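(* Let $E$ be a topological graph. If $E$ has no cycles, then every tracial state on $C^*(E)$ is gauge invariant.
   Context: A topological graph $E=(E^0,E^1,r,s)$ consists of locally compact Hausdorff spaces $E^0,E^1$ (not assumed second countable), a continuous map $r:E^1\to E^0$ and a local homeomorphism $s:E^1\to E^0$. $E^0_{\mathrm{reg}}$ is the largest open set $U\subseteq E^0$ such that $r$ restricts to a proper surjection $r^{-1}(U)\to U$. A path of length $n\ge1$ is a word $\alpha=\alpha_1\cdots\alpha_n$ with $\alpha_i\in E^1$ and $s(\alpha_i)=r(\alpha_{i+1})$; put $r(\alpha)=r(\alpha_1)$, $s(\alpha)=s(\alpha_n)$. A cycle is a path of length at least $1$ with $s(\alpha)=r(\alpha)$. $H(E)$ is the $C^*$-correspondence over $C_0(E^0)$ obtained by completing $C_c(E^1)$ for $\langle\xi,\eta\rangle(v)=\sum_{e\in s^{-1}(v)}\overline{\xi(e)}\eta(e)$, with actions $a\cdot\xi=(a\circ r)\xi$, $\xi\cdot a=\xi(a\circ s)$. A Toeplitz representation $(\pi^0,\pi^1)$ of $E$ on a $C^*$-algebra $A$ is a $*$-homomorphism $\pi^0:C_0(E^0)\to A$ and a linear map $\pi^1:H(E)\to A$ with $\pi^1(\xi)^*\pi^1(\eta)=\pi^0(\langle\xi,\eta\rangle)$ and $\pi^0(a)\pi^1(\xi)=\pi^1(a\xi)$. It induces a $*$-homomorphism $\varphi:\mathbb K(H(E))\to A$ with $\varphi(\xi\otimes\eta^* )=\pi^1(\xi)\pi^1(\eta)^*$, where $(\xi\otimes\eta^*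 )(\zeta)=\xi\langle\eta,\zeta\rangle$. Let $\lambda:C_b(E^1)\to\mathbb B(H(E))$ be pointwise multiplication ($\lambda(\xi)$ is compact iff $\xi\in C_0(E^1)$). The representation is covariant if $\varphi(\lambda(a\circ r))=\pi^0(a)$ for all $a\in C_0(E^0_{\mathrm{reg}})$. $C^*(E)$ is the universal $C^*$-algebra generated by a covariant representation $(\pi^0,\pi^1)$. The gauge action $\gamma$ of $\mathbb T$ on $C^*(E)$ is given by $\gamma_z(\pi^0(a))=\pi^0(a)$, $\gamma_z(\pi^1(\xi))=z\pi^1(\xi)$; a state $\tau$ is gauge invariant if $\tau\circ\gamma_z=\tau$ for all $z\in\mathbb T$. *)

theory Defs
  imports "HOL-Analysis.Analysis"
begin

section \<open>C*-algebras on carrier sets\<close>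

text \<open>The algebras are complex, not necessarily unital, and possibly zero.\<close>

record 'a cstar =
  carrier :: "'a set"
  zer :: 'a ("\<zero>\<index>")
  add :: "'a \<Rightarrow> 'a \<Rightarrow> 'a" (infixl "\<oplus>\<index>" 65)
  scl :: "complex \<Rightarrow> 'a \<Rightarrow> 'a" (infixr "\<odot>\<index>" 75)
  mul :: "'a \<Rightarrow> 'a \<Rightarrow> 'a" (infixl "\<otimes>\<index>" 70)
  star :: "'a \<Rightarrow> 'a"
  nrm :: "'a \<Rightarrow> real"

definition dif :: "'a cstar \<Rightarrow> 'a \<Rightarrow> 'a \<Rightarrow> 'a" where
  "dif A x y = x \<oplus>\<^bsub>A\<^esub> ((-1) \<odot>\<^bsub>A\<^esub> y)"

definition converges :: "'a cstar \<Rightarrow> (nat \<Rightarrow> 'a) \<Rightarrow> 'a \<Rightarrow> bool" where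
  "converges A \<sigma> x \<longleftrightarrow> (\<lambda>n. nrm A (dif A (\<sigma> n) x)) \<longlonglongrightarrow> 0"

definition norm_Cauchy :: "'a cstar \<Rightarrow> (nat \<Rightarrow> 'a) \<Rightarrow> bool" where
  "norm_Cauchy A \<sigma> \<longleftrightarrow>
     (\<forall>\<epsilon>>0. \<exists>N. \<forall>m\<ge>N. \<forall>n\<ge>N. nrm A (dif A (\<sigma> m) (\<sigma> n)) < \<epsilon>)"

locale cstar_algebra =
  fixes A :: "'a cstar" (structure)
  assumes zer_closed: "\<zero> \<in> carrier A"
    and add_closed: "\<lbrakk>x \<in> carrier A; y \<in> carrier A\<rbrakk> \<Longrightarrow> x \<oplus> y \<in> carrier A"
    and scl_closed: "x \<in> carrier A \<Longrightarrow> c \<odot> x \<in> carrier A"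
    and mul_closed: "\<lbrakk>x \<in> carrier A; y \<in> carrier A\<rbrakk> \<Longrightarrow> x \<otimes> y \<in> carrier A"
    and star_closed: "x \<in> carrier A \<Longrightarrow> star A x \<in> carrier A"
    and add_assoc: "\<lbrakk>x \<in> carrier A; y \<in> carrier A; z \<in> carrier A\<rbrakk> \<Longrightarrow> (x \<oplus> y) \<oplus> z = x \<oplus> (y \<oplus> z)"
    and add_comm: "\<lbrakk>x \<in> carrier A; y \<in> carrier A\<rbrakk> \<Longrightarrow> x \<oplus> y = y \<oplus> x"
    and add_zer: "x \<in> carrier A \<Longrightarrow> x \<oplus> \<zero> = x"
    and add_inv: "x \<in> carrier A \<Longrightarrow> x \<oplus> ((-1) \<odot> x) = \<zero>"
    and scl_add: "\<lbrakk>x \<in> carrier A; y \<in> carrier A\<rbrakk> \<Longrightarrow> c \<odot> (x \<oplus> y) = c \<odot> x \<oplus> c \<odot> y"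
    and add_scl: "x \<in> carrier A \<Longrightarrow> (c + d) \<odot> x = c \<odot> x \<oplus> d \<odot> x"
    and scl_scl: "x \<in> carrier A \<Longrightarrow> c \<odot> (d \<odot> x) = (c * d) \<odot> x"
    and scl_one: "x \<in> carrier A \<Longrightarrow> 1 \<odot> x = x"
    and mul_assoc: "\<lbrakk>x \<in> carrier A; y \<in> carrier A; z \<in> carrier A\<rbrakk> \<Longrightarrow> (x \<otimes> y) \<otimes> z = x \<otimes> (y \<otimes> z)"
    and mul_add: "\<lbrakk>x \<in> carrier A; y \<in> carrier A; z \<in> carrier A\<rbrakk> \<Longrightarrow> x \<otimes> (y \<oplus> z) = x \<otimes> y \<oplus> x \<otimes> z"
    and add_mul: "\<lbrakk>x \<in> carrier A; y \<in> carrier A; z \<in> carrier A\<rbrakk> \<Longrightarrow> (x \<oplus> y) \<otimes> z = x \<otimes> z \<oplus> y \<otimes> z"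
    and scl_mul: "\<lbrakk>x \<in> carrier A; y \<in> carrier A\<rbrakk> \<Longrightarrow> (c \<odot> x) \<otimes> y = c \<odot> (x \<otimes> y)"
    and mul_scl: "\<lbrakk>x \<in> carrier A; y \<in> carrier A\<rbrakk> \<Longrightarrow> x \<otimes> (c \<odot> y) = c \<odot> (x \<otimes> y)"
    and star_star: "x \<in> carrier A \<Longrightarrow> star A (star A x) = x"
    and star_add: "\<lbrakk>x \<in> carrier A; y \<in> carrier A\<rbrakk> \<Longrightarrow> star A (x \<oplus> y) = star A x \<oplus> star A y"
    and star_scl: "x \<in> carrier A \<Longrightarrow> star A (c \<odot> x) = cnj c \<odot> star A x"
    and star_mul: "\<lbrakk>x \<in> carrier A; y \<in> carrier A\<rbrakk> \<Longrightarrow> star A (x \<otimes> y) = star A y \<otimes> star A x"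
    and nrm_eq_0: "x \<in> carrier A \<Longrightarrow> nrm A x = 0 \<longleftrightarrow> x = \<zero>"
    and nrm_add: "\<lbrakk>x \<in> carrier A; y \<in> carrier A\<rbrakk> \<Longrightarrow> nrm A (x \<oplus> y) \<le> nrm A x + nrm A y"
    and nrm_scl: "x \<in> carrier A \<Longrightarrow> nrm A (c \<odot> x) = cmod c * nrm A x"
    and nrm_mul: "\<lbrakk>x \<in> carrier A; y \<in> carrier A\<rbrakk> \<Longrightarrow> nrm A (x \<otimes> y) \<le> nrm A x * nrm A y"
    and cstar_identity: "x \<in> carrier A \<Longrightarrow> nrm A (star A x \<otimes> x) = (nrm A x)\<^sup>2"
    and complete: "\<lbrakk>\<And>n. \<sigma> n \<in> carrier A; norm_Cauchy A \<sigma>\<rbrakk> \<Longrightarrow> \<exists>x\<in>carrier A. converges A \<sigma> x"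

text \<open>Between C*-algebras the last clause (contractivity) follows from the algebraic ones.\<close>

definition star_hom :: "'a cstar \<Rightarrow> 'b cstar \<Rightarrow> ('a \<Rightarrow> 'b) \<Rightarrow> bool" where
  "star_hom A B \<phi> \<longleftrightarrow>
     \<phi> \<in> carrier A \<rightarrow> carrier B \<and>
     (\<forall>x\<in>carrier A. \<forall>y\<in>carrier A. \<phi> (x \<oplus>\<^bsub>A\<^esub> y) = \<phi> x \<oplus>\<^bsub>B\<^esub> \<phi> y) \<and>
     (\<forall>c. \<forall>x\<in>carrier A. \<phi> (c \<odot>\<^bsub>A\<^esub> x) = c \<odot>\<^bsub>B\<^esub> \<phi> x) \<and>
     (\<forall>x\<in>carrier A. \<forall>y\<in>carrier A. \<phi> (x \<otimes>\<^bsub>A\<^esub> y) = \<phi> x \<otimes>\<^bsub>B\<^esub> \<phi> y) \<and>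
     (\<forall>x\<in>carrier A. \<phi> (star A x) = star B (\<phi> x)) \<and>
     (\<forall>x\<in>carrier A. nrm B (\<phi> x) \<le> nrm A x)"

definition linear_closed :: "'a cstar \<Rightarrow> 'a set \<Rightarrow> bool" where
  "linear_closed A S \<longleftrightarrow> \<zero>\<^bsub>A\<^esub> \<in> S \<and>
     (\<forall>x\<in>S. \<forall>y\<in>S. x \<oplus>\<^bsub>A\<^esub> y \<in> S) \<and> (\<forall>c. \<forall>x\<in>S. c \<odot>\<^bsub>A\<^esub> x \<in> S)"

definition star_subalgebra :: "'a cstar \<Rightarrow> 'a set \<Rightarrow> bool" where
  "star_subalgebra A S \<longleftrightarrow> S \<subseteq> carrier A \<and> linear_closed A S \<and>
     (\<forall>x\<in>S. \<forall>y\<in>S. x \<otimes>\<^bsub>A\<^esub> y \<in> S) \<and> (\<forall>x\<in>S. star A x \<in> S)"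

definition norm_closed :: "'a cstar \<Rightarrow> 'a set \<Rightarrow> bool" where
  "norm_closed A S \<longleftrightarrow>
     (\<forall>\<sigma>. \<forall>x\<in>carrier A. (\<forall>n. \<sigma> n \<in> S) \<longrightarrow> converges A \<sigma> x \<longrightarrow> x \<in> S)"

text \<open>In a normed space \<open>A\<close> with \<open>G \<subseteq> carrier A\<close>, the carrier is one of the sets in the
  intersection, so \<open>closed_span A G \<subseteq> carrier A\<close>.\<close>

definition closed_span :: "'a cstar \<Rightarrow> 'a set \<Rightarrow> 'a set" where
  "closed_span A G = \<Inter>{S. linear_closed A S \<and> norm_closed A S \<and> G \<subseteq> S}"

definition cstar_generated :: "'a cstar \<Rightarrow> 'a set \<Rightarrow> 'a set" where
  "cstar_generated A G = \<Inter>{S. star_subalgebra A S \<and> norm_closed A S \<and> G \<subseteq> S}"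

definition state :: "'a cstar \<Rightarrow> ('a \<Rightarrow> complex) \<Rightarrow> bool" where
  "state A \<tau> \<longleftrightarrow>
     (\<forall>x\<in>carrier A. \<forall>y\<in>carrier A. \<tau> (x \<oplus>\<^bsub>A\<^esub> y) = \<tau> x + \<tau> y) \<and>
     (\<forall>c. \<forall>x\<in>carrier A. \<tau> (c \<odot>\<^bsub>A\<^esub> x) = c * \<tau> x) \<and>
     (\<forall>x\<in>carrier A. \<tau> (star A x \<otimes>\<^bsub>A\<^esub> x) \<in> \<real>\<^sub>\<ge>\<^sub>0) \<and>
     bdd_above {cmod (\<tau> x) |x. x \<in> carrier A \<and> nrm A x \<le> 1} \<and>
     Sup {cmod (\<tau> x) |x. x \<in> carrier A \<and> nrm A x \<le> 1} = 1"

definition tracial_state :: "'a cstar \<Rightarrow> ('a \<Rightarrow> complex) \<Rightarrow> bool" where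
  "tracial_state A \<tau> \<longleftrightarrow> state A \<tau> \<and>
     (\<forall>x\<in>carrier A. \<forall>y\<in>carrier A. \<tau> (x \<otimes>\<^bsub>A\<^esub> y) = \<tau> (y \<otimes>\<^bsub>A\<^esub> x))"


section \<open>Function algebras\<close>

text \<open>Functions on a space \<open>X\<close> are total functions that vanish off \<open>topspace X\<close>, so that
  equality of functions is equality on \<open>X\<close>.  For \<open>U\<close> open in a Hausdorff space \<open>X\<close>,
  \<open>C0 (subtopology X U)\<close> thereby sits inside \<open>C0 X\<close> by extension by zero.\<close>

definition C0 :: "'x topology \<Rightarrow> ('x \<Rightarrow> complex) set" where
  "C0 X = {f. continuous_map X euclidean f \<and> (\<forall>x. x \<notin> topspace X \<longrightarrow> f x = 0) \<and>
     (\<forall>\<epsilon>>0. compactin X {x \<in> topspace X. \<epsilon> \<le> cmod (f x)})}"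

definition Cc :: "'x topology \<Rightarrow> ('x \<Rightarrow> complex) set" where
  "Cc X = {f. continuous_map X euclidean f \<and> (\<forall>x. x \<notin> topspace X \<longrightarrow> f x = 0) \<and>
     compactin X (X closure_of {x \<in> topspace X. f x \<noteq> 0})}"

definition C0_algebra :: "'x topology \<Rightarrow> ('x \<Rightarrow> complex) cstar" where
  "C0_algebra X = \<lparr>carrier = C0 X, zer = (\<lambda>x. 0), add = (\<lambda>f g x. f x + g x),
     scl = (\<lambda>c f x. c * f x), mul = (\<lambda>f g x. f x * g x), star = (\<lambda>f x. cnj (f x)),
     nrm = (\<lambda>f. SUP x. cmod (f x))\<rparr>"


section \<open>Topological graphs\<close>

record ('v, 'e) top_graph =
  vertices :: "'v topology"
  edges :: "'e topology"
  rng :: "'e \<Rightarrow> 'v"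
  src :: "'e \<Rightarrow> 'v"

definition local_homeomorphism :: "'x topology \<Rightarrow> 'y topology \<Rightarrow> ('x \<Rightarrow> 'y) \<Rightarrow> bool" where
  "local_homeomorphism X Y f \<longleftrightarrow> f \<in> topspace X \<rightarrow> topspace Y \<and>
     (\<forall>x\<in>topspace X. \<exists>U. openin X U \<and> x \<in> U \<and> openin Y (f ` U) \<and>
        homeomorphic_map (subtopology X U) (subtopology Y (f ` U)) f)"

definition topological_graph :: "('v, 'e) top_graph \<Rightarrow> bool" where
  "topological_graph E \<longleftrightarrow>
     locally_compact_space (vertices E) \<and> Hausdorff_space (vertices E) \<and>
     locally_compact_space (edges E) \<and> Hausdorff_space (edges E) \<and>
     continuous_map (edges E) (vertices E) (rng E) \<and>
     local_homeomorphism (edges E) (vertices E) (src E)"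

definition regular_open :: "('v, 'e) top_graph \<Rightarrow> 'v set \<Rightarrow> bool" where
  "regular_open E U \<longleftrightarrow> openin (vertices E) U \<and>
     proper_map (subtopology (edges E) {e \<in> topspace (edges E). rng E e \<in> U})
       (subtopology (vertices E) U) (rng E) \<and>
     rng E ` {e \<in> topspace (edges E). rng E e \<in> U} = U"

text \<open>The union of all such sets is again one of them, hence the largest one.\<close>

definition regular_vertices :: "('v, 'e) top_graph \<Rightarrow> 'v set" where
  "regular_vertices E = \<Union>{U. regular_open E U}"

definition graph_path :: "('v, 'e) top_graph \<Rightarrow> 'e list \<Rightarrow> bool" where
  "graph_path E \<alpha> \<longleftrightarrow> \<alpha> \<noteq> [] \<and> set \<alpha> \<subseteq> topspace (edges E) \<and>
     successively (\<lambda>e f. src E e = rng E f) \<alpha>"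

definition cycle :: "('v, 'e) top_graph \<Rightarrow> 'e list \<Rightarrow> bool" where
  "cycle E \<alpha> \<longleftrightarrow> graph_path E \<alpha> \<and> src E (last \<alpha>) = rng E (hd \<alpha>)"


section \<open>The graph correspondence\<close>

definition ip :: "('v, 'e) top_graph \<Rightarrow> ('e \<Rightarrow> complex) \<Rightarrow> ('e \<Rightarrow> complex) \<Rightarrow> 'v \<Rightarrow> complex" where
  "ip E \<xi> \<eta> v = (\<Sum>\<^sub>\<infinity>e\<in>{e \<in> topspace (edges E). src E e = v}. cnj (\<xi> e) * \<eta> e)"

definition hnrm :: "('v, 'e) top_graph \<Rightarrow> ('e \<Rightarrow> complex) \<Rightarrow> real" where
  "hnrm E \<xi> = sqrt (SUP v. Re (ip E \<xi> \<xi> v))"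

text \<open>The completion of \<open>Cc\<close> of the edge space.  The norm dominates the supremum norm, so a
  Cauchy sequence converges pointwise; two Cauchy sequences have the same pointwise limit iff
  their difference tends to zero in norm.  Each point of the completion is therefore represented
  by a function on the edges, and the extended inner product and actions are given by the same
  formulas.\<close>

definition H :: "('v, 'e) top_graph \<Rightarrow> ('e \<Rightarrow> complex) set" where
  "H E = {\<xi>. \<exists>\<sigma>. (\<forall>n. \<sigma> n \<in> Cc (edges E)) \<and>
     (\<forall>\<epsilon>>0. \<exists>N. \<forall>m\<ge>N. \<forall>n\<ge>N. hnrm E (\<lambda>e. \<sigma> m e - \<sigma> n e) < \<epsilon>) \<and>
     (\<forall>e. (\<lambda>n. \<sigma> n e) \<longlonglongrightarrow> \<xi> e)}"

definition is_adjoint ::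
  "('v, 'e) top_graph \<Rightarrow> (('e \<Rightarrow> complex) \<Rightarrow> 'e \<Rightarrow> complex) \<Rightarrow> (('e \<Rightarrow> complex) \<Rightarrow> 'e \<Rightarrow> complex) \<Rightarrow> bool"
  where
  "is_adjoint E T S \<longleftrightarrow> T \<in> H E \<rightarrow>\<^sub>E H E \<and> S \<in> H E \<rightarrow>\<^sub>E H E \<and>
     (\<forall>\<xi>\<in>H E. \<forall>\<eta>\<in>H E. ip E (T \<xi>) \<eta> = ip E \<xi> (S \<eta>))"

text \<open>The adjointable operators on \<open>H E\<close>.  As usual, adjointability implies linearity and
  boundedness.\<close>

definition adjointable_algebra ::
  "('v, 'e) top_graph \<Rightarrow> (('e \<Rightarrow> complex) \<Rightarrow> 'e \<Rightarrow> complex) cstar" where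
  "adjointable_algebra E = \<lparr>carrier = {T. \<exists>S. is_adjoint E T S},
     zer = (\<lambda>\<xi>\<in>H E. \<lambda>e. 0),
     add = (\<lambda>T S. \<lambda>\<xi>\<in>H E. \<lambda>e. T \<xi> e + S \<xi> e),
     scl = (\<lambda>c T. \<lambda>\<xi>\<in>H E. \<lambda>e. c * T \<xi> e),
     mul = (\<lambda>T S. \<lambda>\<xi>\<in>H E. T (S \<xi>)),
     star = (\<lambda>T. THE S. is_adjoint E T S),
     nrm = (\<lambda>T. SUP \<xi>\<in>{\<xi> \<in> H E. hnrm E \<xi> \<le> 1}. hnrm E (T \<xi>))\<rparr>"

definition rank_one ::
  "('v, 'e) top_graph \<Rightarrow> ('e \<Rightarrow> complex) \<Rightarrow> ('e \<Rightarrow> complex) \<Rightarrow> ('e \<Rightarrow> complex) \<Rightarrow> 'e \<Rightarrow> complex" where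
  "rank_one E \<xi> \<eta> = (\<lambda>\<zeta>\<in>H E. \<lambda>e. \<xi> e * ip E \<eta> \<zeta> (src E e))"

definition compact_algebra ::
  "('v, 'e) top_graph \<Rightarrow> (('e \<Rightarrow> complex) \<Rightarrow> 'e \<Rightarrow> complex) cstar" where
  "compact_algebra E = (adjointable_algebra E)
     \<lparr>carrier := closed_span (adjointable_algebra E) {rank_one E \<xi> \<eta> |\<xi> \<eta>. \<xi> \<in> H E \<and> \<eta> \<in> H E}\<rparr>"

definition mult_op ::
  "('v, 'e) top_graph \<Rightarrow> ('e \<Rightarrow> complex) \<Rightarrow> ('e \<Rightarrow> complex) \<Rightarrow> 'e \<Rightarrow> complex" where
  "mult_op E f = (\<lambda>\<zeta>\<in>H E. \<lambda>e. f e * \<zeta> e)"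


section \<open>The C*-algebra of a topological graph\<close>

definition toeplitz_rep ::
  "('v, 'e) top_graph \<Rightarrow> 'a cstar \<Rightarrow> (('v \<Rightarrow> complex) \<Rightarrow> 'a) \<Rightarrow> (('e \<Rightarrow> complex) \<Rightarrow> 'a) \<Rightarrow> bool" where
  "toeplitz_rep E A \<pi>0 \<pi>1 \<longleftrightarrow>
     star_hom (C0_algebra (vertices E)) A \<pi>0 \<and>
     \<pi>1 \<in> H E \<rightarrow> carrier A \<and>
     (\<forall>\<xi>\<in>H E. \<forall>\<eta>\<in>H E. \<pi>1 (\<lambda>e. \<xi> e + \<eta> e) = \<pi>1 \<xi> \<oplus>\<^bsub>A\<^esub> \<pi>1 \<eta>) \<and>
     (\<forall>c. \<forall>\<xi>\<in>H E. \<pi>1 (\<lambda>e. c * \<xi> e) = c \<odot>\<^bsub>A\<^esub> \<pi>1 \<xi>) \<and>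
     (\<forall>\<xi>\<in>H E. \<forall>\<eta>\<in>H E. star A (\<pi>1 \<xi>) \<otimes>\<^bsub>A\<^esub> \<pi>1 \<eta> = \<pi>0 (ip E \<xi> \<eta>)) \<and>
     (\<forall>a\<in>C0 (vertices E). \<forall>\<xi>\<in>H E. \<pi>0 a \<otimes>\<^bsub>A\<^esub> \<pi>1 \<xi> = \<pi>1 (\<lambda>e. a (rng E e) * \<xi> e))"

text \<open>The induced homomorphism is determined on the rank-one operators, hence on all compact
  operators.\<close>

definition induced_hom ::
  "('v, 'e) top_graph \<Rightarrow> 'a cstar \<Rightarrow> (('e \<Rightarrow> complex) \<Rightarrow> 'a)
     \<Rightarrow> ((('e \<Rightarrow> complex) \<Rightarrow> 'e \<Rightarrow> complex) \<Rightarrow> 'a) \<Rightarrow> bool" where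
  "induced_hom E A \<pi>1 \<phi> \<longleftrightarrow> star_hom (compact_algebra E) A \<phi> \<and>
     (\<forall>\<xi>\<in>H E. \<forall>\<eta>\<in>H E. \<phi> (rank_one E \<xi> \<eta>) = \<pi>1 \<xi> \<otimes>\<^bsub>A\<^esub> star A (\<pi>1 \<eta>))"

definition covariant_rep ::
  "('v, 'e) top_graph \<Rightarrow> 'a cstar \<Rightarrow> (('v \<Rightarrow> complex) \<Rightarrow> 'a) \<Rightarrow> (('e \<Rightarrow> complex) \<Rightarrow> 'a) \<Rightarrow> bool" where
  "covariant_rep E A \<pi>0 \<pi>1 \<longleftrightarrow> toeplitz_rep E A \<pi>0 \<pi>1 \<and>
     (\<exists>\<phi>. induced_hom E A \<pi>1 \<phi> \<and>
        (\<forall>a\<in>C0 (subtopology (vertices E) (regular_vertices E)).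
           \<phi> (mult_op E (a \<circ> rng E)) = \<pi>0 a))"

definition factors_through ::
  "('v, 'e) top_graph \<Rightarrow> 'a cstar \<Rightarrow> (('v \<Rightarrow> complex) \<Rightarrow> 'a) \<Rightarrow> (('e \<Rightarrow> complex) \<Rightarrow> 'a)
     \<Rightarrow> 'b cstar \<Rightarrow> (('v \<Rightarrow> complex) \<Rightarrow> 'b) \<Rightarrow> (('e \<Rightarrow> complex) \<Rightarrow> 'b) \<Rightarrow> ('a \<Rightarrow> 'b) \<Rightarrow> bool" where
  "factors_through E A \<pi>0 \<pi>1 B \<rho>0 \<rho>1 \<psi> \<longleftrightarrow> star_hom A B \<psi> \<and>
     (\<forall>a\<in>C0 (vertices E). \<psi> (\<pi>0 a) = \<rho>0 a) \<and> (\<forall>\<xi>\<in>H E. \<psi> (\<pi>1 \<xi>) = \<rho>1 \<xi>)"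

datatype ('v, 'e) star_poly =
  Gen0 "'v \<Rightarrow> complex" | Gen1 "'e \<Rightarrow> complex"
  | Add "('v, 'e) star_poly" "('v, 'e) star_poly" | Scl complex "('v, 'e) star_poly"
  | Mul "('v, 'e) star_poly" "('v, 'e) star_poly" | Star "('v, 'e) star_poly"

text \<open>\<open>A\<close> together with \<open>\<pi>0\<close>, \<open>\<pi>1\<close> is (a model of) \<open>C*(E)\<close>.  The logic does not quantify over
  types inside a formula, so the test algebras \<open>B\<close> live on one type, that of sequences of formal
  *-polynomials in the generators.  That type is large enough for every C*-algebra generated by a
  covariant representation, and the property for test algebras on arbitrary types follows: see
  \<open>graph_algebra_universal\<close> below.\<close>

definition graph_algebra ::
  "('v, 'e) top_graph \<Rightarrow> 'a cstar \<Rightarrow> (('v \<Rightarrow> complex) \<Rightarrow> 'a) \<Rightarrow> (('e \<Rightarrow> complex) \<Rightarrow> 'a) \<Rightarrow> bool" where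
  "graph_algebra E A \<pi>0 \<pi>1 \<longleftrightarrow> cstar_algebra A \<and> covariant_rep E A \<pi>0 \<pi>1 \<and>
     cstar_generated A (\<pi>0 ` C0 (vertices E) \<union> \<pi>1 ` H E) = carrier A \<and>
     (\<forall>(B :: (nat \<Rightarrow> ('v, 'e) star_poly) cstar) \<rho>0 \<rho>1.
        cstar_algebra B \<and> covariant_rep E B \<rho>0 \<rho>1 \<longrightarrow>
        (\<exists>\<psi>. factors_through E A \<pi>0 \<pi>1 B \<rho>0 \<rho>1 \<psi>))"

definition gauge_action ::
  "('v, 'e) top_graph \<Rightarrow> 'a cstar \<Rightarrow> (('v \<Rightarrow> complex) \<Rightarrow> 'a) \<Rightarrow> (('e \<Rightarrow> complex) \<Rightarrow> 'a)
     \<Rightarrow> complex \<Rightarrow> 'a \<Rightarrow> 'a" where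
  "gauge_action E A \<pi>0 \<pi>1 z = (THE \<gamma>. \<gamma> \<in> extensional (carrier A) \<and> star_hom A A \<gamma> \<and>
     (\<forall>a\<in>C0 (vertices E). \<gamma> (\<pi>0 a) = \<pi>0 a) \<and> (\<forall>\<xi>\<in>H E. \<gamma> (\<pi>1 \<xi>) = z \<odot>\<^bsub>A\<^esub> \<pi>1 \<xi>))"

definition gauge_invariant ::
  "('v, 'e) top_graph \<Rightarrow> 'a cstar \<Rightarrow> (('v \<Rightarrow> complex) \<Rightarrow> 'a) \<Rightarrow> (('e \<Rightarrow> complex) \<Rightarrow> 'a)
     \<Rightarrow> ('a \<Rightarrow> complex) \<Rightarrow> bool" where
  "gauge_invariant E A \<pi>0 \<pi>1 \<tau> \<longleftrightarrow>
     (\<forall>z. cmod z = 1 \<longrightarrow> (\<forall>x\<in>carrier A. \<tau> (gauge_action E A \<pi>0 \<pi>1 z x) = \<tau> x))"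


section \<open>The universal property for test algebras on arbitrary types\<close>

context cstar_algebra
begin

lemma dif_closed: "\<lbrakk>x \<in> carrier A; y \<in> carrier A\<rbrakk> \<Longrightarrow> dif A x y \<in> carrier A"
  by (simp add: dif_def add_closed scl_closed)

lemma dif_self: "x \<in> carrier A \<Longrightarrow> dif A x x = \<zero>"
  by (simp add: dif_def add_inv)

lemma nrm_zer: "nrm A \<zero> = 0"
  using nrm_eq_0 zer_closed by blast

lemma scl_0: "x \<in> carrier A \<Longrightarrow> 0 \<odot> x = \<zero>"
  using add_scl[of x 1 "-1"] scl_one add_inv by simp

lemma add_left_comm:
  "\<lbrakk>x \<in> carrier A; y \<in> carrier A; z \<in> carrier A\<rbrakk> \<Longrightarrow> x \<oplus> (y \<oplus> z) = y \<oplus> (x \<oplus> z)"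
  by (metis add_assoc add_comm)

lemmas add_ac = add_assoc add_comm add_left_comm

lemma dif_trans:
  assumes "x \<in> carrier A" "y \<in> carrier A" "z \<in> carrier A"
  shows "dif A x y \<oplus> dif A y z = dif A x z"
proof -
  have "dif A x y \<oplus> dif A y z = x \<oplus> ((y \<oplus> (-1) \<odot> y) \<oplus> (-1) \<odot> z)"
    using assms by (simp add: dif_def add_ac add_closed scl_closed)
  also have "\<dots> = x \<oplus> (-1) \<odot> z"
    using assms add_zer[of "(-1) \<odot> z"] add_comm[of "\<zero>" "(-1) \<odot> z"]
    by (simp add: add_inv zer_closed scl_closed)
  finally show ?thesis by (simp add: dif_def)
qed

lemma nrm_tri:
  "\<lbrakk>x \<in> carrier A; y \<in> carrier A; z \<in> carrier A\<rbrakk>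
   \<Longrightarrow> nrm A (dif A x z) \<le> nrm A (dif A x y) + nrm A (dif A y z)"
  by (metis dif_closed dif_trans nrm_add)

lemma nrm_nonneg: "x \<in> carrier A \<Longrightarrow> 0 \<le> nrm A x"
  using nrm_add[of x "(-1) \<odot> x"] nrm_scl[of x "-1"] by (simp add: add_inv nrm_zer scl_closed)

lemma dif_swap: "\<lbrakk>x \<in> carrier A; y \<in> carrier A\<rbrakk> \<Longrightarrow> dif A y x = (-1) \<odot> dif A x y"
  by (simp add: dif_def scl_add scl_scl scl_closed scl_one add_comm)

lemma nrm_swap: "\<lbrakk>x \<in> carrier A; y \<in> carrier A\<rbrakk> \<Longrightarrow> nrm A (dif A y x) = nrm A (dif A x y)"
  by (subst dif_swap) (simp_all add: nrm_scl dif_closed)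

lemma dif_eq: "\<lbrakk>x \<in> carrier A; y \<in> carrier A; dif A x y = \<zero>\<rbrakk> \<Longrightarrow> x = y"
  using dif_trans[of x y "\<zero>"] add_comm add_zer
  by (metis add_assoc add_inv dif_def scl_closed)

lemma star_mono: "x \<in> carrier A \<Longrightarrow> nrm A x \<le> nrm A (star A x)"
proof -
  assume x: "x \<in> carrier A"
  have "nrm A x * nrm A x \<le> nrm A (star A x) * nrm A x"
    using cstar_identity[OF x] nrm_mul[OF star_closed[OF x] x] by (simp add: power2_eq_square)
  then show ?thesis
    using nrm_nonneg[OF x] nrm_nonneg[OF star_closed[OF x]]
    by (metis mult_right_le_imp_le order_le_less)
qed

lemma nrm_star: "x \<in> carrier A \<Longrightarrow> nrm A (star A x) = nrm A x"
  using star_mono[of x] star_mono[of "star A x"] star_closed star_star by fastforce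

lemma dif_add:
  assumes "x \<in> carrier A" "y \<in> carrier A" "x' \<in> carrier A" "y' \<in> carrier A"
  shows "dif A (x \<oplus> y) (x' \<oplus> y') = dif A x x' \<oplus> dif A y y'"
  using assms by (simp add: dif_def scl_add add_ac add_closed scl_closed)

lemma dif_scl:
  "\<lbrakk>x \<in> carrier A; y \<in> carrier A\<rbrakk> \<Longrightarrow> dif A (c \<odot> x) (c \<odot> y) = c \<odot> dif A x y"
  by (simp add: dif_def scl_add scl_scl scl_closed)

lemma dif_star:
  "\<lbrakk>x \<in> carrier A; y \<in> carrier A\<rbrakk> \<Longrightarrow> dif A (star A x) (star A y) = star A (dif A x y)"
  by (simp add: dif_def star_add star_scl scl_closed)

lemma dif_mul:
  assumes "x \<in> carrier A" "y \<in> carrier A" "x' \<in> carrier A" "y' \<in> carrier A"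
  shows "dif A (x \<otimes> y) (x' \<otimes> y') = dif A x x' \<otimes> y \<oplus> x' \<otimes> dif A y y'"
proof -
  have "dif A x x' \<otimes> y = dif A (x \<otimes> y) (x' \<otimes> y)" "x' \<otimes> dif A y y' = dif A (x' \<otimes> y) (x' \<otimes> y')"
    using assms by (simp_all add: dif_def add_mul mul_add scl_mul mul_scl scl_closed)
  then show ?thesis using assms by (simp add: dif_trans mul_closed)
qed

lemma converges_add:
  assumes "converges A \<sigma> x" "converges A \<tau> y" "\<And>n. \<sigma> n \<in> carrier A" "\<And>n. \<tau> n \<in> carrier A"
    "x \<in> carrier A" "y \<in> carrier A"
  shows "converges A (\<lambda>n. \<sigma> n \<oplus> \<tau> n) (x \<oplus> y)"
  unfolding converges_def
proof (rule tendsto_sandwich[OF _ _ tendsto_const])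
  show "(\<lambda>n. nrm A (dif A (\<sigma> n) x) + nrm A (dif A (\<tau> n) y)) \<longlonglongrightarrow> 0"
    using tendsto_add[OF assms(1,2)[unfolded converges_def]] by simp
  show "\<forall>\<^sub>F n in sequentially. 0 \<le> nrm A (dif A (\<sigma> n \<oplus> \<tau> n) (x \<oplus> y))"
    using assms by (simp add: nrm_nonneg dif_closed add_closed)
  show "\<forall>\<^sub>F n in sequentially. nrm A (dif A (\<sigma> n \<oplus> \<tau> n) (x \<oplus> y))
          \<le> nrm A (dif A (\<sigma> n) x) + nrm A (dif A (\<tau> n) y)"
    using assms by (simp add: dif_add nrm_add dif_closed)
qed

lemma converges_scl:
  assumes "converges A \<sigma> x" "\<And>n. \<sigma> n \<in> carrier A" "x \<in> carrier A"
  shows "converges A (\<lambda>n. c \<odot> \<sigma> n) (c \<odot> x)"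
  using tendsto_mult_right_zero[OF assms(1)[unfolded converges_def], of "cmod c"] assms
  by (simp add: converges_def dif_scl nrm_scl dif_closed)

lemma converges_star:
  assumes "converges A \<sigma> x" "\<And>n. \<sigma> n \<in> carrier A" "x \<in> carrier A"
  shows "converges A (\<lambda>n. star A (\<sigma> n)) (star A x)"
  using assms by (simp add: converges_def dif_star nrm_star dif_closed)

lemma nrm_dif_le: "\<lbrakk>x \<in> carrier A; y \<in> carrier A\<rbrakk> \<Longrightarrow> nrm A x \<le> nrm A (dif A x y) + nrm A y"
proof -
  assume xy: "x \<in> carrier A" "y \<in> carrier A"
  have "dif A x y \<oplus> y = x"
    using xy by (simp add: dif_def add_ac add_closed scl_closed)
      (metis add_assoc add_comm add_inv add_zer scl_closed)
  then show ?thesis using xy by (metis dif_closed nrm_add)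
qed

lemma converges_mul:
  assumes "converges A \<sigma> x" "converges A \<tau> y" "\<And>n. \<sigma> n \<in> carrier A" "\<And>n. \<tau> n \<in> carrier A"
    "x \<in> carrier A" "y \<in> carrier A"
  shows "converges A (\<lambda>n. \<sigma> n \<otimes> \<tau> n) (x \<otimes> y)"
  unfolding converges_def
proof (rule tendsto_sandwich[OF _ _ tendsto_const])
  let ?b = "\<lambda>n. nrm A (dif A (\<sigma> n) x) * (nrm A (dif A (\<tau> n) y) + nrm A y)
                + nrm A x * nrm A (dif A (\<tau> n) y)"
  have "?b \<longlonglongrightarrow> 0 * (0 + nrm A y) + nrm A x * 0"
    using assms(1,2) unfolding converges_def by (intro tendsto_intros)
  then show "?b \<longlonglongrightarrow> 0" by simp
  show "\<forall>\<^sub>F n in sequentially. 0 \<le> nrm A (dif A (\<sigma> n \<otimes> \<tau> n) (x \<otimes> y))"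
    using assms by (simp add: nrm_nonneg dif_closed mul_closed)
  have "nrm A (dif A (\<sigma> n \<otimes> \<tau> n) (x \<otimes> y)) \<le> ?b n" for n
  proof -
    have "nrm A (dif A (\<sigma> n \<otimes> \<tau> n) (x \<otimes> y))
        \<le> nrm A (dif A (\<sigma> n) x \<otimes> \<tau> n) + nrm A (x \<otimes> dif A (\<tau> n) y)"
      using assms by (simp add: dif_mul nrm_add dif_closed mul_closed)
    also have "\<dots> \<le> nrm A (dif A (\<sigma> n) x) * nrm A (\<tau> n) + nrm A x * nrm A (dif A (\<tau> n) y)"
      using assms by (intro add_mono nrm_mul dif_closed) auto
    also have "\<dots> \<le> ?b n"
      using assms by (intro add_mono mult_left_mono nrm_dif_le nrm_nonneg dif_closed) auto
    finally show ?thesis .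
  qed
  then show "\<forall>\<^sub>F n in sequentially. nrm A (dif A (\<sigma> n \<otimes> \<tau> n) (x \<otimes> y)) \<le> ?b n" by simp
qed

lemma converges_unique:
  assumes "converges A \<sigma> x" "converges A \<sigma> y" "\<And>n. \<sigma> n \<in> carrier A" "x \<in> carrier A" "y \<in> carrier A"
  shows "x = y"
proof -
  have "(\<lambda>n. nrm A (dif A (\<sigma> n) x) + nrm A (dif A (\<sigma> n) y)) \<longlonglongrightarrow> 0"
    using tendsto_add[OF assms(1,2)[unfolded converges_def]] by simp
  moreover have "nrm A (dif A x y) \<le> nrm A (dif A (\<sigma> n) x) + nrm A (dif A (\<sigma> n) y)" for n
    using nrm_tri[of x "\<sigma> n" y] nrm_swap[of "\<sigma> n" x] assms by simp
  ultimately have "nrm A (dif A x y) \<le> 0"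
    by (meson LIMSEQ_le_const)
  then show ?thesis using assms
    by (metis dif_closed dif_eq nrm_eq_0 nrm_nonneg order_antisym)
qed

text \<open>The closure of a *-subalgebra.\<close>

lemma closure_star_subalgebra:
  assumes S: "star_subalgebra A S"
  defines "T \<equiv> {x \<in> carrier A. \<exists>\<sigma>. (\<forall>n. \<sigma> n \<in> S) \<and> converges A \<sigma> x}"
  shows "star_subalgebra A T" "norm_closed A T" "S \<subseteq> T"
proof -
  have SA: "S \<subseteq> carrier A" "\<zero> \<in> S" using S by (auto simp: star_subalgebra_def linear_closed_def)
  show ST: "S \<subseteq> T"
  proof
    fix x assume "x \<in> S"
    then have "x \<in> carrier A" "converges A (\<lambda>n. x) x"
      using SA by (auto simp: converges_def dif_self nrm_zer)
    then show "x \<in> T" unfolding T_def using \<open>x \<in> S\<close>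
      by (intro CollectI conjI exI[of _ "\<lambda>n. x"]) auto
  qed
  have memT: "x \<in> T" if "x \<in> carrier A" "\<And>n. \<sigma> n \<in> S" "converges A \<sigma> x" for x \<sigma>
    unfolding T_def using that(1) by (intro CollectI conjI exI[of _ \<sigma>] allI that(2,3))
  have add: "x \<oplus> y \<in> T" and mul: "x \<otimes> y \<in> T" if xy: "x \<in> T" "y \<in> T" for x y
  proof -
    obtain \<sigma> \<tau> where *: "\<And>n. \<sigma> n \<in> S" "\<And>n. \<tau> n \<in> S" "converges A \<sigma> x" "converges A \<tau> y"
        "x \<in> carrier A" "y \<in> carrier A"
      using xy unfolding T_def by blast
    have c: "\<sigma> n \<in> carrier A" "\<tau> n \<in> carrier A" for n
      using subsetD[OF SA(1)] *(1,2) by blast+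
    have "converges A (\<lambda>n. \<sigma> n \<oplus> \<tau> n) (x \<oplus> y)" "converges A (\<lambda>n. \<sigma> n \<otimes> \<tau> n) (x \<otimes> y)"
      by (rule converges_add[OF *(3,4) c *(5,6)], rule converges_mul[OF *(3,4) c *(5,6)])
    moreover have "\<sigma> n \<oplus> \<tau> n \<in> S" "\<sigma> n \<otimes> \<tau> n \<in> S" for n
      using *(1,2) S by (simp_all add: star_subalgebra_def linear_closed_def)
    moreover have "x \<oplus> y \<in> carrier A" "x \<otimes> y \<in> carrier A"
      using *(5,6) by (simp_all add: add_closed mul_closed)
    ultimately show "x \<oplus> y \<in> T" "x \<otimes> y \<in> T"
      using memT[of "x \<oplus> y" "\<lambda>n. \<sigma> n \<oplus> \<tau> n"] memT[of "x \<otimes> y" "\<lambda>n. \<sigma> n \<otimes> \<tau> n"] by simp_all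
  qed
  have scl: "c \<odot> x \<in> T" and star: "star A x \<in> T" if x: "x \<in> T" for x c
  proof -
    obtain \<sigma> where *: "\<And>n. \<sigma> n \<in> S" "converges A \<sigma> x" "x \<in> carrier A"
      using x unfolding T_def by blast
    have c: "\<sigma> n \<in> carrier A" for n using *(1) SA(1) by (rule subsetD[rotated])
    have "converges A (\<lambda>n. c \<odot> \<sigma> n) (c \<odot> x)" "converges A (\<lambda>n. star A (\<sigma> n)) (star A x)"
      by (rule converges_scl[OF *(2) c *(3)], rule converges_star[OF *(2) c *(3)])
    moreover have "c \<odot> \<sigma> n \<in> S" "star A (\<sigma> n) \<in> S" for n
      using *(1) S by (simp_all add: star_subalgebra_def linear_closed_def)
    moreover have "c \<odot> x \<in> carrier A" "star A x \<in> carrier A"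
      using *(3) by (simp_all add: scl_closed star_closed)
    ultimately show "c \<odot> x \<in> T" "star A x \<in> T"
      using memT[of "c \<odot> x" "\<lambda>n. c \<odot> \<sigma> n"] memT[of "star A x" "\<lambda>n. star A (\<sigma> n)"] by simp_all
  qed
  have TA: "T \<subseteq> carrier A" unfolding T_def by blast
  show "star_subalgebra A T"
    unfolding star_subalgebra_def linear_closed_def
    by (intro conjI allI ballI TA subsetD[OF ST SA(2)] add mul scl star)
  show "norm_closed A T"
    unfolding norm_closed_def
  proof (intro allI ballI impI)
    fix \<sigma> x assume x: "x \<in> carrier A" and \<sigma>: "\<forall>n. \<sigma> n \<in> T" and lim: "converges A \<sigma> x"
    have "\<exists>y\<in>S. nrm A (dif A y (\<sigma> n)) < inverse (real (Suc n))" for n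
    proof -
      obtain \<tau> where \<tau>: "\<And>k. \<tau> k \<in> S" "converges A \<tau> (\<sigma> n)" using \<sigma> unfolding T_def by blast
      have "\<forall>\<^sub>F k in sequentially. nrm A (dif A (\<tau> k) (\<sigma> n)) < inverse (real (Suc n))"
        using \<tau>(2) unfolding converges_def by (rule order_tendstoD) simp
      then obtain k where "nrm A (dif A (\<tau> k) (\<sigma> n)) < inverse (real (Suc n))"
        by (auto simp: eventually_sequentially)
      then show ?thesis using \<tau>(1) by (rule bexI)
    qed
    then have "\<exists>\<tau>. \<forall>n. \<tau> n \<in> S \<and> nrm A (dif A (\<tau> n) (\<sigma> n)) < inverse (real (Suc n))"
      by (intro choice allI) (simp add: Bex_def)
    then obtain \<tau> where \<tau>: "\<And>n. \<tau> n \<in> S" "\<And>n. nrm A (dif A (\<tau> n) (\<sigma> n)) < inverse (real (Suc n))"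
      by auto
    have c: "\<tau> n \<in> carrier A" "\<sigma> n \<in> carrier A" for n
      using subsetD[OF SA(1) \<tau>(1)] subsetD[OF TA] \<sigma> by simp_all
    have "(\<lambda>n. nrm A (dif A (\<tau> n) x)) \<longlonglongrightarrow> 0"
    proof (rule tendsto_sandwich[OF _ _ tendsto_const])
      show "(\<lambda>n. inverse (real (Suc n)) + nrm A (dif A (\<sigma> n) x)) \<longlonglongrightarrow> 0"
        using tendsto_add[OF LIMSEQ_inverse_real_of_nat lim[unfolded converges_def]] by simp
      show "\<forall>\<^sub>F n in sequentially. 0 \<le> nrm A (dif A (\<tau> n) x)"
        using c x by (simp add: nrm_nonneg dif_closed)
      have "nrm A (dif A (\<tau> n) x) \<le> inverse (real (Suc n)) + nrm A (dif A (\<sigma> n) x)" for n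
        using nrm_tri[of "\<tau> n" "\<sigma> n" x] \<tau>(2)[of n] c x by simp
      then show "\<forall>\<^sub>F n in sequentially. nrm A (dif A (\<tau> n) x)
          \<le> inverse (real (Suc n)) + nrm A (dif A (\<sigma> n) x)" by simp
    qed
    then show "x \<in> T" using memT[of x \<tau>] x \<tau>(1) by (simp add: converges_def)
  qed
qed

end

definition sub_cstar :: "'a cstar \<Rightarrow> 'a set \<Rightarrow> 'a cstar" where
  "sub_cstar A S = A\<lparr>carrier := S\<rparr>"

lemma sub_cstar_simps [simp]:
  "carrier (sub_cstar A S) = S" "zer (sub_cstar A S) = zer A" "add (sub_cstar A S) = add A"
  "scl (sub_cstar A S) = scl A" "mul (sub_cstar A S) = mul A" "star (sub_cstar A S) = star A"
  "nrm (sub_cstar A S) = nrm A" "dif (sub_cstar A S) = dif A"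
  "converges (sub_cstar A S) = converges A" "norm_Cauchy (sub_cstar A S) = norm_Cauchy A"
  by (simp_all add: sub_cstar_def dif_def converges_def norm_Cauchy_def fun_eq_iff)

lemma sub_cstar_algebra:
  fixes A :: "'a cstar" (structure)
  assumes A: "cstar_algebra A" and S: "star_subalgebra A S" "norm_closed A S"
  shows "cstar_algebra (sub_cstar A S)"
proof -
  interpret cstar_algebra A by fact
  have SA: "x \<in> S \<Longrightarrow> x \<in> carrier A" for x
    using S by (auto simp: star_subalgebra_def)
  have cl: "\<zero> \<in> S" "\<And>x y. x \<in> S \<Longrightarrow> y \<in> S \<Longrightarrow> x \<oplus> y \<in> S" "\<And>c x. x \<in> S \<Longrightarrow> c \<odot> x \<in> S"
    "\<And>x y. x \<in> S \<Longrightarrow> y \<in> S \<Longrightarrow> x \<otimes> y \<in> S" "\<And>x. x \<in> S \<Longrightarrow> star A x \<in> S"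
    using S by (auto simp: star_subalgebra_def linear_closed_def)
  show ?thesis
  proof (unfold_locales, goal_cases)
    case (28 \<sigma>)
    then have "\<exists>x\<in>carrier A. converges A \<sigma> x" using complete SA by simp
    then show ?case using S(2) 28 unfolding norm_closed_def by auto
  qed (simp_all add: cl SA scl_add add_scl scl_scl scl_one mul_assoc
      mul_add add_mul scl_mul mul_scl star_star star_add star_scl star_mul nrm_eq_0 nrm_scl
      cstar_identity add_zer add_inv add_ac nrm_add nrm_mul)
qed

text \<open>Transport of structure along an injection.\<close>

definition image_cstar :: "'a cstar \<Rightarrow> ('a \<Rightarrow> 'b) \<Rightarrow> 'b cstar" where
  "image_cstar A f = (let g = inv_into (carrier A) f in
     \<lparr>carrier = f ` carrier A, zer = f (zer A), add = (\<lambda>x y. f (add A (g x) (g y))),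
      scl = (\<lambda>c x. f (scl A c (g x))), mul = (\<lambda>x y. f (mul A (g x) (g y))),
      star = (\<lambda>x. f (star A (g x))), nrm = (\<lambda>x. nrm A (g x))\<rparr>)"

lemma image_cstar_algebra:
  assumes A: "cstar_algebra A" and f: "inj_on f (carrier A)"
  shows "cstar_algebra (image_cstar A f)"
    and "star_hom A (image_cstar A f) f"
    and "star_hom (image_cstar A f) A (inv_into (carrier A) f)"
proof -
  interpret cstar_algebra A by fact
  let ?g = "inv_into (carrier A) f"
  let ?B = "image_cstar A f"
  have g [simp]: "x \<in> carrier A \<Longrightarrow> ?g (f x) = x" for x using f by simp
  note cl [simp] = zer_closed add_closed scl_closed mul_closed star_closed
  have B [simp]: "carrier ?B = f ` carrier A" "zer ?B = f (zer A)"
    "add ?B = (\<lambda>x y. f (add A (?g x) (?g y)))" "scl ?B = (\<lambda>c x. f (scl A c (?g x)))"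
    "mul ?B = (\<lambda>x y. f (mul A (?g x) (?g y)))" "star ?B = (\<lambda>x. f (star A (?g x)))"
    "nrm ?B = (\<lambda>x. nrm A (?g x))"
    by (simp_all add: image_cstar_def Let_def)
  have difB: "nrm ?B (dif ?B x y) = nrm A (dif A (?g x) (?g y))"
    if "x \<in> carrier ?B" "y \<in> carrier ?B" for x y
    using that by (auto simp: dif_def)
  show "star_hom A ?B f" by (auto simp: star_hom_def)
  show "star_hom ?B A ?g" by (auto simp: star_hom_def)
  show "cstar_algebra ?B"
  proof (unfold_locales, goal_cases)
    case (28 \<sigma>)
    then have gc: "?g (\<sigma> n) \<in> carrier A" for n by (metis B(1) inv_into_into)
    have "norm_Cauchy A (\<lambda>n. ?g (\<sigma> n))"
      using 28 by (simp only: norm_Cauchy_def difB)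
    then obtain x where x: "x \<in> carrier A" "converges A (\<lambda>n. ?g (\<sigma> n)) x"
      using complete[of "\<lambda>n. ?g (\<sigma> n)"] gc by blast
    have "nrm ?B (dif ?B (\<sigma> n) (f x)) = nrm A (dif A (?g (\<sigma> n)) x)" for n
      using difB[of "\<sigma> n" "f x"] 28(1)[of n] x(1) by simp
    with x(2) have "converges ?B \<sigma> (f x)"
      by (simp only: converges_def)
    then show ?case using x(1) by auto
  next
    case (23 x)
    then obtain a where a: "x = f a" "a \<in> carrier A" by auto
    then have "f a = f (zer A) \<longleftrightarrow> a = zer A" using inj_on_eq_iff[OF f] by simp
    then show ?case using a by (simp add: nrm_eq_0)
  qed (auto simp: scl_add add_scl scl_scl scl_one
      mul_add add_mul scl_mul mul_scl star_star star_add star_scl star_mul nrm_scl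
      cstar_identity add_zer add_inv add_ac mul_assoc nrm_add nrm_mul)
qed

lemma star_hom_comp:
  "star_hom A B \<phi> \<Longrightarrow> star_hom B C \<psi> \<Longrightarrow> star_hom A C (\<lambda>x. \<psi> (\<phi> x))"
  unfolding star_hom_def by (auto simp: Pi_iff) (meson order_trans)

lemma covariant_rep_comp:
  assumes A: "cstar_algebra A" and cov: "covariant_rep E A \<pi>0 \<pi>1" and \<psi>: "star_hom A B \<psi>"
  shows "covariant_rep E B (\<lambda>a. \<psi> (\<pi>0 a)) (\<lambda>\<xi>. \<psi> (\<pi>1 \<xi>))"
proof -
  interpret cstar_algebra A by fact
  obtain \<phi> where toep: "toeplitz_rep E A \<pi>0 \<pi>1" and \<phi>: "induced_hom E A \<pi>1 \<phi>"
    "\<forall>a\<in>C0 (subtopology (vertices E) (regular_vertices E)). \<phi> (mult_op E (a \<circ> rng E)) = \<pi>0 a"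
    using cov unfolding covariant_rep_def by blast
  have \<pi>0: "star_hom (C0_algebra (vertices E)) A \<pi>0" and \<pi>1: "\<xi> \<in> H E \<Longrightarrow> \<pi>1 \<xi> \<in> carrier A" for \<xi>
    using toep unfolding toeplitz_rep_def by auto
  have \<pi>0c: "a \<in> C0 (vertices E) \<Longrightarrow> \<pi>0 a \<in> carrier A" for a
    using \<pi>0 unfolding star_hom_def C0_algebra_def by auto
  have h: "\<psi> x \<in> carrier B" "\<psi> (star A x) = star B (\<psi> x)"
     "\<psi> (c \<odot>\<^bsub>A\<^esub> x) = c \<odot>\<^bsub>B\<^esub> \<psi> x" if "x \<in> carrier A" for x c
    using \<psi> that unfolding star_hom_def by auto
  have h2: "\<psi> (x \<oplus>\<^bsub>A\<^esub> y) = \<psi> x \<oplus>\<^bsub>B\<^esub> \<psi> y" "\<psi> (x \<otimes>\<^bsub>A\<^esub> y) = \<psi> x \<otimes>\<^bsub>B\<^esub> \<psi> y"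
    if "x \<in> carrier A" "y \<in> carrier A" for x y
    using \<psi> that unfolding star_hom_def by auto
  have "star B (\<psi> (\<pi>1 \<xi>)) \<otimes>\<^bsub>B\<^esub> \<psi> (\<pi>1 \<eta>) = \<psi> (\<pi>0 (ip E \<xi> \<eta>))" if "\<xi> \<in> H E" "\<eta> \<in> H E" for \<xi> \<eta>
  proof -
    have "\<psi> (star A (\<pi>1 \<xi>) \<otimes>\<^bsub>A\<^esub> \<pi>1 \<eta>) = \<psi> (\<pi>0 (ip E \<xi> \<eta>))"
      using toep that unfolding toeplitz_rep_def by simp
    then show ?thesis using that by (simp add: h h2 \<pi>1 star_closed)
  qed
  moreover have "\<psi> (\<pi>0 a) \<otimes>\<^bsub>B\<^esub> \<psi> (\<pi>1 \<xi>) = \<psi> (\<pi>1 (\<lambda>e. a (rng E e) * \<xi> e))"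
    if "a \<in> C0 (vertices E)" "\<xi> \<in> H E" for a \<xi>
  proof -
    have "\<psi> (\<pi>0 a \<otimes>\<^bsub>A\<^esub> \<pi>1 \<xi>) = \<psi> (\<pi>1 (\<lambda>e. a (rng E e) * \<xi> e))"
      using toep that unfolding toeplitz_rep_def by simp
    then show ?thesis using that by (simp add: h h2 \<pi>1 \<pi>0c)
  qed
  moreover have "\<psi> (\<pi>1 (\<lambda>e. \<xi> e + \<eta> e)) = \<psi> (\<pi>1 \<xi>) \<oplus>\<^bsub>B\<^esub> \<psi> (\<pi>1 \<eta>)"
    "\<psi> (\<pi>1 (\<lambda>e. c * \<xi> e)) = c \<odot>\<^bsub>B\<^esub> \<psi> (\<pi>1 \<xi>)" if "\<xi> \<in> H E" "\<eta> \<in> H E" for \<xi> \<eta> c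
    using toep that unfolding toeplitz_rep_def by (simp_all add: h h2 \<pi>1)
  ultimately have "toeplitz_rep E B (\<lambda>a. \<psi> (\<pi>0 a)) (\<lambda>\<xi>. \<psi> (\<pi>1 \<xi>))"
    unfolding toeplitz_rep_def using star_hom_comp[OF \<pi>0 \<psi>] h(1) \<pi>1 by auto
  moreover have "induced_hom E B (\<lambda>\<xi>. \<psi> (\<pi>1 \<xi>)) (\<lambda>k. \<psi> (\<phi> k))"
    using \<phi>(1) star_hom_comp[of "compact_algebra E" A \<phi> B \<psi>] \<psi> unfolding induced_hom_def
    by (simp add: h h2 \<pi>1 star_closed)
  ultimately show ?thesis
    unfolding covariant_rep_def using \<phi>(2) by (auto intro!: exI[of _ "\<lambda>k. \<psi> (\<phi> k)"])
qed

lemma star_hom_restrict: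
  assumes "star_hom A B \<phi>" "\<phi> ` carrier A \<subseteq> S"
  shows "star_hom A (sub_cstar B S) \<phi>"
  using assms unfolding star_hom_def by auto

text \<open>A covariant representation corestricts to any C*-subalgebra containing the generators.\<close>

lemma covariant_rep_restrict:
  assumes B: "cstar_algebra B" and cov: "covariant_rep E B \<rho>0 \<rho>1"
    and S: "star_subalgebra B S" "norm_closed B S"
    and gen: "\<rho>0 ` C0 (vertices E) \<subseteq> S" "\<rho>1 ` H E \<subseteq> S"
  shows "covariant_rep E (sub_cstar B S) \<rho>0 \<rho>1"
proof -
  interpret cstar_algebra B by fact
  obtain \<phi> where toep: "toeplitz_rep E B \<rho>0 \<rho>1" and \<phi>: "induced_hom E B \<rho>1 \<phi>"
    "\<forall>a\<in>C0 (subtopology (vertices E) (regular_vertices E)). \<phi> (mult_op E (a \<circ> rng E)) = \<rho>0 a"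
    using cov unfolding covariant_rep_def by blast
  have "toeplitz_rep E (sub_cstar B S) \<rho>0 \<rho>1"
    using toep gen unfolding toeplitz_rep_def
    by (auto intro!: star_hom_restrict simp: C0_algebra_def)
  moreover have "\<phi> ` carrier (compact_algebra E) \<subseteq> S"
  proof -
    let ?L = "adjointable_algebra E" and ?R = "{rank_one E \<xi> \<eta> |\<xi> \<eta>. \<xi> \<in> H E \<and> \<eta> \<in> H E}"
    let ?K = "carrier (compact_algebra E)"
    have K: "?K = closed_span ?L ?R" and ops: "add (compact_algebra E) = add ?L"
      "scl (compact_algebra E) = scl ?L" "zer (compact_algebra E) = zer ?L"
      "nrm (compact_algebra E) = nrm ?L"
      by (simp_all add: compact_algebra_def)
    have hom: "star_hom (compact_algebra E) B \<phi>"
      and rk: "\<And>\<xi> \<eta>. \<xi> \<in> H E \<Longrightarrow> \<eta> \<in> H E \<Longrightarrow> \<phi> (rank_one E \<xi> \<eta>) = \<rho>1 \<xi> \<otimes>\<^bsub>B\<^esub> star B (\<rho>1 \<eta>)"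
      using \<phi>(1) unfolding induced_hom_def by auto
    have h: "\<phi> x \<in> carrier B" "\<phi> (c \<odot>\<^bsub>?L\<^esub> x) = c \<odot>\<^bsub>B\<^esub> \<phi> x" "nrm B (\<phi> x) \<le> nrm ?L x"
      if "x \<in> ?K" for x c
      using hom that unfolding star_hom_def ops by auto
    have h2: "\<phi> (x \<oplus>\<^bsub>?L\<^esub> y) = \<phi> x \<oplus>\<^bsub>B\<^esub> \<phi> y" if "x \<in> ?K" "y \<in> ?K" for x y
      using hom that unfolding star_hom_def ops by auto
    have rank: "?R \<subseteq> ?K" unfolding K closed_span_def by auto
    have Kz: "\<zero>\<^bsub>?L\<^esub> \<in> ?K" and Ka: "\<And>x y. x \<in> ?K \<Longrightarrow> y \<in> ?K \<Longrightarrow> x \<oplus>\<^bsub>?L\<^esub> y \<in> ?K"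
      and Ks: "\<And>c x. x \<in> ?K \<Longrightarrow> c \<odot>\<^bsub>?L\<^esub> x \<in> ?K"
      unfolding K closed_span_def linear_closed_def by auto
    have Kc: "x \<in> ?K" if "x \<in> carrier ?L" "\<And>n. \<sigma> n \<in> ?K" "converges ?L \<sigma> x" for x \<sigma>
      using that unfolding K closed_span_def norm_closed_def by blast
    have d: "dif ?L x y \<in> ?K" "\<phi> (dif ?L x y) = dif B (\<phi> x) (\<phi> y)" if "x \<in> ?K" "y \<in> ?K" for x y
      using that by (simp_all add: dif_def Ka Ks h h2)
    have z: "\<phi> \<zero>\<^bsub>?L\<^esub> \<in> S"
    proof -
      have "\<zero>\<^bsub>?L\<^esub> \<oplus>\<^bsub>?L\<^esub> (-1) \<odot>\<^bsub>?L\<^esub> \<zero>\<^bsub>?L\<^esub> = \<zero>\<^bsub>?L\<^esub>"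
        by (auto simp: adjointable_algebra_def)
      then have "\<phi> \<zero>\<^bsub>?L\<^esub> = \<zero>\<^bsub>B\<^esub>"
        using d(2)[OF Kz Kz] dif_self h(1)[OF Kz] by (simp add: dif_def)
      then show ?thesis using S by (simp add: star_subalgebra_def linear_closed_def)
    qed
    have SS: "x \<oplus>\<^bsub>B\<^esub> y \<in> S" "x \<otimes>\<^bsub>B\<^esub> y \<in> S" if "x \<in> S" "y \<in> S" for x y
      using S(1) that by (auto simp: star_subalgebra_def linear_closed_def)
    have SS': "c \<odot>\<^bsub>B\<^esub> x \<in> S" "star B x \<in> S" if "x \<in> S" for x c
      using S(1) that by (auto simp: star_subalgebra_def linear_closed_def)
    let ?P = "{x \<in> ?K. \<phi> x \<in> S}"
    have "linear_closed ?L ?P"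
      unfolding linear_closed_def using Kz Ka Ks z SS SS' by (auto simp: h h2)
    moreover have "norm_closed ?L ?P"
      unfolding norm_closed_def
    proof (intro allI ballI impI)
      fix \<sigma> x assume x: "x \<in> carrier ?L" and \<sigma>: "\<forall>n. \<sigma> n \<in> ?P" and lim: "converges ?L \<sigma> x"
      have xK: "x \<in> ?K" using Kc x \<sigma> lim by blast
      have "converges B (\<lambda>n. \<phi> (\<sigma> n)) (\<phi> x)"
        unfolding converges_def
      proof (rule tendsto_sandwich[OF _ _ tendsto_const lim[unfolded converges_def]])
        show "\<forall>\<^sub>F n in sequentially. 0 \<le> nrm B (dif B (\<phi> (\<sigma> n)) (\<phi> x))"
          using \<sigma> xK h(1) by (auto intro!: always_eventually nrm_nonneg dif_closed)
        show "\<forall>\<^sub>F n in sequentially. nrm B (dif B (\<phi> (\<sigma> n)) (\<phi> x)) \<le> nrm ?L (dif ?L (\<sigma> n) x)"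
          using \<sigma> xK h(3)[OF d(1)] d(2) by (intro always_eventually) simp
      qed
      then have "\<phi> x \<in> S" using S(2)[unfolded norm_closed_def, rule_format, of "\<phi> x" "\<lambda>n. \<phi> (\<sigma> n)"]
        \<sigma> h(1)[OF xK] by simp
      then show "x \<in> ?P" using x xK by simp
    qed
    moreover have "?R \<subseteq> ?P"
      using rank gen SS SS' by (auto simp: rk image_subset_iff)
    ultimately have "?K \<subseteq> ?P"
      unfolding K closed_span_def by blast
    then show ?thesis by blast
  qed
  ultimately show ?thesis
    unfolding covariant_rep_def using \<phi> star_hom_restrict[of "compact_algebra E" B \<phi> S]
    by (intro conjI exI[of _ \<phi>]) (simp_all add: induced_hom_def)
qed

primrec eval_poly ::
  "('v, 'e) top_graph \<Rightarrow> 'a cstar \<Rightarrow> (('v \<Rightarrow> complex) \<Rightarrow> 'a) \<Rightarrow> (('e \<Rightarrow> complex) \<Rightarrow> 'a)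
     \<Rightarrow> ('v, 'e) star_poly \<Rightarrow> 'a" where
  "eval_poly E B \<rho>0 \<rho>1 (Gen0 a) = (if a \<in> C0 (vertices E) then \<rho>0 a else \<zero>\<^bsub>B\<^esub>)"
| "eval_poly E B \<rho>0 \<rho>1 (Gen1 \<xi>) = (if \<xi> \<in> H E then \<rho>1 \<xi> else \<zero>\<^bsub>B\<^esub>)"
| "eval_poly E B \<rho>0 \<rho>1 (Add p q) = eval_poly E B \<rho>0 \<rho>1 p \<oplus>\<^bsub>B\<^esub> eval_poly E B \<rho>0 \<rho>1 q"
| "eval_poly E B \<rho>0 \<rho>1 (Scl c p) = c \<odot>\<^bsub>B\<^esub> eval_poly E B \<rho>0 \<rho>1 p"
| "eval_poly E B \<rho>0 \<rho>1 (Mul p q) = eval_poly E B \<rho>0 \<rho>1 p \<otimes>\<^bsub>B\<^esub> eval_poly E B \<rho>0 \<rho>1 q"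
| "eval_poly E B \<rho>0 \<rho>1 (Star p) = star B (eval_poly E B \<rho>0 \<rho>1 p)"

theorem graph_algebra_universal:
  fixes E :: "('v, 'e) top_graph" and B :: "'b cstar"
  assumes univ: "graph_algebra E A \<pi>0 \<pi>1"
    and B: "cstar_algebra B" and cov: "covariant_rep E B \<rho>0 \<rho>1"
  shows "\<exists>\<psi>. factors_through E A \<pi>0 \<pi>1 B \<rho>0 \<rho>1 \<psi>"
proof -
  interpret cstar_algebra B by fact
  let ?ev = "eval_poly E B \<rho>0 \<rho>1"
  let ?P = "range ?ev"
  have \<rho>0: "a \<in> C0 (vertices E) \<Longrightarrow> \<rho>0 a \<in> carrier B" for a
    using cov unfolding covariant_rep_def toeplitz_rep_def star_hom_def C0_algebra_def by auto
  have \<rho>1: "\<xi> \<in> H E \<Longrightarrow> \<rho>1 \<xi> \<in> carrier B" for \<xi>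
    using cov unfolding covariant_rep_def toeplitz_rep_def by auto
  have evc: "?ev p \<in> carrier B" for p
    by (induction p) (auto simp: zer_closed add_closed scl_closed mul_closed star_closed \<rho>0 \<rho>1)
  have "\<zero>\<^bsub>B\<^esub> = ?ev (Scl 0 p)" for p by (simp add: scl_0 evc)
  then have "\<zero>\<^bsub>B\<^esub> \<in> ?P" by blast
  moreover have "?ev p \<oplus>\<^bsub>B\<^esub> ?ev q \<in> ?P" "?ev p \<otimes>\<^bsub>B\<^esub> ?ev q \<in> ?P" "c \<odot>\<^bsub>B\<^esub> ?ev p \<in> ?P"
    "star B (?ev p) \<in> ?P" for p q c
    using rangeI[of ?ev "Add p q"] rangeI[of ?ev "Mul p q"] rangeI[of ?ev "Scl c p"]
      rangeI[of ?ev "Star p"] by simp_all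
  ultimately have sub: "star_subalgebra B ?P"
    unfolding star_subalgebra_def linear_closed_def using evc by (simp add: image_subset_iff)
  define S where "S = {x \<in> carrier B. \<exists>\<sigma>. (\<forall>n. \<sigma> n \<in> ?P) \<and> converges B \<sigma> x}"
  note S = closure_star_subalgebra[OF sub, folded S_def]
  have "\<exists>p. converges B (\<lambda>n. ?ev (p n)) x" if "x \<in> S" for x
  proof -
    obtain \<sigma> where \<sigma>: "\<forall>n. \<sigma> n \<in> ?P" "converges B \<sigma> x" using \<open>x \<in> S\<close> unfolding S_def by blast
    then have "\<sigma> = (\<lambda>n. ?ev (inv ?ev (\<sigma> n)))" by (simp add: f_inv_into_f)
    with \<sigma>(2) show ?thesis by metis
  qed
  then have "\<exists>f. \<forall>x\<in>S. converges B (\<lambda>n. ?ev (f x n)) x" by (intro bchoice) simp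
  then obtain f where f: "\<And>x. x \<in> S \<Longrightarrow> converges B (\<lambda>n. ?ev (f x n)) x" by blast
  have inj: "inj_on f S"
  proof (rule inj_onI)
    fix x y assume *: "x \<in> S" "y \<in> S" "f x = f y"
    then have "x \<in> carrier B" "y \<in> carrier B" by (simp_all add: S_def)
    then show "x = y" using f[of x] f[of y] * evc
      by (intro converges_unique[of "\<lambda>n. ?ev (f x n)" x y]) simp_all
  qed
  have evS: "?ev p \<in> S" for p using S(3) by blast
  have "\<rho>0 a \<in> S" if "a \<in> C0 (vertices E)" for a using evS[of "Gen0 a"] that by simp
  moreover have "\<rho>1 \<xi> \<in> S" if "\<xi> \<in> H E" for \<xi> using evS[of "Gen1 \<xi>"] that by simp
  ultimately have gen: "\<rho>0 ` C0 (vertices E) \<subseteq> S" "\<rho>1 ` H E \<subseteq> S" by auto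
  let ?S = "sub_cstar B S"
  have SA: "cstar_algebra ?S" by (rule sub_cstar_algebra[OF B S(1,2)])
  have Scov: "covariant_rep E ?S \<rho>0 \<rho>1" by (rule covariant_rep_restrict[OF B cov S(1,2) gen])
  let ?C = "image_cstar ?S f" and ?g = "inv_into S f"
  have C: "cstar_algebra ?C" "star_hom ?S ?C f" "star_hom ?C ?S ?g"
    using image_cstar_algebra[OF SA, of f] inj by simp_all
  obtain \<psi> where \<psi>: "factors_through E A \<pi>0 \<pi>1 ?C (\<lambda>a. f (\<rho>0 a)) (\<lambda>\<xi>. f (\<rho>1 \<xi>)) \<psi>"
    using univ C(1) covariant_rep_comp[OF SA Scov C(2)] unfolding graph_algebra_def by blast
  have "S \<subseteq> carrier B" unfolding S_def by blast
  then have "star_hom ?S B (\<lambda>x. x)" unfolding star_hom_def by auto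
  moreover have "star_hom A ?C \<psi>" using \<psi> unfolding factors_through_def by blast
  ultimately have "star_hom A B (\<lambda>x. ?g (\<psi> x))"
    using star_hom_comp[OF star_hom_comp[OF _ C(3)], of A \<psi> B "\<lambda>x. x"] by simp
  moreover have "?g (\<psi> (\<pi>0 a)) = \<rho>0 a" if "a \<in> C0 (vertices E)" for a
    using \<psi> that gen(1) inj unfolding factors_through_def by (simp add: image_subset_iff)
  moreover have "?g (\<psi> (\<pi>1 \<xi>)) = \<rho>1 \<xi>" if "\<xi> \<in> H E" for \<xi>
    using \<psi> that gen(2) inj unfolding factors_through_def by (simp add: image_subset_iff)
  ultimately show ?thesis unfolding factors_through_def by blast
qed

end

theory Submission
  imports Defs
begin

text \<open>A gauge automorphism multiplies a word in the generators \<open>\<pi>0 a\<close>, \<open>\<pi>1 f\<close>, \<open>star A (\<pi>1 f)\<close> by a power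
  \<open>z\<^sup>d\<close>, where the degree \<open>d\<close> is the number of letters \<open>\<pi>1 f\<close> minus the number of letters
  \<open>star A (\<pi>1 f)\<close>.  The words span a dense subspace, so the claim is that a trace \<open>\<tau>\<close> vanishes on every
  word of nonzero degree.

  Since \<open>\<tau>\<close> sees words only up to rotation, and since \<open>star A (\<pi>1 f) \<otimes> \<pi>1 g\<close> is some \<open>\<pi>0 a\<close> and
  letters \<open>\<pi>0 a\<close> are absorbed by their neighbours, a word of nonzero degree can be shortened until it
  is \<open>\<pi>1 f\<^sub>1 \<otimes> \<dots> \<otimes> \<pi>1 f\<^sub>k\<close> with \<open>k \<ge> 1\<close>, or the adjoint of such a word (\<open>trace_word_zero\<close>).

  For such a word regard \<open>\<tau> (\<pi>1 f\<^sub>1 \<otimes> \<dots> \<otimes> \<pi>1 f\<^sub>k)\<close> as a \<open>k\<close>-additive functional of compactly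
  supported functions \<open>f\<^sub>1, \<dots>, f\<^sub>k\<close> on the edge space.  Near any tuple \<open>(e\<^sub>1, \<dots>, e\<^sub>k)\<close> of edges it
  vanishes: the tuple is not a cycle, so \<open>s(e\<^sub>i) \<noteq> r(e\<^sub>i\<^sub>+\<^sub>1)\<close> for some \<open>i\<close> modulo \<open>k\<close>, and there is a
  function \<open>h\<close> on the vertices that is \<open>1\<close> near \<open>r(e\<^sub>i\<^sub>+\<^sub>1)\<close> and \<open>0\<close> near \<open>s(e\<^sub>i)\<close>.  For \<open>f\<^sub>i\<close>, \<open>f\<^sub>i\<^sub>+\<^sub>1\<close>
  supported near \<open>e\<^sub>i\<close>, \<open>e\<^sub>i\<^sub>+\<^sub>1\<close> this gives \<open>\<pi>0 h \<otimes> \<pi>1 f\<^sub>i\<^sub>+\<^sub>1 = \<pi>1 f\<^sub>i\<^sub>+\<^sub>1\<close> and \<open>\<pi>1 f\<^sub>i \<otimes> \<pi>0 h = 0\<close>, and the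
  trace property lets \<open>h\<close> travel from the one factor to the other (\<open>trace_creation_word_zero\<close>).  A
  multiadditive functional that vanishes locally is zero by partitions of unity
  (\<open>multiadditive_locally_zero\<close>).

  Compact supports suffice because \<open>\<pi>1\<close> is contractive, hence \<open>\<pi>1\<close> of \<open>Cc\<close> is dense in \<open>\<pi>1\<close> of \<open>H E\<close>
  (\<open>pi1_approx\<close>).  Contractivity is read off from \<open>star A (\<pi>1 \<xi>) \<otimes> \<pi>1 \<xi> = \<pi>0 \<langle>\<xi>, \<xi>\<rangle>\<close>, which requires that
  \<open>\<langle>\<xi>, \<xi>\<rangle>\<close> is a function in \<open>C0\<close>; this rests on the continuity of sums over the fibres of a local
  homeomorphism (\<open>fibre_sum_C0\<close>).\<close>

section \<open>Continuous functions on locally compact spaces\<close>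

definition supp :: "'x topology \<Rightarrow> ('x \<Rightarrow> complex) \<Rightarrow> 'x set" where
  "supp X f = X closure_of {x \<in> topspace X. f x \<noteq> 0}"

lemma continuous_map_complex_mult:
  fixes f g :: "'x \<Rightarrow> complex"
  assumes "continuous_map X euclidean f" "continuous_map X euclidean g"
  shows "continuous_map X euclidean (\<lambda>x. f x * g x)"
  using assms by (simp add: continuous_map_atin tendsto_mult)

lemma continuous_map_complex_of_real:
  assumes "continuous_map X euclideanreal f"
  shows "continuous_map X euclidean (\<lambda>x. complex_of_real (f x))"
  using assms by (simp add: continuous_map_atin tendsto_of_real)

lemma continuous_map_complex_cnj:
  assumes "continuous_map X euclidean f"
  shows "continuous_map X euclidean (\<lambda>x. cnj (f x))"
  using assms by (simp add: continuous_map_atin tendsto_cnj)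

lemma Cc_iff:
  "f \<in> Cc X \<longleftrightarrow> continuous_map X euclidean f \<and> (\<forall>x. x \<notin> topspace X \<longrightarrow> f x = 0) \<and> compactin X (supp X f)"
  by (simp add: Cc_def supp_def)

lemma supp_subset_topspace: "supp X f \<subseteq> topspace X"
  by (simp add: supp_def closure_of_subset_topspace)

lemma closedin_supp: "closedin X (supp X f)"
  by (simp add: supp_def)

lemma in_supp: "x \<in> topspace X \<Longrightarrow> f x \<noteq> 0 \<Longrightarrow> x \<in> supp X f"
  unfolding supp_def using closure_of_subset[of "{x \<in> topspace X. f x \<noteq> 0}" X] by auto

lemma supp_minimal:
  "closedin X C \<Longrightarrow> (\<And>x. x \<in> topspace X \<Longrightarrow> f x \<noteq> 0 \<Longrightarrow> x \<in> C) \<Longrightarrow> supp X f \<subseteq> C"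
  unfolding supp_def by (rule closure_of_minimal) auto

lemma Cc_nonzero_in_supp: "f \<in> Cc X \<Longrightarrow> f x \<noteq> 0 \<Longrightarrow> x \<in> supp X f"
  by (metis Cc_iff in_supp)

lemma Cc_zero: "(\<lambda>x. 0) \<in> Cc X"
  by (simp add: Cc_def)

lemma Cc_add:
  assumes "f \<in> Cc X" "g \<in> Cc X"
  shows "(\<lambda>x. f x + g x) \<in> Cc X"
proof -
  have "supp X (\<lambda>x. f x + g x) \<subseteq> supp X f \<union> supp X g"
  proof (rule supp_minimal)
    show "x \<in> supp X f \<union> supp X g" if "x \<in> topspace X" "f x + g x \<noteq> 0" for x
      using that in_supp[of x X f] in_supp[of x X g] by (cases "f x = 0") auto
  qed (simp add: closedin_supp closedin_Un)
  moreover have "compactin X (supp X f \<union> supp X g)"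
    using assms by (simp add: Cc_iff compactin_Un)
  ultimately have "compactin X (supp X (\<lambda>x. f x + g x))"
    using closed_compactin closedin_supp by blast
  then show ?thesis using assms by (simp add: Cc_iff continuous_map_add)
qed

lemma supp_mult_subset: "supp X (\<lambda>x. g x * f x) \<subseteq> supp X f"
  by (rule supp_minimal) (auto simp: closedin_supp intro: in_supp)

lemma Cc_mult:
  assumes "f \<in> Cc X" "continuous_map X euclidean g"
  shows "(\<lambda>x. g x * f x) \<in> Cc X"
proof -
  have "compactin X (supp X (\<lambda>x. g x * f x))"
    by (rule closed_compactin[OF _ supp_mult_subset closedin_supp]) (use assms(1) in \<open>simp add: Cc_iff\<close>)
  then show ?thesis using assms by (simp add: Cc_iff continuous_map_complex_mult)
qed

lemma Cc_diff:
  assumes "f \<in> Cc X" "g \<in> Cc X"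
  shows "(\<lambda>x. f x - g x) \<in> Cc X"
  using Cc_add[OF assms(1) Cc_mult[OF assms(2), of "\<lambda>x. -1"]] by simp

lemma Cc_cnj_mult:
  assumes "f \<in> Cc X" "g \<in> Cc X"
  shows "(\<lambda>x. cnj (f x) * g x) \<in> Cc X"
  using assms by (intro Cc_mult continuous_map_complex_cnj) (simp_all add: Cc_iff)

lemma Cc_sum:
  assumes "finite F" "\<And>i. i \<in> F \<Longrightarrow> f i \<in> Cc X"
  shows "(\<lambda>x. \<Sum>i\<in>F. f i x) \<in> Cc X"
  using assms by (induction F rule: finite_induct) (auto simp: Cc_zero Cc_add)

lemma C0_zero: "(\<lambda>x. 0) \<in> C0 X"
proof -
  have "{x \<in> topspace X. \<epsilon> \<le> cmod 0} = {}" if "\<epsilon> > 0" for \<epsilon> using that by auto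
  then show ?thesis by (simp add: C0_def)
qed

lemma C0_cnj: "f \<in> C0 X \<Longrightarrow> (\<lambda>x. cnj (f x)) \<in> C0 X"
  by (simp add: C0_def continuous_map_complex_cnj)

lemma closedin_norm_ge:
  assumes "continuous_map X euclidean (f :: 'x \<Rightarrow> complex)"
  shows "closedin X {x \<in> topspace X. \<epsilon> \<le> cmod (f x)}"
  using closedin_continuous_map_preimage[OF continuous_map_norm[OF assms], of "{\<epsilon>..}"] by simp

lemma C0_add:
  assumes "f \<in> C0 X" "g \<in> C0 X"
  shows "(\<lambda>x. f x + g x) \<in> C0 X"
proof -
  have c: "continuous_map X euclidean (\<lambda>x. f x + g x)"
    using assms by (simp add: C0_def continuous_map_add)
  have "compactin X {x \<in> topspace X. \<epsilon> \<le> cmod (f x + g x)}" if "\<epsilon> > 0" for \<epsilon>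
  proof (rule closed_compactin[OF _ _ closedin_norm_ge[OF c]])
    show "compactin X ({x \<in> topspace X. \<epsilon>/2 \<le> cmod (f x)} \<union> {x \<in> topspace X. \<epsilon>/2 \<le> cmod (g x)})"
      using assms half_gt_zero[OF that] unfolding C0_def by (blast intro: compactin_Un)
    show "{x \<in> topspace X. \<epsilon> \<le> cmod (f x + g x)}
        \<subseteq> {x \<in> topspace X. \<epsilon>/2 \<le> cmod (f x)} \<union> {x \<in> topspace X. \<epsilon>/2 \<le> cmod (g x)}"
      by auto (smt (verit) norm_triangle_ineq field_sum_of_halves)
  qed
  then show ?thesis using assms c by (simp add: C0_def)
qed

lemma C0_bounded:
  assumes "f \<in> C0 X"
  obtains M where "M > 0" "\<And>x. cmod (f x) \<le> M"
proof -
  let ?S = "{x \<in> topspace X. 1 \<le> cmod (f x)}"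
  have "compactin X ?S" "continuous_map X euclidean f" using assms by (simp_all add: C0_def)
  then have "compact (f ` ?S)" using image_compactin[of X ?S euclidean f] by simp
  then obtain M where M: "\<And>y. y \<in> f ` ?S \<Longrightarrow> cmod y \<le> M" using compact_imp_bounded bounded_iff by metis
  have "cmod (f x) \<le> max M 1" for x
  proof (cases "x \<in> ?S")
    case True
    then show ?thesis using M by force
  next
    case False
    then have "x \<notin> topspace X \<or> cmod (f x) \<le> 1" by auto
    then show ?thesis using assms by (auto simp: C0_def)
  qed
  then show ?thesis by (intro that[of "max M 1"]) auto
qed

lemma C0_mult:
  assumes "f \<in> C0 X" "g \<in> C0 X"
  shows "(\<lambda>x. f x * g x) \<in> C0 X"
proof -
  have c: "continuous_map X euclidean (\<lambda>x. f x * g x)"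
    using assms by (simp add: C0_def continuous_map_complex_mult)
  obtain M where M: "M > 0" "\<And>x. cmod (g x) \<le> M" using C0_bounded[OF assms(2)] by blast
  have "compactin X {x \<in> topspace X. \<epsilon> \<le> cmod (f x * g x)}" if "\<epsilon> > 0" for \<epsilon>
  proof (rule closed_compactin[OF _ _ closedin_norm_ge[OF c]])
    show "compactin X {x \<in> topspace X. \<epsilon>/M \<le> cmod (f x)}"
      using assms that M(1) by (simp add: C0_def)
    have "\<epsilon>/M \<le> cmod (f x)" if "\<epsilon> \<le> cmod (f x * g x)" for x
    proof -
      have "cmod (f x * g x) \<le> cmod (f x) * M" using M(2) by (simp add: norm_mult mult_left_mono)
      with that show ?thesis using M(1) by (simp add: pos_divide_le_eq)
    qed
    then show "{x \<in> topspace X. \<epsilon> \<le> cmod (f x * g x)} \<subseteq> {x \<in> topspace X. \<epsilon>/M \<le> cmod (f x)}" by auto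
  qed
  then show ?thesis using assms c by (simp add: C0_def)
qed

lemma C0_uniform_limit:
  assumes lim: "\<And>\<epsilon>. \<epsilon> > 0 \<Longrightarrow> \<exists>g\<in>C0 X. \<forall>x. cmod (f x - g x) \<le> \<epsilon>"
  shows "f \<in> C0 X"
proof -
  have "\<forall>n. \<exists>g\<in>C0 X. \<forall>x. cmod (f x - g x) \<le> inverse (real (Suc n))" using lim by simp
  then obtain g where g: "\<And>n. g n \<in> C0 X" "\<And>n x. cmod (f x - g n x) \<le> inverse (real (Suc n))" by metis
  have c: "continuous_map X euclidean f"
  proof -
    have "continuous_map X (Met_TC.mtopology :: complex topology) f"
    proof (rule Met_TC.continuous_map_uniform_limit[where F = sequentially and f = g])
      fix \<epsilon> :: real assume "\<epsilon> > 0"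
      then obtain N where N: "inverse (real (Suc N)) < \<epsilon>" using reals_Archimedean by blast
      have "dist (g n x) (f x) < \<epsilon>" if "n \<ge> N" for n x
      proof -
        have "inverse (real (Suc n)) \<le> inverse (real (Suc N))" using that by simp
        from le_less_trans[OF order_trans[OF g(2) this] N] show ?thesis
          by (simp only: dist_norm norm_minus_commute)
      qed
      then show "\<forall>\<^sub>F n in sequentially. \<forall>x\<in>topspace X. f x \<in> UNIV \<and> dist (g n x) (f x) < \<epsilon>"
        by (auto simp: eventually_sequentially)
    qed (use g(1) in \<open>auto simp: C0_def\<close>)
    then show ?thesis by simp
  qed
  have "compactin X {x \<in> topspace X. \<epsilon> \<le> cmod (f x)}" if \<epsilon>: "\<epsilon> > 0" for \<epsilon>
  proof -
    obtain h where h: "h \<in> C0 X" "\<And>x. cmod (f x - h x) \<le> \<epsilon>/2" using lim[of "\<epsilon>/2"] \<epsilon> by auto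
    have "\<epsilon>/2 \<le> cmod (h x)" if "\<epsilon> \<le> cmod (f x)" for x
      using h(2)[of x] that norm_triangle_ineq2[of "f x" "h x"] by simp
    moreover have "compactin X {x \<in> topspace X. \<epsilon>/2 \<le> cmod (h x)}"
      using h(1) half_gt_zero[OF \<epsilon>] unfolding C0_def by blast
    ultimately show ?thesis
      by (intro closed_compactin[OF _ _ closedin_norm_ge[OF c], of "{x \<in> topspace X. \<epsilon>/2 \<le> cmod (h x)}"]) auto
  qed
  moreover have "f x = 0" if "x \<notin> topspace X" for x
  proof (rule ccontr)
    assume "f x \<noteq> 0"
    then obtain h where "h \<in> C0 X" "cmod (f x - h x) \<le> cmod (f x) / 2" using lim[of "cmod (f x) / 2"] by auto
    then show False using that \<open>f x \<noteq> 0\<close> by (simp add: C0_def)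
  qed
  ultimately show ?thesis using c by (simp add: C0_def)
qed

text \<open>Complete regularity prescribes the value \<open>1\<close> at the point \<open>x\<close> only; truncating twice that function at
  \<open>1\<close> gives the value \<open>1\<close> on a neighbourhood, so that \<open>h\<close> acts as a unit on functions living there.  Shrinking \<open>W\<close>
  into a compact set first puts \<open>h\<close> into \<open>C0 X\<close>.\<close>

lemma local_unit:
  assumes X: "locally_compact_space X" "Hausdorff_space X" and W: "openin X W" "x \<in> W"
  obtains h V where "h \<in> C0 X" "openin X V" "x \<in> V" "\<And>y. y \<in> V \<Longrightarrow> h y = 1" "\<And>y. h y \<noteq> 0 \<Longrightarrow> y \<in> W"
proof -
  have xX: "x \<in> topspace X" using W openin_subset by blast
  obtain N M where N: "openin X N" "compactin X M" "x \<in> N" "N \<subseteq> M"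
    using X(1) xX unfolding locally_compact_space_def by blast
  have "completely_regular_space X"
    using X locally_compact_regular_imp_completely_regular_space by blast
  moreover have "openin X (W \<inter> N)" "x \<in> W \<inter> N" using W N by auto
  ultimately obtain g :: "'a \<Rightarrow> real" where g: "continuous_map X euclideanreal g" "g x = 1"
      "g ` (topspace X - W \<inter> N) \<subseteq> {0}"
    unfolding completely_regular_space_gen_alt'[of 1 "0::real", OF one_neq_zero] by metis
  define h where "h = (\<lambda>y. if y \<in> topspace X then complex_of_real (min 1 (2 * max 0 (g y))) else 0)"
  have cont: "continuous_map X euclidean h"
  proof -
    have "continuous_map X euclidean (\<lambda>y. complex_of_real (min 1 (2 * max 0 (g y))))"
      by (intro continuous_map_complex_of_real continuous_map_real_min continuous_map_real_mult_left
          continuous_map_real_max g) auto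
    then show ?thesis by (rule continuous_map_eq) (simp add: h_def)
  qed
  have nz: "y \<in> W \<inter> N" if "h y \<noteq> 0" for y
  proof (rule ccontr)
    assume "y \<notin> W \<inter> N"
    then have "y \<notin> topspace X \<or> g y = 0" using g(3) by blast
    with that show False by (auto simp: h_def split: if_splits)
  qed
  have "compactin X {y \<in> topspace X. \<epsilon> \<le> cmod (h y)}" if "\<epsilon> > 0" for \<epsilon>
  proof (rule closed_compactin[OF N(2) _ closedin_norm_ge[OF cont]])
    show "{y \<in> topspace X. \<epsilon> \<le> cmod (h y)} \<subseteq> M"
    proof
      fix y assume "y \<in> {y \<in> topspace X. \<epsilon> \<le> cmod (h y)}"
      then have "h y \<noteq> 0" using that by auto
      then show "y \<in> M" using nz N(4) by blast
    qed
  qed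
  then have "h \<in> C0 X" using cont by (simp add: C0_def h_def)
  moreover have "openin X {y \<in> topspace X. g y \<in> {1/2<..}}"
    by (rule openin_continuous_map_preimage[OF g(1)]) auto
  ultimately show ?thesis
    using nz xX g(2) by (intro that[of h "{y \<in> topspace X. g y \<in> {1/2<..}}"]) (auto simp: h_def)
qed

lemma compactin_finite_subcover:
  assumes K: "compactin X K" and U: "\<And>x. x \<in> K \<Longrightarrow> openin X (U x)" "\<And>x. x \<in> K \<Longrightarrow> x \<in> U x"
  obtains F where "finite F" "F \<subseteq> K" "K \<subseteq> (\<Union>x\<in>F. U x)"
proof -
  have "\<forall>V\<in>U ` K. openin X V" "K \<subseteq> \<Union>(U ` K)" using U by auto
  then obtain \<F> where "finite \<F>" "\<F> \<subseteq> U ` K" "K \<subseteq> \<Union>\<F>"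
    using K unfolding compactin_def by meson
  moreover from this obtain F where "F \<subseteq> K" "finite F" "\<F> = U ` F"
    using finite_subset_image[of \<F> U K] by blast
  ultimately show ?thesis using that by simp
qed

text \<open>This is where a partition of unity enters: \<open>f\<close> is the sum of pieces supported in the members of a
  finite cover of its support.  The denominator \<open>max (\<Sum>x. g x) (1/4)\<close> agrees with \<open>\<Sum>x. g x\<close> on the
  support and is continuous and positive on the whole space, so the quotients need not be glued along
  the boundary of the support.\<close>

lemma Cc_local_induct:
  assumes X: "locally_compact_space X" "Hausdorff_space X" and f: "f \<in> Cc X"
    and loc: "\<And>x. x \<in> supp X f \<Longrightarrow>
      \<exists>U. openin X U \<and> x \<in> U \<and> (\<forall>g\<in>Cc X. supp X g \<subseteq> U \<inter> supp X f \<longrightarrow> P g)"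
    and zero: "P (\<lambda>x. 0)"
    and add: "\<And>g h. \<lbrakk>g \<in> Cc X; h \<in> Cc X; P g; P h\<rbrakk> \<Longrightarrow> P (\<lambda>x. g x + h x)"
  shows "P f"
proof -
  let ?K = "supp X f"
  have K: "compactin X ?K" using f by (simp add: Cc_iff)
  obtain U where U: "\<And>x. x \<in> ?K \<Longrightarrow> openin X (U x)" "\<And>x. x \<in> ?K \<Longrightarrow> x \<in> U x"
      "\<And>x g. x \<in> ?K \<Longrightarrow> g \<in> Cc X \<Longrightarrow> supp X g \<subseteq> U x \<inter> ?K \<Longrightarrow> P g"
    using loc by metis
  have reg: "completely_regular_space X"
    using X locally_compact_regular_imp_completely_regular_space by blast
  have "\<exists>h. continuous_map X euclideanreal h \<and> h x = 1 \<and> h ` (topspace X - U x) \<subseteq> {0}" if "x \<in> ?K" for x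
    using reg U(1,2)[OF that] unfolding completely_regular_space_gen_alt'[of 1 "0::real", OF one_neq_zero]
    by blast
  then obtain h where h: "\<And>x. x \<in> ?K \<Longrightarrow> continuous_map X euclideanreal (h x)" "\<And>x. x \<in> ?K \<Longrightarrow> h x x = 1"
      "\<And>x. x \<in> ?K \<Longrightarrow> h x ` (topspace X - U x) \<subseteq> {0}"
    by metis
  let ?W = "\<lambda>x. {y \<in> topspace X. h x y \<in> {1/2<..}}"
  have W: "openin X (?W x)" if "x \<in> ?K" for x
    by (rule openin_continuous_map_preimage[OF h(1)[OF that]]) auto
  obtain F where F: "finite F" "F \<subseteq> ?K" "?K \<subseteq> (\<Union>x\<in>F. ?W x)"
    using W h(2) supp_subset_topspace[of X f] by (rule_tac compactin_finite_subcover[OF K, of ?W]) auto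
  \<comment> \<open>Cutting off at \<open>1/4\<close> leaves the support of \<open>g x\<close> inside \<open>{y. 1/4 \<le> h x y}\<close>, a closed subset of
    \<open>U x\<close>, while still \<open>1/4 \<le> g x y\<close> where \<open>1/2 < h x y\<close>.\<close>
  define g where "g = (\<lambda>x y. max 0 (h x y - 1/4))"
  have g: "continuous_map X euclideanreal (g x)" if "x \<in> F" for x
    unfolding g_def using that F(2) h(1) by (intro continuous_map_real_max continuous_map_diff) auto
  define G where "G = (\<lambda>y. max (\<Sum>x\<in>F. g x y) (1/4))"
  have G: "continuous_map X euclideanreal G"
    unfolding G_def using g F(1) by (intro continuous_map_real_max continuous_map_sum) auto
  have Gpos: "G y > 0" for y unfolding G_def by (simp add: less_max_iff_disj)
  have GK: "G y = (\<Sum>x\<in>F. g x y)" if "y \<in> ?K" for y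
  proof -
    have "y \<in> (\<Union>x\<in>F. ?W x)" using F(3) that by blast
    then obtain x where x: "x \<in> F" "h x y > 1/2" by auto
    have "1/4 \<le> g x y" using x(2) by (simp add: g_def)
    also have "\<dots> \<le> (\<Sum>x\<in>F. g x y)" using F(1) x(1) by (intro member_le_sum) (auto simp: g_def)
    finally show ?thesis by (simp add: G_def)
  qed
  define p where "p = (\<lambda>x y. complex_of_real (g x y / G y) * f y)"
  have pCc: "p x \<in> Cc X" if "x \<in> F" for x
  proof -
    have "continuous_map X euclideanreal (\<lambda>y. g x y / G y)"
      using g[OF that] G Gpos by (intro continuous_map_real_divide) (auto simp: less_imp_neq[symmetric])
    then show ?thesis unfolding p_def by (intro Cc_mult f continuous_map_complex_of_real)
  qed
  have P: "P (p x)" if x: "x \<in> F" for x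
  proof (rule U(3)[of x])
    show "x \<in> ?K" using x F(2) by blast
    note hx = h(1,3)[OF this]
    have "supp X (p x) \<subseteq> {y \<in> topspace X. h x y \<in> {1/4..}}"
      by (rule supp_minimal[OF closedin_continuous_map_preimage[OF hx(1)]])
        (auto simp: p_def g_def max_def split: if_splits)
    also have "\<dots> \<subseteq> U x" using hx(2) by (force simp: image_subset_iff)
    finally show "supp X (p x) \<subseteq> U x \<inter> ?K" unfolding p_def by (intro Int_greatest supp_mult_subset)
  qed (rule pCc[OF x])
  have "P (\<lambda>y. \<Sum>x\<in>S. p x y)" if "S \<subseteq> F" for S
    using finite_subset[OF that F(1)] that
    by (induction S rule: finite_induct) (auto intro!: zero add pCc P Cc_sum intro: finite_subset)
  moreover have "f y = (\<Sum>x\<in>F. p x y)" for y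
  proof (cases "f y = 0")
    case False
    then have "y \<in> ?K" using f by (rule Cc_nonzero_in_supp[rotated])
    then have "(\<Sum>x\<in>F. g x y / G y) = 1"
      using GK Gpos[of y] by (simp flip: sum_divide_distrib)
    then have "f y = complex_of_real (\<Sum>x\<in>F. g x y / G y) * f y" by simp
    then show ?thesis unfolding p_def of_real_sum sum_distrib_right .
  qed (simp add: p_def)
  ultimately show ?thesis by (metis (no_types, lifting) ext order_refl)
qed

text \<open>Locally zero implies zero, for functions of \<open>k\<close> variables at once.  Partitions of unity remove one
  localisation at a time.  As in the tube lemma, this needs compactness for a uniform choice: finitely
  many neighbourhoods of points in the \<open>m\<close>-th coordinate cover \<open>K\<close>, and the corresponding neighbourhoods
  in the coordinates below \<open>m\<close> may be intersected.\<close>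

lemma multiadditive_locally_zero:
  fixes \<Phi> :: "(nat \<Rightarrow> 'x \<Rightarrow> complex) \<Rightarrow> 'b::ab_group_add"
  assumes X: "locally_compact_space X" "Hausdorff_space X" and K: "compactin X K"
    and add: "\<And>f m g h. \<lbrakk>m < k; \<And>i. i < k \<Longrightarrow> f i \<in> Cc X; g \<in> Cc X; h \<in> Cc X\<rbrakk> \<Longrightarrow>
      \<Phi> (f(m := \<lambda>x. g x + h x)) = \<Phi> (f(m := g)) + \<Phi> (f(m := h))"
    and loc: "\<And>p. (\<And>i. i < k \<Longrightarrow> p i \<in> K) \<Longrightarrow> \<exists>U. (\<forall>i<k. openin X (U i) \<and> p i \<in> U i) \<and>
      (\<forall>f. (\<forall>i<k. f i \<in> Cc X \<and> supp X (f i) \<subseteq> U i) \<longrightarrow> \<Phi> f = 0)"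
    and f: "\<And>i. i < k \<Longrightarrow> f i \<in> Cc X" "\<And>i. i < k \<Longrightarrow> supp X (f i) \<subseteq> K"
  shows "\<Phi> f = 0"
proof -
  \<comment> \<open>\<open>G m p\<close>: vanishing when the coordinates below \<open>m\<close> are localised near \<open>p\<close> and the others range
    over all of \<open>K\<close>; the hypothesis is \<open>G k\<close> and the goal is \<open>G 0\<close>.\<close>
  define G where "G m p \<longleftrightarrow> (\<exists>U. (\<forall>i<m. openin X (U i) \<and> p i \<in> U i) \<and>
      (\<forall>f. (\<forall>i<k. f i \<in> Cc X \<and> supp X (f i) \<subseteq> K) \<and> (\<forall>i<m. supp X (f i) \<subseteq> U i) \<longrightarrow> \<Phi> f = 0))" for m p
  have "\<forall>p. (\<forall>i<m. p i \<in> K) \<longrightarrow> G m p" if "m \<le> k" for m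
    using that
  proof (induction rule: inc_induct)
    case base
    show ?case
    proof (intro allI impI)
      fix p assume "\<forall>i<k. p i \<in> K"
      then obtain U where "\<forall>i<k. openin X (U i) \<and> p i \<in> U i"
          "\<forall>f. (\<forall>i<k. f i \<in> Cc X \<and> supp X (f i) \<subseteq> U i) \<longrightarrow> \<Phi> f = 0"
        using loc[of p] by blast
      then show "G k p" unfolding G_def by (intro exI[of _ U]) blast
    qed
  next
    case (step m)
    show ?case
    proof (intro allI impI)
      fix p assume p: "\<forall>i<m. p i \<in> K"
      define Q where "Q x U \<longleftrightarrow> (\<forall>i<Suc m. openin X (U i) \<and> (p(m := x)) i \<in> U i) \<and>
          (\<forall>f. (\<forall>i<k. f i \<in> Cc X \<and> supp X (f i) \<subseteq> K) \<and> (\<forall>i<Suc m. supp X (f i) \<subseteq> U i) \<longrightarrow> \<Phi> f = 0)"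
        for x U
      have "\<exists>U. Q x U" if "x \<in> K" for x
      proof -
        have "G (Suc m) (p(m := x))" using step.IH p that by (simp add: less_Suc_eq)
        then show ?thesis unfolding G_def Q_def .
      qed
      then have "\<forall>x. \<exists>U. x \<in> K \<longrightarrow> Q x U" by blast
      then obtain U where "\<forall>x. x \<in> K \<longrightarrow> Q x (U x)" by (rule choice[THEN exE])
      then have Q: "Q x (U x)" if "x \<in> K" for x using that by blast
      have U: "openin X (U x i) \<and> p i \<in> U x i" if "x \<in> K" "i < m" for x i
        using Q[OF that(1), unfolded Q_def, THEN conjunct1, rule_format, of i] that(2) by simp
      have Um: "openin X (U x m)" "x \<in> U x m" if "x \<in> K" for x
        using Q[OF that, unfolded Q_def, THEN conjunct1, rule_format, of m] by simp_all
      have UZ: "\<Phi> f = 0" if "x \<in> K" "\<And>i. i < k \<Longrightarrow> f i \<in> Cc X \<and> supp X (f i) \<subseteq> K"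
          "\<And>i. i < Suc m \<Longrightarrow> supp X (f i) \<subseteq> U x i" for x f
        using Q[OF that(1), unfolded Q_def, THEN conjunct2] that(2,3) by blast
      obtain F where F: "finite F" "F \<subseteq> K" "K \<subseteq> (\<Union>x\<in>F. U x m)"
        using compactin_finite_subcover[OF K, of "\<lambda>x. U x m"] Um by blast
      define V where "V = (\<lambda>i. topspace X \<inter> (\<Inter>x\<in>F. U x i))"
      have "openin X (V i) \<and> p i \<in> V i" if "i < m" for i
      proof -
        have "p i \<in> topspace X" using p that K compactin_subset_topspace by blast
        moreover have "openin X (V i)"
          unfolding V_def using U[OF _ that] F(1,2) by (cases "F = {}") (auto intro!: openin_Int openin_INT2)
        ultimately show ?thesis using U[OF _ that] F(2) by (auto simp: V_def)
      qed
      moreover have "\<Phi> f = 0"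
        if f: "\<forall>i<k. f i \<in> Cc X \<and> supp X (f i) \<subseteq> K" and fV: "\<forall>i<m. supp X (f i) \<subseteq> V i" for f
      proof -
        have "\<Phi> (f(m := f m)) = 0"
        proof (rule Cc_local_induct[OF X, of "f m" "\<lambda>g. \<Phi> (f(m := g)) = 0"])
          show "f m \<in> Cc X" using f step.hyps by blast
          show z: "\<Phi> (f(m := \<lambda>x. 0)) = 0"
            using add[of m f "\<lambda>x. 0" "\<lambda>x. 0"] f step.hyps by (simp add: Cc_zero)
          show "\<Phi> (f(m := \<lambda>x. g x + h x)) = 0"
            if "g \<in> Cc X" "h \<in> Cc X" "\<Phi> (f(m := g)) = 0" "\<Phi> (f(m := h)) = 0" for g h
            using add[of m f g h] f step.hyps that by simp
          fix x assume x: "x \<in> supp X (f m)"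
          then have "x \<in> K" using f step.hyps by blast
          then obtain y where y: "y \<in> F" "x \<in> U y m" using F(3) by blast
          have "\<Phi> (f(m := g)) = 0" if g: "g \<in> Cc X" "supp X g \<subseteq> U y m \<inter> supp X (f m)" for g
          proof (rule UZ)
            show "y \<in> K" using y F by blast
            show "(f(m := g)) i \<in> Cc X \<and> supp X ((f(m := g)) i) \<subseteq> K" if "i < k" for i
              using f g that by auto
            show "supp X ((f(m := g)) i) \<subseteq> U y i" if "i < Suc m" for i
            proof (cases "i = m")
              case False
              then have "supp X (f i) \<subseteq> V i" using fV that by simp
              then show ?thesis using y(1) False by (auto simp: V_def)
            qed (use g(2) in simp)
          qed
          then show "\<exists>U. openin X U \<and> x \<in> U \<and>
              (\<forall>g\<in>Cc X. supp X g \<subseteq> U \<inter> supp X (f m) \<longrightarrow> \<Phi> (f(m := g)) = 0)"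
            using y F(2) Um(1) by blast
        qed
        then show ?thesis by simp
      qed
      ultimately show "G m p" unfolding G_def by (intro exI[of _ V]) blast
    qed
  qed
  from this[of 0] have "G 0 undefined" by simp
  then show ?thesis unfolding G_def using f by auto
qed

section \<open>Inner products in the graph correspondence\<close>

lemma local_homeomorphism_imp_continuous_map:
  assumes "local_homeomorphism X Y f"
  shows "continuous_map X Y f"
proof -
  have "\<forall>x\<in>topspace X. \<exists>U. openin X U \<and> x \<in> U \<and>
      homeomorphic_map (subtopology X U) (subtopology Y (f ` U)) f"
    using assms unfolding local_homeomorphism_def by blast
  then obtain U where U: "\<And>x. x \<in> topspace X \<Longrightarrow> openin X (U x) \<and> x \<in> U x \<and>
      homeomorphic_map (subtopology X (U x)) (subtopology Y (f ` U x)) f"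
    by metis
  show ?thesis
  proof (rule pasting_lemma[where I = "topspace X" and T = U and f = "\<lambda>i. f"])
    show "continuous_map (subtopology X (U x)) Y f" if "x \<in> topspace X" for x
      using U[OF that] homeomorphic_imp_continuous_map continuous_map_in_subtopology by blast
  qed (use U in auto)
qed

text \<open>Where the function is supported in a sheet of the local homeomorphism, summing over the fibres
  is composition with the inverse of the sheet, extended by zero; a partition of unity reduces to this
  case.\<close>

lemma fibre_sum_C0:
  assumes X: "locally_compact_space X" "Hausdorff_space X" and Y: "Hausdorff_space Y"
    and s: "local_homeomorphism X Y s" and f: "f \<in> Cc X"
  shows "(\<lambda>v. \<Sum>\<^sub>\<infinity>e\<in>{e \<in> topspace X. s e = v}. f e) \<in> C0 Y"
    and "finite {e \<in> topspace X. s e = v \<and> f e \<noteq> 0}"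
proof -
  let ?fib = "\<lambda>v. {e \<in> topspace X. s e = v}"
  define S where "S f v = infsum f (?fib v)" for f :: "'a \<Rightarrow> complex" and v
  define P where "P f \<longleftrightarrow> S f \<in> C0 Y \<and> (\<forall>v. finite {e \<in> ?fib v. f e \<noteq> 0})" for f
  note cs = local_homeomorphism_imp_continuous_map[OF s]
  have "P f"
  proof (rule Cc_local_induct[OF X f])
    show "P (\<lambda>x. 0)" by (simp add: P_def S_def[abs_def] C0_zero)
  next
    fix g h assume P: "P g" "P h"
    then have sm: "g summable_on ?fib v" "h summable_on ?fib v" for v
      unfolding P_def by (auto intro: finite_nonzero_values_imp_summable_on)
    have "S (\<lambda>x. g x + h x) = (\<lambda>v. S g v + S h v)"
      unfolding S_def[abs_def] using sm by (simp add: infsum_add)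
    moreover have "finite {e \<in> ?fib v. g e + h e \<noteq> 0}" for v
    proof (rule finite_subset)
      show "finite ({e \<in> ?fib v. g e \<noteq> 0} \<union> {e \<in> ?fib v. h e \<noteq> 0})" using P unfolding P_def by blast
    qed auto
    ultimately show "P (\<lambda>x. g x + h x)" using P by (simp add: P_def C0_add)
  next
    fix x assume "x \<in> supp X f"
    then have "x \<in> topspace X" by (rule subsetD[OF supp_subset_topspace])
    then obtain U where U: "openin X U" "x \<in> U" "openin Y (s ` U)"
        "homeomorphic_map (subtopology X U) (subtopology Y (s ` U)) s"
      using s unfolding local_homeomorphism_def by blast
    obtain t where t: "homeomorphic_maps (subtopology X U) (subtopology Y (s ` U)) s t"
      using U(4) unfolding homeomorphic_map_maps ..
    note UX = openin_subset[OF U(1)] and UY = openin_subset[OF U(3)]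
    have ts: "t (s e) = e" if "e \<in> U" for e
      using t that UX by (auto simp: homeomorphic_maps_def)
    have "P g" if g: "g \<in> Cc X" "supp X g \<subseteq> U" for g
    proof -
      have nz: "e \<in> U" "e \<in> supp X g" if "g e \<noteq> 0" for e
        using Cc_nonzero_in_supp[OF g(1) that] g(2) by auto
      have "{e \<in> ?fib v. g e \<noteq> 0} \<subseteq> {t v}" for v using nz ts by auto
      then have fin: "finite {e \<in> ?fib v. g e \<noteq> 0}" for v by (rule finite_subset) simp
      have S1: "S g v = g (t v)" if v: "v \<in> s ` U" for v
      proof -
        have "infsum g (?fib v) = infsum g {t v}"
        proof (rule infsum_cong_neutral)
          show "g e = 0" if "e \<in> ?fib v - {t v}" for e
            using that nz(1)[of e] ts[of e] by (cases "g e = 0") auto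
        qed (use v UX ts in auto)
        then show ?thesis by (simp add: S_def)
      qed
      have S0: "S g v = 0" if v: "v \<notin> s ` supp X g" for v
        unfolding S_def using v nz by (intro infsum_0) blast
      have Kc: "compactin Y (s ` supp X g)"
        using g(1) cs image_compactin by (auto simp: Cc_iff)
      have cont: "continuous_map Y euclidean (S g)"
      proof (rule pasting_lemma[where I = UNIV and T = "\<lambda>b. if b then s ` U else topspace Y - s ` supp X g"
              and f = "\<lambda>b. if b then g \<circ> t else (\<lambda>v. 0)"])
        show "openin Y (if b then s ` U else topspace Y - s ` supp X g)" for b
          using U(3) compactin_imp_closedin[OF Y Kc] by auto
        have "continuous_map (subtopology Y (s ` U)) X t"
          using t unfolding homeomorphic_maps_def continuous_map_in_subtopology by blast
        then have "continuous_map (subtopology Y (s ` U)) euclidean (g \<circ> t)"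
          using g(1) by (auto simp: Cc_iff intro: continuous_map_compose)
        then show "continuous_map (subtopology Y (if b then s ` U else topspace Y - s ` supp X g)) euclidean
            (if b then g \<circ> t else (\<lambda>v. 0))" for b
          by (cases b) simp_all
        show "(if i then g \<circ> t else (\<lambda>v. 0)) v = (if j then g \<circ> t else (\<lambda>v. 0)) v"
          if "v \<in> topspace Y \<inter> (if i then s ` U else topspace Y - s ` supp X g) \<inter>
            (if j then s ` U else topspace Y - s ` supp X g)" for i j v
          using that S1[of v] S0[of v] by (cases i; cases j) auto
        show "\<exists>j. j \<in> UNIV \<and> v \<in> (if j then s ` U else topspace Y - s ` supp X g) \<and>
            S g v = (if j then g \<circ> t else (\<lambda>v. 0)) v" if "v \<in> topspace Y" for v
        proof (cases "v \<in> s ` U")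
          case True
          then show ?thesis using S1 by (intro exI[of _ True]) simp
        next
          case False
          then have "v \<notin> s ` supp X g" using g(2) by blast
          then show ?thesis using S0 that by (intro exI[of _ False]) simp
        qed
      qed
      have "compactin Y {v \<in> topspace Y. \<epsilon> \<le> cmod (S g v)}" if "\<epsilon> > 0" for \<epsilon>
      proof (rule closed_compactin[OF Kc _ closedin_norm_ge[OF cont]])
        show "{v \<in> topspace Y. \<epsilon> \<le> cmod (S g v)} \<subseteq> s ` supp X g" using that S0 by fastforce
      qed
      moreover have "S g v = 0" if "v \<notin> topspace Y" for v
        using S0[of v] that g(2) UY by blast
      ultimately show ?thesis using cont fin by (simp add: P_def C0_def)
    qed
    then show "\<exists>U. openin X U \<and> x \<in> U \<and> (\<forall>g\<in>Cc X. supp X g \<subseteq> U \<inter> supp X f \<longrightarrow> P g)"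
      using U(1,2) by (intro exI[of _ U]) simp
  qed
  then show "(\<lambda>v. \<Sum>\<^sub>\<infinity>e\<in>{e \<in> topspace X. s e = v}. f e) \<in> C0 Y"
    and "finite {e \<in> topspace X. s e = v \<and> f e \<noteq> 0}"
    by (auto simp: P_def S_def[abs_def] conj_assoc)
qed

abbreviation fibre :: "('v, 'e) top_graph \<Rightarrow> 'v \<Rightarrow> 'e set" where
  "fibre E v \<equiv> {e \<in> topspace (edges E). src E e = v}"

lemma ip_Cc:
  assumes E: "topological_graph E" and "\<xi> \<in> Cc (edges E)" "\<eta> \<in> Cc (edges E)"
  shows "ip E \<xi> \<eta> \<in> C0 (vertices E)"
  using E fibre_sum_C0(1)[of "edges E" "vertices E" "src E", OF _ _ _ _ Cc_cnj_mult[OF assms(2,3)]]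
  unfolding topological_graph_def ip_def[abs_def] by blast

lemma Cc_fibre_finite:
  assumes E: "topological_graph E" and "\<xi> \<in> Cc (edges E)"
  shows "finite {e \<in> fibre E v. \<xi> e \<noteq> 0}"
  using E fibre_sum_C0(2)[of "edges E" "vertices E" "src E", OF _ _ _ _ assms(2)]
  unfolding topological_graph_def by (simp add: conj_assoc)

definition fibre_norm :: "('v, 'e) top_graph \<Rightarrow> ('e \<Rightarrow> complex) \<Rightarrow> 'v \<Rightarrow> real" where
  "fibre_norm E \<zeta> v = sqrt (\<Sum>\<^sub>\<infinity>e\<in>fibre E v. (cmod (\<zeta> e))\<^sup>2)"

lemma fibre_norm_nonneg: "0 \<le> fibre_norm E \<zeta> v"
  by (simp add: fibre_norm_def infsum_nonneg)

text \<open>A bound on the finite partial sums makes the infinite sum that defines \<open>ip E \<zeta> \<zeta> v\<close> a genuine one,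
  rather than the default value of a divergent sum.\<close>
lemma fibre_l2:
  assumes B: "\<And>F. finite F \<Longrightarrow> F \<subseteq> fibre E v \<Longrightarrow> L2_set (\<lambda>e. cmod (\<zeta> e)) F \<le> B"
  shows "ip E \<zeta> \<zeta> v = of_real ((fibre_norm E \<zeta> v)\<^sup>2)"
    and "fibre_norm E \<zeta> v \<le> B"
    and "finite F \<Longrightarrow> F \<subseteq> fibre E v \<Longrightarrow> L2_set (\<lambda>e. cmod (\<zeta> e)) F \<le> fibre_norm E \<zeta> v"
proof -
  let ?q = "\<lambda>e. (cmod (\<zeta> e))\<^sup>2"
  have B0: "0 \<le> B" using B[of "{}"] by simp
  have le: "sum ?q F \<le> B\<^sup>2" if "finite F" "F \<subseteq> fibre E v" for F
    using B[OF that] B0 by (simp add: L2_set_def real_sqrt_le_iff' sqrt_le_D)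
  have sm: "?q summable_on fibre E v"
    by (rule nonneg_bdd_above_summable_on) (auto intro!: bdd_aboveI2[of _ _ "B\<^sup>2"] le)
  have n2: "(fibre_norm E \<zeta> v)\<^sup>2 = infsum ?q (fibre E v)"
    by (simp add: fibre_norm_def infsum_nonneg)
  have "((\<lambda>e. complex_of_real (?q e)) has_sum complex_of_real (infsum ?q (fibre E v))) (fibre E v)"
    using has_sum_infsum[OF sm] by (simp add: has_sum_of_real_iff del: of_real_power)
  then have "(\<Sum>\<^sub>\<infinity>e\<in>fibre E v. complex_of_real (?q e)) = complex_of_real (infsum ?q (fibre E v))"
    by (rule infsumI)
  moreover have "cnj z * z = complex_of_real ((cmod z)\<^sup>2)" for z
    by (simp add: complex_norm_square mult.commute del: of_real_power)
  ultimately show "ip E \<zeta> \<zeta> v = of_real ((fibre_norm E \<zeta> v)\<^sup>2)"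
    unfolding ip_def n2 by (simp del: of_real_power)
  have "infsum ?q (fibre E v) \<le> B\<^sup>2" using sm le by (rule infsum_le_finite_sums)
  then show "fibre_norm E \<zeta> v \<le> B" unfolding fibre_norm_def using B0 by (simp add: real_le_lsqrt infsum_nonneg)
  show "L2_set (\<lambda>e. cmod (\<zeta> e)) F \<le> fibre_norm E \<zeta> v" if "finite F" "F \<subseteq> fibre E v"
    unfolding fibre_norm_def L2_set_def using sm that
    by (intro real_sqrt_le_mono finite_sum_le_infsum) auto
qed

text \<open>Fibres are discrete, so they meet a compact support in a finite set.\<close>
lemma Cc_L2_bound:
  assumes E: "topological_graph E" and g: "g \<in> Cc (edges E)" and F: "finite F" "F \<subseteq> fibre E v"
  shows "L2_set (\<lambda>e. cmod (g e)) F \<le> L2_set (\<lambda>e. cmod (g e)) {e \<in> fibre E v. g e \<noteq> 0}"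
proof -
  have "(\<Sum>e\<in>F. (cmod (g e))\<^sup>2) = (\<Sum>e\<in>{e \<in> F. g e \<noteq> 0}. (cmod (g e))\<^sup>2)"
    using F(1) by (intro sum.mono_neutral_right) auto
  also have "\<dots> \<le> (\<Sum>e\<in>{e \<in> fibre E v. g e \<noteq> 0}. (cmod (g e))\<^sup>2)"
    using F(2) Cc_fibre_finite[OF E g] by (intro sum_mono2) auto
  finally show ?thesis by (simp add: L2_set_def)
qed

lemma Cc_fibre_norm:
  assumes E: "topological_graph E" and g: "g \<in> Cc (edges E)"
  shows "ip E g g v = of_real ((fibre_norm E g v)\<^sup>2)"
    and "finite F \<Longrightarrow> F \<subseteq> fibre E v \<Longrightarrow> L2_set (\<lambda>e. cmod (g e)) F \<le> fibre_norm E g v"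
  by (rule fibre_l2(1), rule Cc_L2_bound[OF E g], assumption+)
    (rule fibre_l2(3), rule Cc_L2_bound[OF E g], assumption+)

lemma Cc_fibre_norm_le_hnrm:
  assumes E: "topological_graph E" and g: "g \<in> Cc (edges E)"
  shows "fibre_norm E g v \<le> hnrm E g"
proof -
  obtain M where M: "\<And>v. cmod (ip E g g v) \<le> M" using C0_bounded[OF ip_Cc[OF E g g]] by blast
  have "bdd_above (range (\<lambda>v. Re (ip E g g v)))"
    using order_trans[OF complex_Re_le_cmod M] by (intro bdd_aboveI[of _ M]) auto
  then have "Re (ip E g g v) \<le> (SUP v. Re (ip E g g v))" by (rule cSUP_upper[OF UNIV_I])
  then have "sqrt (Re (ip E g g v)) \<le> hnrm E g"
    unfolding hnrm_def by (rule real_sqrt_le_mono)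
  then show ?thesis by (simp add: Cc_fibre_norm(1)[OF E g] fibre_norm_nonneg flip: of_real_power)
qed

text \<open>By the triangle inequality in each fibre, uniform approximation of \<open>\<zeta>\<close> in the fibre norm is uniform
  approximation of \<open>\<langle>\<zeta>, \<zeta>\<rangle>\<close> by elements of \<open>C0\<close>.\<close>

lemma ip_C0_of_approx:
  assumes E: "topological_graph E"
    and approx: "\<And>\<epsilon>. \<epsilon> > 0 \<Longrightarrow> \<exists>g\<in>Cc (edges E). \<forall>v F. finite F \<longrightarrow> F \<subseteq> fibre E v \<longrightarrow>
      L2_set (\<lambda>e. cmod (\<zeta> e - g e)) F \<le> \<epsilon>"
  shows "ip E \<zeta> \<zeta> \<in> C0 (vertices E)"
proof -
  have tri: "L2_set (\<lambda>e. cmod (f e)) F \<le> L2_set (\<lambda>e. cmod (f e - g e)) F + L2_set (\<lambda>e. cmod (g e)) F"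
    for f g :: "'b \<Rightarrow> complex" and F
  proof -
    have "cmod (f e) \<le> cmod (f e - g e) + cmod (g e)" for e
      using norm_triangle_ineq[of "f e - g e" "g e"] by simp
    then have "L2_set (\<lambda>e. cmod (f e)) F \<le> L2_set (\<lambda>e. cmod (f e - g e) + cmod (g e)) F"
      by (intro L2_set_mono) simp_all
    also have "\<dots> \<le> L2_set (\<lambda>e. cmod (f e - g e)) F + L2_set (\<lambda>e. cmod (g e)) F"
      by (rule L2_set_triangle_ineq)
    finally show ?thesis .
  qed
  obtain g\<^sub>1 where g\<^sub>1: "g\<^sub>1 \<in> Cc (edges E)" "\<And>v F. finite F \<Longrightarrow> F \<subseteq> fibre E v \<Longrightarrow>
      L2_set (\<lambda>e. cmod (\<zeta> e - g\<^sub>1 e)) F \<le> 1"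
    using approx[of 1] by auto
  define M where "M = 1 + hnrm E g\<^sub>1"
  have bd: "L2_set (\<lambda>e. cmod (\<zeta> e)) F \<le> M" if "finite F" "F \<subseteq> fibre E v" for F v
    using tri[of \<zeta> F g\<^sub>1] g\<^sub>1(2)[OF that] Cc_fibre_norm(2)[OF E g\<^sub>1(1) that] Cc_fibre_norm_le_hnrm[OF E g\<^sub>1(1), of v]
    by (simp add: M_def)
  have l2: "ip E \<zeta> \<zeta> v = of_real ((fibre_norm E \<zeta> v)\<^sup>2)" "fibre_norm E \<zeta> v \<le> M"
      "\<And>F. finite F \<Longrightarrow> F \<subseteq> fibre E v \<Longrightarrow> L2_set (\<lambda>e. cmod (\<zeta> e)) F \<le> fibre_norm E \<zeta> v" for v
    by (rule fibre_l2(1), rule bd, assumption+)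
      (rule fibre_l2(2), rule bd, assumption+, rule fibre_l2(3), rule bd, assumption+)
  have M: "M \<ge> 1"
    using Cc_fibre_norm_le_hnrm[OF E g\<^sub>1(1)] fibre_norm_nonneg[of E g\<^sub>1] by (simp add: M_def) (meson order_trans)
  show ?thesis
  proof (rule C0_uniform_limit)
    fix \<epsilon> :: real assume \<epsilon>: "\<epsilon> > 0"
    \<comment> \<open>If \<open>a, b\<close> are the fibre norms of \<open>\<zeta>, g\<close>, then
      \<open>\<bar>a\<^sup>2 - b\<^sup>2\<bar> = \<bar>a - b\<bar> (a + b) \<le> \<delta> (2 M + 1)\<close>.\<close>
    define \<delta> where "\<delta> = min 1 (\<epsilon> / (2 * M + 1))"
    have \<delta>: "\<delta> > 0" "\<delta> \<le> 1" using \<epsilon> M by (auto simp: \<delta>_def)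
    have "\<delta> \<le> \<epsilon> / (2 * M + 1)" unfolding \<delta>_def by simp
    then have \<delta>_le: "\<delta> * (2 * M + 1) \<le> \<epsilon>" using M by (simp add: pos_le_divide_eq)
    obtain g where g: "g \<in> Cc (edges E)" "\<And>v F. finite F \<Longrightarrow> F \<subseteq> fibre E v \<Longrightarrow>
      L2_set (\<lambda>e. cmod (\<zeta> e - g e)) F \<le> \<delta>"
      using approx[OF \<delta>(1)] by auto
    have "cmod (ip E \<zeta> \<zeta> v - ip E g g v) \<le> \<epsilon>" for v
    proof -
      let ?a = "fibre_norm E \<zeta> v" and ?b = "fibre_norm E g v"
      have "?a \<le> \<delta> + ?b"
      proof (rule fibre_l2(2))
        fix F assume F: "finite F" "F \<subseteq> fibre E v"
        show "L2_set (\<lambda>e. cmod (\<zeta> e)) F \<le> \<delta> + ?b"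
          using tri[of \<zeta> F g] g(2)[OF F] Cc_fibre_norm(2)[OF E g(1) F] by simp
      qed
      moreover have "?b \<le> \<delta> + ?a"
      proof (rule fibre_l2(2))
        fix F assume F: "finite F" "F \<subseteq> fibre E v"
        have "L2_set (\<lambda>e. cmod (g e - \<zeta> e)) F = L2_set (\<lambda>e. cmod (\<zeta> e - g e)) F"
          by (simp add: norm_minus_commute)
        then show "L2_set (\<lambda>e. cmod (g e)) F \<le> \<delta> + ?a"
          using tri[of g F \<zeta>] g(2)[OF F] l2(3)[OF F] by simp
      qed
      moreover have "?a \<le> M" using l2(2)[of v] by simp
      ultimately have "\<bar>?a - ?b\<bar> \<le> \<delta>" "?a + ?b \<le> 2 * M + 1" using \<delta> by auto
      then have "\<bar>?a - ?b\<bar> * (?a + ?b) \<le> \<delta> * (2 * M + 1)"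
        using \<delta>(1) fibre_norm_nonneg[of E] by (intro mult_mono) auto
      moreover have "\<bar>?a\<^sup>2 - ?b\<^sup>2\<bar> = \<bar>?a - ?b\<bar> * (?a + ?b)"
        using fibre_norm_nonneg[of E \<zeta> v] fibre_norm_nonneg[of E g v]
        by (simp add: power2_eq_square square_diff_square_factored abs_mult)
      moreover have "ip E \<zeta> \<zeta> v - ip E g g v = of_real (?a\<^sup>2 - ?b\<^sup>2)"
        using l2(1)[of v] Cc_fibre_norm(1)[OF E g(1)] by simp
      ultimately show ?thesis using \<delta>_le by (simp only: norm_of_real)
    qed
    then show "\<exists>f\<in>C0 (vertices E). \<forall>v. cmod (ip E \<zeta> \<zeta> v - f v) \<le> \<epsilon>"
      using ip_Cc[OF E g(1) g(1)] by blast
  qed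
qed

lemma Cc_subset_H: "Cc (edges E) \<subseteq> H E"
proof
  fix f assume "f \<in> Cc (edges E)"
  moreover have "hnrm E (\<lambda>e. 0) = 0" by (simp add: hnrm_def ip_def)
  ultimately show "f \<in> H E" unfolding H_def by (auto intro!: exI[of _ "\<lambda>n. f"])
qed

text \<open>A Cauchy sequence for the norm of the completion converges in the fibre norm, uniformly over the
  fibres, to its pointwise limit.  That \<open>\<langle>\<zeta>, \<zeta>\<rangle>\<close> lies in \<open>C0\<close> for the differences \<open>\<zeta>\<close> is part of the
  conclusion because \<open>\<pi>0\<close> is a contraction on \<open>C0\<close> and is not controlled elsewhere.\<close>
lemma H_approx:
  fixes E :: "('v, 'e) top_graph"
  assumes E: "topological_graph E" and \<xi>: "\<xi> \<in> H E"
  obtains \<sigma> :: "nat \<Rightarrow> 'e \<Rightarrow> complex" where "\<And>n. \<sigma> n \<in> Cc (edges E)" "\<And>n. (\<lambda>e. \<xi> e - \<sigma> n e) \<in> H E"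
    "\<And>n. ip E (\<lambda>e. \<xi> e - \<sigma> n e) (\<lambda>e. \<xi> e - \<sigma> n e) \<in> C0 (vertices E)"
    "\<And>\<epsilon>. \<epsilon> > 0 \<Longrightarrow> \<exists>N. \<forall>n\<ge>N. \<forall>v. cmod (ip E (\<lambda>e. \<xi> e - \<sigma> n e) (\<lambda>e. \<xi> e - \<sigma> n e) v) \<le> \<epsilon>\<^sup>2"
proof -
  obtain \<sigma> where \<sigma>: "\<And>n. \<sigma> n \<in> Cc (edges E)"
      "\<And>\<epsilon>. \<epsilon> > 0 \<Longrightarrow> \<exists>N. \<forall>m\<ge>N. \<forall>n\<ge>N. hnrm E (\<lambda>e. \<sigma> m e - \<sigma> n e) < \<epsilon>"
      "\<And>e. (\<lambda>n. \<sigma> n e) \<longlonglongrightarrow> \<xi> e"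
    using \<xi> unfolding H_def by blast
  have tail: "\<exists>N. \<forall>n\<ge>N. \<forall>v F. finite F \<longrightarrow> F \<subseteq> fibre E v \<longrightarrow> L2_set (\<lambda>e. cmod (\<xi> e - \<sigma> n e)) F \<le> \<epsilon>"
    if "\<epsilon> > 0" for \<epsilon>
  proof -
    obtain N where N: "\<And>m n. m \<ge> N \<Longrightarrow> n \<ge> N \<Longrightarrow> hnrm E (\<lambda>e. \<sigma> m e - \<sigma> n e) < \<epsilon>"
      using \<sigma>(2)[of \<epsilon>] \<open>\<epsilon> > 0\<close> by metis
    have "L2_set (\<lambda>e. cmod (\<xi> e - \<sigma> n e)) F \<le> \<epsilon>" if n: "n \<ge> N" and F: "finite F" "F \<subseteq> fibre E v" for n v F
    proof (rule tendsto_upperbound)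
      show "(\<lambda>m. L2_set (\<lambda>e. cmod (\<sigma> m e - \<sigma> n e)) F) \<longlonglongrightarrow> L2_set (\<lambda>e. cmod (\<xi> e - \<sigma> n e)) F"
        unfolding L2_set_def by (intro tendsto_intros \<sigma>(3))
      have "L2_set (\<lambda>e. cmod (\<sigma> m e - \<sigma> n e)) F \<le> \<epsilon>" if "m \<ge> N" for m
        using Cc_fibre_norm(2)[OF E Cc_diff[OF \<sigma>(1) \<sigma>(1)] F, of m n] N[OF that n]
          Cc_fibre_norm_le_hnrm[OF E Cc_diff[OF \<sigma>(1) \<sigma>(1)], of m n v] by linarith
      then show "\<forall>\<^sub>F m in sequentially. L2_set (\<lambda>e. cmod (\<sigma> m e - \<sigma> n e)) F \<le> \<epsilon>"
        by (auto simp: eventually_sequentially)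
    qed simp
    then show ?thesis by blast
  qed
  show ?thesis
  proof (rule that[of \<sigma>])
    fix n :: nat
    show "(\<lambda>e. \<xi> e - \<sigma> n e) \<in> H E"
      unfolding H_def
    proof (intro CollectI exI[of _ "\<lambda>(m::nat) e. \<sigma> m e - \<sigma> n e"] conjI allI impI)
      show "(\<lambda>e. \<sigma> m e - \<sigma> n e) \<in> Cc (edges E)" for m by (rule Cc_diff[OF \<sigma>(1) \<sigma>(1)])
      show "\<exists>N. \<forall>m\<ge>N. \<forall>k\<ge>N. hnrm E (\<lambda>e. \<sigma> m e - \<sigma> n e - (\<sigma> k e - \<sigma> n e)) < \<epsilon>" if "\<epsilon> > 0" for \<epsilon>
        using \<sigma>(2)[OF that] by simp
      show "(\<lambda>m. \<sigma> m e - \<sigma> n e) \<longlonglongrightarrow> \<xi> e - \<sigma> n e" for e by (intro tendsto_intros \<sigma>(3))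
    qed
    show "ip E (\<lambda>e. \<xi> e - \<sigma> n e) (\<lambda>e. \<xi> e - \<sigma> n e) \<in> C0 (vertices E)"
    proof (rule ip_C0_of_approx[OF E])
      fix \<epsilon> :: real assume "\<epsilon> > 0"
      obtain N where "\<forall>n\<ge>N. \<forall>v F. finite F \<longrightarrow> F \<subseteq> fibre E v \<longrightarrow> L2_set (\<lambda>e. cmod (\<xi> e - \<sigma> n e)) F \<le> \<epsilon>"
        using tail[OF \<open>\<epsilon> > 0\<close>] ..
      from this[rule_format, OF order_refl] show "\<exists>g\<in>Cc (edges E). \<forall>v F. finite F \<longrightarrow> F \<subseteq> fibre E v \<longrightarrow>
          L2_set (\<lambda>e. cmod (\<xi> e - \<sigma> n e - g e)) F \<le> \<epsilon>"
        by (intro bexI[of _ "\<lambda>e. \<sigma> N e - \<sigma> n e"] Cc_diff[OF \<sigma>(1) \<sigma>(1)]) simp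
    qed
  next
    fix \<epsilon> :: real assume "\<epsilon> > 0"
    obtain N where "\<forall>n\<ge>N. \<forall>v F. finite F \<longrightarrow> F \<subseteq> fibre E v \<longrightarrow> L2_set (\<lambda>e. cmod (\<xi> e - \<sigma> n e)) F \<le> \<epsilon>"
      using tail[OF \<open>\<epsilon> > 0\<close>] ..
    note N = this[rule_format]
    have "cmod (ip E (\<lambda>e. \<xi> e - \<sigma> n e) (\<lambda>e. \<xi> e - \<sigma> n e) v) \<le> \<epsilon>\<^sup>2" if "n \<ge> N" for n v
    proof -
      have l2: "ip E (\<lambda>e. \<xi> e - \<sigma> n e) (\<lambda>e. \<xi> e - \<sigma> n e) v =
            of_real ((fibre_norm E (\<lambda>e. \<xi> e - \<sigma> n e) v)\<^sup>2)"
          "fibre_norm E (\<lambda>e. \<xi> e - \<sigma> n e) v \<le> \<epsilon>"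
        by (rule fibre_l2(1), rule N[OF that], assumption+)
          (rule fibre_l2(2), rule N[OF that], assumption+)
      have "cmod (complex_of_real ((fibre_norm E (\<lambda>e. \<xi> e - \<sigma> n e) v)\<^sup>2)) \<le> \<epsilon>\<^sup>2"
        using power_mono[OF l2(2) fibre_norm_nonneg, of 2] by (simp add: norm_of_real del: of_real_power)
      then show ?thesis using l2(1) by simp
    qed
    then show "\<exists>N. \<forall>n\<ge>N. \<forall>v. cmod (ip E (\<lambda>e. \<xi> e - \<sigma> n e) (\<lambda>e. \<xi> e - \<sigma> n e) v) \<le> \<epsilon>\<^sup>2"
      by blast
  qed (rule \<sigma>(1))
qed

section \<open>Words in a C*-algebra and tracial functionals\<close>

text \<open>The algebra need not have a unit, so only nonempty words are meaningful.\<close>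

fun word_prod :: "'a cstar \<Rightarrow> 'a list \<Rightarrow> 'a" where
  "word_prod A [] = zer A"
| "word_prod A [x] = x"
| "word_prod A (x # y # ys) = mul A x (word_prod A (y # ys))"

definition tracial_functional :: "'a cstar \<Rightarrow> ('a \<Rightarrow> complex) \<Rightarrow> bool" where
  "tracial_functional A \<tau> \<longleftrightarrow>
     (\<forall>x\<in>carrier A. \<forall>y\<in>carrier A. \<tau> (add A x y) = \<tau> x + \<tau> y) \<and>
     (\<forall>c. \<forall>x\<in>carrier A. \<tau> (scl A c x) = c * \<tau> x) \<and>
     (\<forall>x\<in>carrier A. \<forall>y\<in>carrier A. \<tau> (mul A x y) = \<tau> (mul A y x))"

context cstar_algebra
begin

lemma mul_zer: "x \<in> carrier A \<Longrightarrow> x \<otimes> \<zero> = \<zero>"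
  using mul_scl[of x "\<zero>" 0] by (simp add: scl_0 zer_closed mul_closed)

lemma zer_mul: "x \<in> carrier A \<Longrightarrow> \<zero> \<otimes> x = \<zero>"
  using scl_mul[of "\<zero>" x 0] by (simp add: scl_0 zer_closed mul_closed)

lemma star_zer: "star A \<zero> = \<zero>"
  using star_scl[OF zer_closed, of 0] by (simp add: scl_0 zer_closed star_closed)

lemma eq_zer_if_star_mul_zer: "x \<in> carrier A \<Longrightarrow> star A x \<otimes> x = \<zero> \<Longrightarrow> x = \<zero>"
  using cstar_identity[of x] nrm_eq_0[of x] by (simp add: nrm_zer)

lemma word_prod_closed: "set xs \<subseteq> carrier A \<Longrightarrow> word_prod A xs \<in> carrier A"
  by (induction xs rule: induct_list012) (auto simp: zer_closed mul_closed)

lemma word_prod_Cons: "xs \<noteq> [] \<Longrightarrow> word_prod A (x # xs) = x \<otimes> word_prod A xs"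
  by (cases xs) simp_all

lemma word_prod_append:
  "\<lbrakk>set xs \<subseteq> carrier A; set ys \<subseteq> carrier A; xs \<noteq> []; ys \<noteq> []\<rbrakk> \<Longrightarrow>
    word_prod A (xs @ ys) = word_prod A xs \<otimes> word_prod A ys"
proof (induction xs)
  case (Cons x xs)
  then show ?case
    by (cases "xs = []") (simp_all add: word_prod_Cons word_prod_closed mul_assoc)
qed simp

lemma word_prod_star:
  "\<lbrakk>set xs \<subseteq> carrier A; xs \<noteq> []\<rbrakk> \<Longrightarrow> star A (word_prod A xs) = word_prod A (rev (map (star A) xs))"
proof (induction xs)
  case (Cons x xs)
  show ?case
  proof (cases "xs = []")
    case False
    have "set (rev (map (star A) xs)) \<subseteq> carrier A" using Cons.prems star_closed by auto
    then show ?thesis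
      using Cons False by (simp add: word_prod_Cons word_prod_append star_mul word_prod_closed star_closed)
  qed simp
qed simp

lemma word_prod_add:
  assumes "set xs \<subseteq> carrier A" "set ys \<subseteq> carrier A" "x \<in> carrier A" "y \<in> carrier A"
  shows "word_prod A (xs @ (x \<oplus> y) # ys) = word_prod A (xs @ x # ys) \<oplus> word_prod A (xs @ y # ys)"
proof -
  have *: "word_prod A ((x \<oplus> y) # ys) = word_prod A (x # ys) \<oplus> word_prod A (y # ys)"
    using assms by (cases "ys = []") (simp_all add: word_prod_Cons add_mul word_prod_closed)
  show ?thesis
  proof (cases "xs = []")
    case False
    then show ?thesis
      using assms * by (simp add: word_prod_append word_prod_closed add_closed mul_add)
  qed (simp add: *)
qed

lemma word_prod_left_unit:
  assumes "set xs \<subseteq> carrier A" "x \<in> carrier A" "a \<in> carrier A" "a \<otimes> x = x"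
  shows "a \<otimes> word_prod A (x # xs) = word_prod A (x # xs)"
  using assms by (cases "xs = []") (simp_all add: word_prod_Cons word_prod_closed flip: mul_assoc)

lemma word_prod_right_zero:
  assumes "set xs \<subseteq> carrier A" "x \<in> carrier A" "a \<in> carrier A" "x \<otimes> a = \<zero>"
  shows "word_prod A (xs @ [x]) \<otimes> a = \<zero>"
  using assms by (cases "xs = []") (simp_all add: word_prod_append word_prod_closed mul_assoc mul_zer)

lemma tracial_functional_zer: "tracial_functional A \<tau> \<Longrightarrow> \<tau> \<zero> = 0"
  unfolding tracial_functional_def using scl_0[OF zer_closed] zer_closed by (metis mult_zero_left)

lemma trace_cyclic:
  assumes "tracial_functional A \<tau>" "set xs \<subseteq> carrier A" "set ys \<subseteq> carrier A"
  shows "\<tau> (word_prod A (xs @ ys)) = \<tau> (word_prod A (ys @ xs))"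
proof (cases "xs = [] \<or> ys = []")
  case False
  then show ?thesis using assms by (simp add: word_prod_append word_prod_closed tracial_functional_def)
qed auto

lemma tracial_functional_star:
  assumes "tracial_functional A \<tau>"
  shows "tracial_functional A (\<lambda>x. cnj (\<tau> (star A x)))"
  using assms unfolding tracial_functional_def
  by (simp add: star_add star_scl star_mul star_closed scl_closed)

end

section \<open>Toeplitz representations\<close>

locale toeplitz_representation = cstar_algebra A for A :: "'a cstar" (structure) +
  fixes E :: "('v, 'e) top_graph" and \<pi>0 :: "('v \<Rightarrow> complex) \<Rightarrow> 'a" and \<pi>1 :: "('e \<Rightarrow> complex) \<Rightarrow> 'a"
  assumes top_graph: "topological_graph E" and toeplitz: "toeplitz_rep E A \<pi>0 \<pi>1"
begin

lemma rng_continuous: "continuous_map (edges E) (vertices E) (rng E)"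
  using top_graph by (simp add: topological_graph_def)

lemma src_continuous: "continuous_map (edges E) (vertices E) (src E)"
  using top_graph by (simp add: topological_graph_def local_homeomorphism_imp_continuous_map)

lemma pi0_closed: "a \<in> C0 (vertices E) \<Longrightarrow> \<pi>0 a \<in> carrier A"
  using toeplitz by (auto simp: toeplitz_rep_def star_hom_def C0_algebra_def)

lemma pi0_mult:
  "\<lbrakk>a \<in> C0 (vertices E); b \<in> C0 (vertices E)\<rbrakk> \<Longrightarrow> \<pi>0 a \<otimes> \<pi>0 b = \<pi>0 (\<lambda>v. a v * b v)"
  using toeplitz by (simp add: toeplitz_rep_def star_hom_def C0_algebra_def)

lemma pi0_star: "a \<in> C0 (vertices E) \<Longrightarrow> star A (\<pi>0 a) = \<pi>0 (\<lambda>v. cnj (a v))"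
  using toeplitz by (simp add: toeplitz_rep_def star_hom_def C0_algebra_def)

lemma pi0_nrm: "a \<in> C0 (vertices E) \<Longrightarrow> nrm A (\<pi>0 a) \<le> (SUP v. cmod (a v))"
  using toeplitz by (simp add: toeplitz_rep_def star_hom_def C0_algebra_def)

lemma pi0_scl: "a \<in> C0 (vertices E) \<Longrightarrow> \<pi>0 (\<lambda>v. c * a v) = c \<odot> \<pi>0 a"
  using toeplitz by (simp add: toeplitz_rep_def star_hom_def C0_algebra_def)

lemma pi0_zero: "\<pi>0 (\<lambda>v. 0) = \<zero>"
  using pi0_scl[OF C0_zero, of 0] scl_0[OF pi0_closed[OF C0_zero]] by simp

lemma pi1_closed: "\<xi> \<in> H E \<Longrightarrow> \<pi>1 \<xi> \<in> carrier A"
  using toeplitz by (auto simp: toeplitz_rep_def)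

lemma pi1_add: "\<lbrakk>\<xi> \<in> H E; \<eta> \<in> H E\<rbrakk> \<Longrightarrow> \<pi>1 (\<lambda>e. \<xi> e + \<eta> e) = \<pi>1 \<xi> \<oplus> \<pi>1 \<eta>"
  using toeplitz by (auto simp: toeplitz_rep_def)

lemma pi1_scl: "\<xi> \<in> H E \<Longrightarrow> \<pi>1 (\<lambda>e. c * \<xi> e) = c \<odot> \<pi>1 \<xi>"
  using toeplitz by (auto simp: toeplitz_rep_def)

lemma pi1_ip: "\<lbrakk>\<xi> \<in> H E; \<eta> \<in> H E\<rbrakk> \<Longrightarrow> star A (\<pi>1 \<xi>) \<otimes> \<pi>1 \<eta> = \<pi>0 (ip E \<xi> \<eta>)"
  using toeplitz by (auto simp: toeplitz_rep_def)

lemma pi0_pi1: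
  "\<lbrakk>a \<in> C0 (vertices E); \<xi> \<in> H E\<rbrakk> \<Longrightarrow> \<pi>0 a \<otimes> \<pi>1 \<xi> = \<pi>1 (\<lambda>e. a (rng E e) * \<xi> e)"
  using toeplitz by (auto simp: toeplitz_rep_def)

lemma Cc_in_H: "f \<in> Cc (edges E) \<Longrightarrow> f \<in> H E"
  using Cc_subset_H by blast

lemma Cc_left_action: "\<lbrakk>a \<in> C0 (vertices E); f \<in> Cc (edges E)\<rbrakk> \<Longrightarrow> (\<lambda>e. a (rng E e) * f e) \<in> Cc (edges E)"
  using continuous_map_compose[OF rng_continuous, of euclidean a]
  by (intro Cc_mult) (auto simp: C0_def o_def)

text \<open>The case \<open>\<xi> h = 0\<close> of the right module relation \<open>\<pi>1 \<xi> \<otimes> \<pi>0 h = \<pi>1 (\<xi> h)\<close>.  By the C*-identity it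
  follows from \<open>\<langle>\<xi>, \<xi>\<rangle> h = 0\<close>.\<close>

lemma pi1_pi0_eq_zero:
  assumes f: "f \<in> Cc (edges E)" and h: "h \<in> C0 (vertices E)"
    and z: "\<And>e. e \<in> topspace (edges E) \<Longrightarrow> f e \<noteq> 0 \<Longrightarrow> h (src E e) = 0"
  shows "\<pi>1 f \<otimes> \<pi>0 h = \<zero>"
proof (rule eq_zer_if_star_mul_zer)
  note c = pi1_closed[OF Cc_in_H[OF f]] pi0_closed[OF h]
  show "\<pi>1 f \<otimes> \<pi>0 h \<in> carrier A" using c by (rule mul_closed)
  have "ip E f f v * h v = 0" for v
  proof (cases "h v = 0")
    case False
    then have "ip E f f v = 0" unfolding ip_def using z by (intro infsum_0) auto
    then show ?thesis by simp
  qed simp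
  then have "\<pi>0 (ip E f f) \<otimes> \<pi>0 h = \<zero>"
    unfolding pi0_mult[OF ip_Cc[OF top_graph f f] h] by (simp only: pi0_zero)
  then have "star A (\<pi>1 f) \<otimes> (\<pi>1 f \<otimes> \<pi>0 h) = \<zero>"
    using c pi1_ip[OF Cc_in_H[OF f] Cc_in_H[OF f]] by (simp add: star_closed flip: mul_assoc)
  then show "star A (\<pi>1 f \<otimes> \<pi>0 h) \<otimes> (\<pi>1 f \<otimes> \<pi>0 h) = \<zero>"
    using c by (simp add: star_mul star_closed mul_closed mul_assoc mul_zer)
qed

lemma pi1_nrm_le:
  assumes \<xi>: "\<xi> \<in> H E" "ip E \<xi> \<xi> \<in> C0 (vertices E)" and \<epsilon>: "\<epsilon> \<ge> 0" "\<And>v. cmod (ip E \<xi> \<xi> v) \<le> \<epsilon>\<^sup>2"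
  shows "nrm A (\<pi>1 \<xi>) \<le> \<epsilon>"
proof -
  have "(nrm A (\<pi>1 \<xi>))\<^sup>2 = nrm A (\<pi>0 (ip E \<xi> \<xi>))"
    using cstar_identity[OF pi1_closed[OF \<xi>(1)]] pi1_ip[OF \<xi>(1) \<xi>(1)] by simp
  also have "\<dots> \<le> (SUP v. cmod (ip E \<xi> \<xi> v))" by (rule pi0_nrm[OF \<xi>(2)])
  also have "\<dots> \<le> \<epsilon>\<^sup>2" using \<epsilon>(2) by (intro cSUP_least) auto
  finally show ?thesis using \<epsilon>(1) by (rule power2_le_imp_le)
qed

text \<open>Density of the image of \<open>Cc\<close>; with it, compactness arguments can be confined to compactly
  supported functions on the edges.\<close>
lemma pi1_approx:
  assumes \<xi>: "\<xi> \<in> H E"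
  obtains \<sigma> where "\<And>n. \<sigma> n \<in> Cc (edges E)" "converges A (\<lambda>n. \<pi>1 (\<sigma> n)) (\<pi>1 \<xi>)"
proof (rule H_approx[OF top_graph \<xi>])
  fix \<sigma> :: "nat \<Rightarrow> 'e \<Rightarrow> complex"
  assume \<sigma>: "\<And>n. \<sigma> n \<in> Cc (edges E)" "\<And>n. (\<lambda>e. \<xi> e - \<sigma> n e) \<in> H E"
    "\<And>n. ip E (\<lambda>e. \<xi> e - \<sigma> n e) (\<lambda>e. \<xi> e - \<sigma> n e) \<in> C0 (vertices E)"
    "\<And>\<epsilon>. \<epsilon> > 0 \<Longrightarrow> \<exists>N. \<forall>n\<ge>N. \<forall>v. cmod (ip E (\<lambda>e. \<xi> e - \<sigma> n e) (\<lambda>e. \<xi> e - \<sigma> n e) v) \<le> \<epsilon>\<^sup>2"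
  have c: "\<pi>1 (\<sigma> n) \<in> carrier A" "\<pi>1 \<xi> \<in> carrier A" for n
    using \<xi> \<sigma>(1) by (simp_all add: pi1_closed Cc_in_H)
  have eq: "nrm A (dif A (\<pi>1 (\<sigma> n)) (\<pi>1 \<xi>)) = nrm A (\<pi>1 (\<lambda>e. \<xi> e - \<sigma> n e))" for n
  proof -
    have m: "(\<lambda>e. (-1) * \<sigma> n e) \<in> H E" using Cc_mult[OF \<sigma>(1), of "\<lambda>e. -1"] by (simp add: Cc_in_H)
    have "\<pi>1 (\<lambda>e. \<xi> e - \<sigma> n e) = \<pi>1 (\<lambda>e. \<xi> e + (-1) * \<sigma> n e)" by simp
    also have "\<dots> = \<pi>1 \<xi> \<oplus> (-1) \<odot> \<pi>1 (\<sigma> n)"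
      using pi1_add[OF \<xi> m] pi1_scl[OF Cc_in_H[OF \<sigma>(1)], of "-1" n] by simp
    finally show ?thesis using nrm_swap[OF c(2) c(1)] by (simp add: dif_def)
  qed
  have "converges A (\<lambda>n. \<pi>1 (\<sigma> n)) (\<pi>1 \<xi>)"
    unfolding converges_def eq
  proof (rule LIMSEQ_I)
    fix r :: real assume r: "r > 0"
    obtain N where N: "\<forall>n\<ge>N. \<forall>v. cmod (ip E (\<lambda>e. \<xi> e - \<sigma> n e) (\<lambda>e. \<xi> e - \<sigma> n e) v) \<le> (r/2)\<^sup>2"
      using \<sigma>(4)[of "r/2"] r by auto
    have "norm (nrm A (\<pi>1 (\<lambda>e. \<xi> e - \<sigma> n e)) - 0) < r" if "n \<ge> N" for n
      using pi1_nrm_le[OF \<sigma>(2,3), of "r/2" n] N that r nrm_nonneg[OF pi1_closed[OF \<sigma>(2)], of n] by auto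
    then show "\<exists>N. \<forall>n\<ge>N. norm (nrm A (\<pi>1 (\<lambda>e. \<xi> e - \<sigma> n e)) - 0) < r" by blast
  qed
  with \<sigma>(1) show thesis by (rule that)
qed

section \<open>Traces of products of edge functions\<close>

text \<open>Rotate the word so that it begins with the factor that \<open>h\<close> fixes from the left and ends with the one
  that \<open>h\<close> annihilates from the right.  Then moving \<open>h\<close> around the trace turns the word into \<open>0\<close>.  For
  \<open>k = 1\<close> both are the same factor.\<close>
lemma trace_creation_word_locally_zero:
  assumes \<tau>: "tracial_functional A \<tau>" and i: "i < k"
    and f: "\<And>l. l < k \<Longrightarrow> f l \<in> Cc (edges E)" and h: "h \<in> C0 (vertices E)"
    and hi: "\<pi>1 (f i) \<otimes> \<pi>0 h = \<zero>" and hj: "\<pi>0 h \<otimes> \<pi>1 (f (Suc i mod k)) = \<pi>1 (f (Suc i mod k))"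
  shows "\<tau> (word_prod A (map (\<lambda>l. \<pi>1 (f l)) [0..<k])) = 0"
proof -
  let ?w = "\<lambda>l. \<pi>1 (f l)"
  have c: "?w l \<in> carrier A" if "l < k" for l using f[OF that] by (simp add: pi1_closed Cc_in_H)
  have hc: "\<pi>0 h \<in> carrier A" by (rule pi0_closed[OF h])
  have jk: "Suc i mod k < k" using i by simp
  let ?xs = "map ?w [0..<Suc i]" and ?ys = "map ?w [Suc i..<k]"
  have cx: "set ?xs \<subseteq> carrier A" "set ?ys \<subseteq> carrier A" using c i by auto
  have "[0..<k] = [0..<Suc i] @ [Suc i..<k]" using i upt_add_eq_append[of 0 "Suc i" "k - Suc i"] by simp
  then have "\<tau> (word_prod A (map ?w [0..<k])) = \<tau> (word_prod A (?ys @ ?xs))"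
    using trace_cyclic[OF \<tau> cx] by (simp only: map_append)
  also have "\<dots> = 0"
  proof -
    let ?R = "?ys @ ?xs"
    have Rc: "word_prod A ?R \<in> carrier A" using cx by (simp add: word_prod_closed)
    obtain zs where zs: "?R = ?w (Suc i mod k) # zs"
    proof (cases "Suc i < k")
      case True
      then show ?thesis using that by (simp add: upt_conv_Cons)
    next
      case False
      then have "Suc i = k" using i by simp
      then show ?thesis using that by (simp add: upt_conv_Cons del: upt_Suc)
    qed
    have "set ?R \<subseteq> carrier A" using cx by (simp only: set_append Un_subset_iff simp_thms)
    then have "set zs \<subseteq> carrier A" unfolding zs by simp
    then have "\<pi>0 h \<otimes> word_prod A ?R = word_prod A ?R"
      unfolding zs using c[OF jk] hc hj by (intro word_prod_left_unit)
    moreover have "word_prod A ((?ys @ map ?w [0..<i]) @ [?w i]) \<otimes> \<pi>0 h = \<zero>"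
      using c i hc hi by (intro word_prod_right_zero) auto
    then have "word_prod A ?R \<otimes> \<pi>0 h = \<zero>" by simp
    moreover have "\<tau> (\<pi>0 h \<otimes> word_prod A ?R) = \<tau> (word_prod A ?R \<otimes> \<pi>0 h)"
      using \<tau> Rc hc unfolding tracial_functional_def by blast
    ultimately show ?thesis by (simp add: tracial_functional_zer[OF \<tau>])
  qed
  finally show ?thesis .
qed

lemma exists_break_of_no_cycle:
  assumes no_cycle: "\<not> (\<exists>\<alpha>. cycle E \<alpha>)" and k: "k > 0" and p: "\<And>i. i < k \<Longrightarrow> p i \<in> topspace (edges E)"
  obtains i where "i < k" "src E (p i) \<noteq> rng E (p (Suc i mod k))"
proof (rule ccontr)
  assume *: "\<not> thesis"
  note break = that
  have eq: "src E (p i) = rng E (p (Suc i mod k))" if "i < k" for i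
    using * break[OF that] by blast
  have "cycle E (map p [0..<k])"
    unfolding cycle_def graph_path_def
  proof (intro conjI)
    show "successively (\<lambda>e f. src E e = rng E f) (map p [0..<k])"
      using eq by (auto simp: successively_conv_nth)
    show "src E (last (map p [0..<k])) = rng E (hd (map p [0..<k]))"
      using eq[of "k - 1"] k by (simp add: last_map hd_map)
  qed (use k p in auto)
  then show False using no_cycle by blast
qed

text \<open>The heart of the proof.  A tuple of edges is not a cycle, so it has a break
  \<open>s(e\<^sub>i) \<noteq> r(e\<^sub>i\<^sub>+\<^sub>1)\<close>, indices modulo \<open>k\<close>.  A function \<open>h\<close> on the vertices that is \<open>1\<close> near
  \<open>r(e\<^sub>i\<^sub>+\<^sub>1)\<close> and \<open>0\<close> near \<open>s(e\<^sub>i)\<close> makes the trace vanish on functions supported near the tuple.  Tuples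
  that are not even paths are included, so no path space has to be formed: the trace is regarded as a
  \<open>k\<close>-additive functional on all of the \<open>k\<close>-fold product of the edge space.\<close>

lemma trace_creation_word_zero:
  assumes no_cycle: "\<not> (\<exists>\<alpha>. cycle E \<alpha>)" and \<tau>: "tracial_functional A \<tau>"
    and k: "k > 0" and f: "\<And>i. i < k \<Longrightarrow> f i \<in> Cc (edges E)"
  shows "\<tau> (word_prod A (map (\<lambda>i. \<pi>1 (f i)) [0..<k])) = 0"
proof -
  let ?X = "edges E" and ?Y = "vertices E"
  have X: "locally_compact_space ?X" "Hausdorff_space ?X" and Y: "locally_compact_space ?Y" "Hausdorff_space ?Y"
    using top_graph by (simp_all add: topological_graph_def)
  let ?K = "\<Union>i<k. supp ?X (f i)"
  have K: "compactin ?X ?K" using f by (intro compactin_Union) (auto simp: Cc_iff)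
  let ?\<Phi> = "\<lambda>f. \<tau> (word_prod A (map (\<lambda>i. \<pi>1 (f i)) [0..<k]))"
  show ?thesis
  proof (rule multiadditive_locally_zero[OF X K, of k ?\<Phi> f])
    fix f :: "nat \<Rightarrow> 'e \<Rightarrow> complex" and m g h
    assume m: "m < k" and f: "\<And>i. i < k \<Longrightarrow> f i \<in> Cc ?X" and gh: "g \<in> Cc ?X" "h \<in> Cc ?X"
    let ?xs = "map (\<lambda>i. \<pi>1 (f i)) [0..<m]" and ?ys = "map (\<lambda>i. \<pi>1 (f i)) [Suc m..<k]"
    have "[0..<k] = [0..<m] @ m # [Suc m..<k]"
      using m upt_add_eq_append[of 0 m "k - m"] by (simp add: upt_conv_Cons)
    then have split: "map (\<lambda>i. \<pi>1 ((f(m := u)) i)) [0..<k] = ?xs @ \<pi>1 u # ?ys" for u by simp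
    have xs: "set ?xs \<subseteq> carrier A" and ys: "set ?ys \<subseteq> carrier A"
      using f m by (auto intro!: pi1_closed Cc_in_H)
    have c: "\<pi>1 g \<in> carrier A" "\<pi>1 h \<in> carrier A" using gh by (simp_all add: pi1_closed Cc_in_H)
    have "word_prod A (?xs @ \<pi>1 u # ?ys) \<in> carrier A" if "\<pi>1 u \<in> carrier A" for u
      using xs ys that by (intro word_prod_closed) auto
    then show "?\<Phi> (f(m := \<lambda>x. g x + h x)) = ?\<Phi> (f(m := g)) + ?\<Phi> (f(m := h))"
      unfolding split pi1_add[OF Cc_in_H Cc_in_H, OF gh] word_prod_add[OF xs ys c]
      using \<tau> c unfolding tracial_functional_def by blast
  next
    fix p assume p: "\<And>i. i < k \<Longrightarrow> p i \<in> ?K"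
    then have pX: "p i \<in> topspace ?X" if "i < k" for i
      using that compactin_subset_topspace[OF K] by blast
    obtain i where i: "i < k" "src E (p i) \<noteq> rng E (p (Suc i mod k))"
      using exists_break_of_no_cycle[OF no_cycle k, of p] pX by blast
    let ?j = "Suc i mod k"
    have j: "?j < k" using k by simp
    have "src E (p i) \<in> topspace ?Y" "rng E (p ?j) \<in> topspace ?Y"
      using pX[OF i(1)] pX[OF j] src_continuous rng_continuous continuous_map_funspace by fast+
    then obtain V W where VW: "openin ?Y V" "openin ?Y W" "src E (p i) \<in> V" "rng E (p ?j) \<in> W" "disjnt V W"
      using Y(2) i(2) unfolding Hausdorff_space_def by meson
    obtain h W' where h: "h \<in> C0 ?Y" "openin ?Y W'" "rng E (p ?j) \<in> W'" "\<And>y. y \<in> W' \<Longrightarrow> h y = 1"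
        "\<And>y. h y \<noteq> 0 \<Longrightarrow> y \<in> W"
      by (rule local_unit[OF Y VW(2,4)]) (rule that)
    let ?A = "{e \<in> topspace ?X. src E e \<in> V}" and ?B = "{e \<in> topspace ?X. rng E e \<in> W'}"
    have AB: "openin ?X ?A" "openin ?X ?B"
      using openin_continuous_map_preimage[OF src_continuous VW(1)]
        openin_continuous_map_preimage[OF rng_continuous h(2)] by simp_all
    \<comment> \<open>Both conditions apply to the same index when \<open>k = 1\<close>.\<close>
    define U where "U l = (if l = i then ?A else topspace ?X) \<inter> (if l = ?j then ?B else topspace ?X)" for l
    show "\<exists>U. (\<forall>l<k. openin ?X (U l) \<and> p l \<in> U l) \<and>
        (\<forall>f. (\<forall>l<k. f l \<in> Cc ?X \<and> supp ?X (f l) \<subseteq> U l) \<longrightarrow> ?\<Phi> f = 0)"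
    proof (intro exI[of _ U] conjI allI impI)
      show "openin ?X (U l)" for l unfolding U_def using AB by (auto intro: openin_Int)
      show "p l \<in> U l" if "l < k" for l unfolding U_def using pX[OF that] VW(3) h(3) by auto
      fix f assume f: "\<forall>l<k. f l \<in> Cc ?X \<and> supp ?X (f l) \<subseteq> U l"
      have fi: "src E e \<in> V" if "f i e \<noteq> 0" for e
      proof -
        have "e \<in> U i" using f i(1) that Cc_nonzero_in_supp[of "f i" ?X e] by blast
        then show ?thesis by (simp add: U_def)
      qed
      have fj: "rng E e \<in> W'" if "f ?j e \<noteq> 0" for e
      proof -
        have "e \<in> U ?j" using f j that Cc_nonzero_in_supp[of "f ?j" ?X e] by blast
        then show ?thesis by (simp add: U_def)
      qed
      show "?\<Phi> f = 0"
      proof (rule trace_creation_word_locally_zero[OF \<tau> i(1) _ h(1)])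
        show "f l \<in> Cc ?X" if "l < k" for l using f that by blast
        have "h (src E e) = 0" if "f i e \<noteq> 0" for e
          using fi[OF that] h(5)[of "src E e"] VW(5) unfolding disjnt_def by blast
        then show "\<pi>1 (f i) \<otimes> \<pi>0 h = \<zero>"
          using f i(1) h(1) by (intro pi1_pi0_eq_zero) blast+
        have "h (rng E e) * f ?j e = f ?j e" for e using fj[of e] h(4) by (cases "f ?j e = 0") auto
        then have "(\<lambda>e. h (rng E e) * f ?j e) = f ?j" by (rule ext)
        then show "\<pi>0 h \<otimes> \<pi>1 (f ?j) = \<pi>1 (f ?j)"
          using f j h(1) by (simp only: pi0_pi1 Cc_in_H)
      qed
    qed
  qed (use f in auto)
qed

end

section \<open>Reduction of words\<close>

text \<open>Going around the cycle from a nonpositive entry, the entries stay negative until a nonnegative one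
  follows a nonpositive one.\<close>
lemma cyclic_sign_change:
  fixes d :: "nat \<Rightarrow> int"
  assumes "n > 0" "\<not> (\<forall>i<n. d i > 0)" "\<not> (\<forall>i<n. d i < 0)"
  obtains i where "i < n" "d i \<le> 0" "d (Suc i mod n) \<ge> 0"
proof (rule ccontr)
  note found = that
  assume *: "\<not> thesis"
  have step: "d (Suc i mod n) < 0" if "i < n" "d i \<le> 0" for i
    using found[OF that] * by force
  obtain i where i: "i < n" "d i \<le> 0" using assms(2) by (auto simp: not_less)
  have neg: "d ((i + Suc t) mod n) < 0" for t
  proof (induction t)
    case 0
    then show ?case using step[OF i] by simp
  next
    case (Suc t)
    then show ?case using step[of "(i + Suc t) mod n"] assms(1) by (simp add: mod_Suc_eq)
  qed
  have "d l < 0" if "l < n" for l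
  proof -
    have "(i + Suc (n - 1 - i + l)) mod n = l" using i that by simp
    then show ?thesis using neg[of "n - 1 - i + l"] by simp
  qed
  then show False using assms(3) by blast
qed

context toeplitz_representation
begin

text \<open>Each letter carries its degree under the gauge action.  Edge functions are restricted to \<open>Cc\<close>, where
  partitions of unity are available; \<open>pi1_approx\<close> compensates for this.\<close>
definition letters :: "('a \<times> int) set" where
  "letters = (\<lambda>a. (\<pi>0 a, 0)) ` C0 (vertices E) \<union> (\<lambda>f. (\<pi>1 f, 1)) ` Cc (edges E)
     \<union> (\<lambda>f. (star A (\<pi>1 f), -1)) ` Cc (edges E)"

abbreviation word_val :: "('a \<times> int) list \<Rightarrow> 'a" where
  "word_val ws \<equiv> word_prod A (map fst ws)"

abbreviation word_degree :: "('a \<times> int) list \<Rightarrow> int" where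
  "word_degree ws \<equiv> sum_list (map snd ws)"

lemma letters_closed: "p \<in> letters \<Longrightarrow> fst p \<in> carrier A"
  by (auto simp: letters_def pi0_closed pi1_closed Cc_in_H star_closed)

lemma word_closed: "set ws \<subseteq> letters \<Longrightarrow> set (map fst ws) \<subseteq> carrier A"
  using letters_closed by auto

text \<open>The products concerned are \<open>\<pi>0 a \<otimes> \<pi>0 b\<close>, \<open>\<pi>0 a \<otimes> \<pi>1 f\<close>, the adjoint of the latter, and
  \<open>star A (\<pi>1 f) \<otimes> \<pi>1 g\<close>; all are immediate from the relations of a representation.\<close>
lemma letters_merge:
  assumes "p \<in> letters" "q \<in> letters" "snd p \<le> 0" "snd q \<ge> 0"
  shows "(fst p \<otimes> fst q, snd p + snd q) \<in> letters"
proof -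
  have I0: "(\<pi>0 a, 0) \<in> letters" if "a \<in> C0 (vertices E)" for a using that by (auto simp: letters_def)
  have I1: "(\<pi>1 f, 1) \<in> letters" "(star A (\<pi>1 f), -1) \<in> letters" if "f \<in> Cc (edges E)" for f
    using that by (auto simp: letters_def)
  have S: "star A (\<pi>1 f) \<otimes> \<pi>0 a = star A (\<pi>1 (\<lambda>e. cnj (a (rng E e)) * f e))"
    if "f \<in> Cc (edges E)" "a \<in> C0 (vertices E)" for f a
  proof -
    have "star A (\<pi>0 (\<lambda>v. cnj (a v)) \<otimes> \<pi>1 f) = star A (\<pi>1 f) \<otimes> \<pi>0 a"
      using that pi0_star[OF that(2)]
      by (simp add: star_mul pi0_closed pi1_closed Cc_in_H C0_cnj pi0_star)
    then show ?thesis using pi0_pi1[OF C0_cnj[OF that(2)] Cc_in_H[OF that(1)]] by simp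
  qed
  have "p \<in> (\<lambda>a. (\<pi>0 a, 0)) ` C0 (vertices E) \<union> (\<lambda>f. (star A (\<pi>1 f), -1)) ` Cc (edges E)"
    "q \<in> (\<lambda>a. (\<pi>0 a, 0)) ` C0 (vertices E) \<union> (\<lambda>f. (\<pi>1 f, 1)) ` Cc (edges E)"
    using assms by (auto simp: letters_def)
  then show ?thesis
    using Cc_left_action[OF C0_cnj]
    by (auto simp: pi0_mult C0_mult pi0_pi1 Cc_in_H Cc_left_action pi1_ip ip_Cc[OF top_graph] S intro!: I0 I1)
qed

lemma trace_creation_list_zero:
  assumes no_cycle: "\<not> (\<exists>\<alpha>. cycle E \<alpha>)" and \<tau>: "tracial_functional A \<tau>"
    and xs: "xs \<noteq> []" "set xs \<subseteq> \<pi>1 ` Cc (edges E)"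
  shows "\<tau> (word_prod A xs) = 0"
proof -
  have "\<forall>i. \<exists>f. i < length xs \<longrightarrow> f \<in> Cc (edges E) \<and> xs ! i = \<pi>1 f"
    using xs(2) nth_mem by blast
  then obtain f where f: "\<And>i. i < length xs \<Longrightarrow> f i \<in> Cc (edges E) \<and> xs ! i = \<pi>1 (f i)" by metis
  then have "xs = map (\<lambda>i. \<pi>1 (f i)) [0..<length xs]" by (intro nth_equalityI) auto
  then show ?thesis
    using trace_creation_word_zero[OF no_cycle \<tau>, of "length xs" f] f xs(1) by simp
qed

text \<open>A trace sees words up to rotation.  Merging adjacent letters keeps the degree and shortens the word;
  when no rotation allows this, all degrees have the same strict sign.  Words of creation letters
  have been dealt with, and words of their adjoints are reduced to them by passing to the tracial functional
  \<open>\<lambda>x. cnj (\<tau> (star A x))\<close>.\<close>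
lemma trace_word_zero:
  assumes no_cycle: "\<not> (\<exists>\<alpha>. cycle E \<alpha>)" and \<tau>: "tracial_functional A \<tau>"
    and ws: "ws \<noteq> []" "set ws \<subseteq> letters" "word_degree ws \<noteq> 0"
  shows "\<tau> (word_val ws) = 0"
  using ws
proof (induction "length ws" arbitrary: ws rule: less_induct)
  case less
  let ?n = "length ws"
  have n: "?n > 0" using less.prems by simp
  have mem: "ws ! i \<in> letters" if "i < ?n" for i using less.prems that nth_mem by blast
  consider (pos) "\<forall>i<?n. snd (ws ! i) > 0" | (neg) "\<forall>i<?n. snd (ws ! i) < 0"
    | (mixed) i where "i < ?n" "snd (ws ! i) \<le> 0" "snd (ws ! (Suc i mod ?n)) \<ge> 0"
    using cyclic_sign_change[OF n, of "\<lambda>i. snd (ws ! i)"] by blast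
  then show ?case
  proof cases
    case pos
    have "fst p \<in> \<pi>1 ` Cc (edges E)" if "p \<in> set ws" for p
    proof -
      have "p \<in> letters" by (rule subsetD[OF less.prems(2) that])
      moreover have "snd p > 0" using that pos by (auto simp: in_set_conv_nth)
      ultimately show ?thesis by (auto simp: letters_def)
    qed
    then show ?thesis using less.prems(1) by (intro trace_creation_list_zero[OF no_cycle \<tau>]) auto
  next
    case neg
    let ?xs = "rev (map (\<lambda>p. star A (fst p)) ws)"
    have *: "fst p \<in> carrier A \<and> star A (fst p) \<in> \<pi>1 ` Cc (edges E)" if "p \<in> set ws" for p
    proof -
      have "p \<in> letters" by (rule subsetD[OF less.prems(2) that])
      moreover have "snd p < 0" using that neg by (auto simp: in_set_conv_nth)
      ultimately show ?thesis by (auto simp: letters_def star_star star_closed pi1_closed Cc_in_H)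
    qed
    have eq: "star A (word_prod A ?xs) = word_val ws"
    proof -
      have "star A (word_prod A ?xs) = word_prod A (map (\<lambda>p. star A (star A (fst p))) ws)"
        using * less.prems(1) by (subst word_prod_star) (auto simp: rev_map star_closed comp_def)
      also have "map (\<lambda>p. star A (star A (fst p))) ws = map fst ws" using * by (simp add: star_star)
      finally show ?thesis .
    qed
    have "cnj (\<tau> (star A (word_prod A ?xs))) = 0"
      by (rule trace_creation_list_zero[OF no_cycle tracial_functional_star[OF \<tau>]]) (use * less.prems(1) in auto)
    then show ?thesis unfolding eq by simp
  next
    case (mixed i)
    show ?thesis
    proof (cases "?n = 1")
      case True
      then obtain p where p: "ws = [p]" by (metis One_nat_def length_0_conv length_Suc_conv)
      then show ?thesis using mixed less.prems(3) by simp
    next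
      case False
      define vs where "vs = rotate i ws"
      have "vs ! 0 = ws ! i" "vs ! 1 = ws ! (Suc i mod ?n)" "length vs = ?n"
        using mixed(1) n False by (simp_all add: vs_def nth_rotate)
      moreover from this obtain p q us where vs: "vs = p # q # us"
        using n False by (cases vs rule: remdups_adj.cases) auto
      ultimately have pq: "snd p \<le> 0" "snd q \<ge> 0" and len: "?n = Suc (Suc (length us))" using mixed by auto
      have set_vs: "set vs \<subseteq> letters" using less.prems(2) by (simp add: vs_def)
      have rot: "ws = take i ws @ drop i ws" "vs = drop i ws @ take i ws"
        using mixed(1) by (simp_all add: vs_def rotate_drop_take)
      have sub: "set (map fst (take i ws)) \<subseteq> carrier A" "set (map fst (drop i ws)) \<subseteq> carrier A"
        using less.prems(2) by (intro word_closed; meson order_trans set_take_subset set_drop_subset)+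
      have "\<tau> (word_val ws) = \<tau> (word_val vs)"
        using trace_cyclic[OF \<tau> sub] rot by (metis map_append)
      have deg: "word_degree vs = word_degree ws"
        by (metis rot sum_list_append map_append add.commute)
      let ?us = "(fst p \<otimes> fst q, snd p + snd q) # us"
      have c: "fst p \<in> carrier A" "fst q \<in> carrier A" "set (map fst us) \<subseteq> carrier A"
        using set_vs vs letters_closed by auto
      have "word_val vs = word_val ?us"
        using c by (cases us) (auto simp: vs word_prod_Cons word_prod_closed mul_assoc)
      moreover have "\<tau> (word_val ?us) = 0"
      proof (rule less.hyps)
        show "length ?us < length ws" using len by simp
        show "set ?us \<subseteq> letters" using set_vs vs letters_merge[of p q] pq by simp
        show "word_degree ?us \<noteq> 0" using deg less.prems(3) by (simp add: vs)
      qed simp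
      ultimately show ?thesis using \<open>\<tau> (word_val ws) = \<tau> (word_val vs)\<close> by simp
    qed
  qed
qed

section \<open>The linear span of the words\<close>

inductive_set word_span :: "'a set" where
  zero: "\<zero> \<in> word_span"
| word: "ws \<noteq> [] \<Longrightarrow> set ws \<subseteq> letters \<Longrightarrow> word_val ws \<in> word_span"
| add: "x \<in> word_span \<Longrightarrow> y \<in> word_span \<Longrightarrow> x \<oplus> y \<in> word_span"
| scl: "x \<in> word_span \<Longrightarrow> c \<odot> x \<in> word_span"

lemma word_span_closed: "x \<in> word_span \<Longrightarrow> x \<in> carrier A"
  by (induction rule: word_span.induct)
    (simp_all add: zer_closed add_closed scl_closed word_prod_closed[OF word_closed])

lemma word_span_subalgebra: "star_subalgebra A word_span"
proof -
  have star_letter: "(star A (fst p), - snd p) \<in> letters" if "p \<in> letters" for p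
    using that by (auto simp: letters_def star_star pi0_star pi1_closed Cc_in_H C0_cnj)
  have star: "star A x \<in> word_span" if "x \<in> word_span" for x
    using that
  proof (induction rule: word_span.induct)
    case (word ws)
    have "star A (word_val ws) = word_val (rev (map (\<lambda>p. (star A (fst p), - snd p)) ws))"
      using word word_closed[of ws] by (simp add: word_prod_star rev_map comp_def)
    moreover have "\<dots> \<in> word_span"
      using word star_letter by (intro word_span.word) auto
    ultimately show ?case by simp
  qed (simp_all add: star_zer star_add star_scl word_span_closed word_span.intros)
  have wmul: "word_val ws \<otimes> y \<in> word_span" if ws: "ws \<noteq> []" "set ws \<subseteq> letters" and "y \<in> word_span" for ws y
    using that(3)
  proof (induction rule: word_span.induct)
    case zero
    then show ?case using word_closed[OF ws(2)] by (simp add: mul_zer word_prod_closed word_span.zero)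
  next
    case (word vs)
    then show ?case
      using ws word_span.word[of "ws @ vs"] word_prod_append[OF word_closed word_closed, of ws vs] by simp
  next
    case (add x y)
    then show ?case
      using word_closed[OF ws(2)] by (simp add: mul_add word_prod_closed word_span_closed word_span.add)
  next
    case (scl x c)
    then show ?case
      using word_closed[OF ws(2)] by (simp add: mul_scl word_prod_closed word_span_closed word_span.scl)
  qed
  have mul: "x \<otimes> y \<in> word_span" if "x \<in> word_span" and y: "y \<in> word_span" for x y
    using that(1)
  proof (induction rule: word_span.induct)
    case zero
    then show ?case using y by (simp add: zer_mul word_span_closed word_span.zero)
  next
    case (word ws)
    then show ?case using y by (rule wmul)
  next
    case (add x x')
    then show ?case using y by (simp add: add_mul word_span_closed word_span.add)
  next
    case (scl x c)
    then show ?case using y by (simp add: scl_mul word_span_closed word_span.scl)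
  qed
  show ?thesis
    unfolding star_subalgebra_def linear_closed_def
    by (intro conjI ballI allI subsetI word_span_closed word_span.zero word_span.add word_span.scl mul star)
qed

text \<open>The closure of the span of the words is a C*-subalgebra; by density of \<open>Cc\<close> it contains the
  generators.\<close>
lemma word_span_dense:
  assumes gen: "cstar_generated A (\<pi>0 ` C0 (vertices E) \<union> \<pi>1 ` H E) = carrier A" and x: "x \<in> carrier A"
  obtains \<sigma> where "\<And>n. \<sigma> n \<in> word_span" "converges A \<sigma> x"
proof -
  let ?T = "{x \<in> carrier A. \<exists>\<sigma>. (\<forall>n. \<sigma> n \<in> word_span) \<and> converges A \<sigma> x}"
  note T = closure_star_subalgebra[OF word_span_subalgebra]
  have letter: "fst p \<in> word_span" if "p \<in> letters" for p using word_span.word[of "[p]"] that by simp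
  have "\<pi>0 a \<in> ?T" if "a \<in> C0 (vertices E)" for a
  proof -
    have "\<pi>0 a \<in> word_span" using letter[of "(\<pi>0 a, 0)"] that by (auto simp: letters_def)
    then show ?thesis using T(3) by blast
  qed
  moreover have "\<pi>1 \<xi> \<in> ?T" if \<xi>: "\<xi> \<in> H E" for \<xi>
  proof (rule pi1_approx[OF \<xi>])
    fix \<sigma> :: "nat \<Rightarrow> 'e \<Rightarrow> complex"
    assume \<sigma>: "\<And>n. \<sigma> n \<in> Cc (edges E)" "converges A (\<lambda>n. \<pi>1 (\<sigma> n)) (\<pi>1 \<xi>)"
    have "\<pi>1 (\<sigma> n) \<in> word_span" for n using letter[of "(\<pi>1 (\<sigma> n), 1)"] \<sigma>(1) by (auto simp: letters_def)
    then show ?thesis using \<sigma>(2) pi1_closed[OF \<xi>]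
      by (intro CollectI conjI exI[of _ "\<lambda>n. \<pi>1 (\<sigma> n)"]) auto
  qed
  ultimately have "cstar_generated A (\<pi>0 ` C0 (vertices E) \<union> \<pi>1 ` H E) \<subseteq> ?T"
    unfolding cstar_generated_def using T(1,2) by (intro Inter_lower) blast
  then have "x \<in> ?T" using x gen by blast
  then show ?thesis using that by blast
qed

lemma gauge_word:
  assumes \<gamma>: "star_hom A A \<gamma>" and z: "cmod z = 1"
    and \<gamma>0: "\<And>a. a \<in> C0 (vertices E) \<Longrightarrow> \<gamma> (\<pi>0 a) = \<pi>0 a"
    and \<gamma>1: "\<And>\<xi>. \<xi> \<in> H E \<Longrightarrow> \<gamma> (\<pi>1 \<xi>) = z \<odot> \<pi>1 \<xi>"
    and ws: "ws \<noteq> []" "set ws \<subseteq> letters"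
  shows "\<gamma> (word_val ws) = (z powi word_degree ws) \<odot> word_val ws"
proof -
  have z0: "z \<noteq> 0" using z by auto
  have "z * cnj z = 1" using z by (simp add: complex_norm_square[symmetric])
  then have zi: "inverse z = cnj z" by (rule inverse_unique)
  have hm: "\<gamma> (x \<otimes> y) = \<gamma> x \<otimes> \<gamma> y" if "x \<in> carrier A" "y \<in> carrier A" for x y
    using \<gamma> that by (simp add: star_hom_def)
  have hs: "\<gamma> (star A x) = star A (\<gamma> x)" if "x \<in> carrier A" for x
    using \<gamma> that by (simp add: star_hom_def)
  have letter: "\<gamma> (fst p) = (z powi snd p) \<odot> fst p" if p: "p \<in> letters" for p
  proof -
    consider (a) a where "a \<in> C0 (vertices E)" "p = (\<pi>0 a, 0)"
      | (c) f where "f \<in> Cc (edges E)" "p = (\<pi>1 f, 1)"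
      | (s) f where "f \<in> Cc (edges E)" "p = (star A (\<pi>1 f), -1)"
      using p by (auto simp: letters_def)
    then show ?thesis
    proof cases
      case a
      then show ?thesis by (simp add: \<gamma>0 scl_one pi0_closed)
    next
      case c
      then show ?thesis by (simp add: \<gamma>1 Cc_in_H)
    next
      case s
      then show ?thesis
        by (simp add: hs \<gamma>1 Cc_in_H pi1_closed star_scl zi power_int_minus del: power_int_minus_left)
    qed
  qed
  show ?thesis
    using ws
  proof (induction ws)
    case (Cons p ws)
    show ?case
    proof (cases "ws = []")
      case True
      then show ?thesis using letter Cons.prems by simp
    next
      case False
      have c: "fst p \<in> carrier A" "word_val ws \<in> carrier A"
        using Cons.prems letters_closed word_closed[of ws] word_prod_closed by auto
      have "\<gamma> (word_val (p # ws)) = ((z powi snd p) \<odot> fst p) \<otimes> ((z powi word_degree ws) \<odot> word_val ws)"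
        using False Cons letter c by (simp add: word_prod_Cons hm)
      also have "\<dots> = (z powi snd p * z powi word_degree ws) \<odot> (fst p \<otimes> word_val ws)"
        using c by (simp add: scl_mul mul_scl scl_scl scl_closed mul_closed mult.commute)
      also have "z powi snd p * z powi word_degree ws = z powi word_degree (p # ws)"
        using z0 by (simp add: power_int_add)
      finally show ?thesis using False by (simp add: word_prod_Cons)
    qed
  qed simp
qed

text \<open>The gauge action fixes words of degree \<open>0\<close> and multiplies the others, on which \<open>\<tau>\<close> vanishes, by a
  scalar.\<close>
lemma trace_gauge_word_span:
  assumes no_cycle: "\<not> (\<exists>\<alpha>. cycle E \<alpha>)" and \<tau>: "tracial_functional A \<tau>"
    and \<gamma>: "star_hom A A \<gamma>" and z: "cmod z = 1"
    and \<gamma>0: "\<And>a. a \<in> C0 (vertices E) \<Longrightarrow> \<gamma> (\<pi>0 a) = \<pi>0 a"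
    and \<gamma>1: "\<And>\<xi>. \<xi> \<in> H E \<Longrightarrow> \<gamma> (\<pi>1 \<xi>) = z \<odot> \<pi>1 \<xi>"
    and x: "x \<in> word_span"
  shows "\<tau> (\<gamma> x) = \<tau> x"
proof -
  have add: "\<gamma> (x \<oplus> y) = \<gamma> x \<oplus> \<gamma> y" "\<tau> (x \<oplus> y) = \<tau> x + \<tau> y"
    if "x \<in> carrier A" "y \<in> carrier A" for x y
    using \<gamma> \<tau> that by (auto simp: star_hom_def tracial_functional_def)
  have scl: "\<gamma> (c \<odot> x) = c \<odot> \<gamma> x" "\<tau> (c \<odot> x) = c * \<tau> x" "\<gamma> x \<in> carrier A"
    if "x \<in> carrier A" for x c
    using \<gamma> \<tau> that by (auto simp: star_hom_def tracial_functional_def)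
  show ?thesis
    using x
  proof (induction rule: word_span.induct)
    case zero
    have "\<gamma> \<zero> = \<zero>"
      using scl(1)[OF zer_closed, of 0] scl(3)[OF zer_closed]
      by (simp add: scl_0 zer_closed)
    then show ?case by simp
  next
    case (word ws)
    have c: "word_val ws \<in> carrier A" using word word_closed word_prod_closed by blast
    have "\<tau> (\<gamma> (word_val ws)) = z powi word_degree ws * \<tau> (word_val ws)"
      using gauge_word[OF \<gamma> z \<gamma>0 \<gamma>1 word] scl(2)[OF c] by simp
    then show ?case
      using trace_word_zero[OF no_cycle \<tau> word] by (cases "word_degree ws = 0") auto
  qed (simp_all add: add scl word_span_closed)
qed

end

section \<open>The gauge action\<close>

lemma star_homs_agree_on_generated:
  assumes A: "cstar_algebra A" and B: "cstar_algebra B"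
    and hom: "star_hom A B \<phi>" "star_hom A B \<psi>"
    and gen: "\<And>x. x \<in> G \<Longrightarrow> x \<in> carrier A \<and> \<phi> x = \<psi> x" and x: "x \<in> cstar_generated A G"
  shows "\<phi> x = \<psi> x"
proof -
  interpret A: cstar_algebra A by fact
  interpret B: cstar_algebra B by fact
  let ?S = "{x \<in> carrier A. \<phi> x = \<psi> x}"
  have z: "\<theta> (zer A) = zer B" if "star_hom A B \<theta>" for \<theta>
  proof -
    have "\<theta> (scl A 0 (zer A)) = scl B 0 (\<theta> (zer A))" "\<theta> (zer A) \<in> carrier B"
      using that A.zer_closed by (auto simp: star_hom_def)
    then show ?thesis by (simp add: A.scl_0 A.zer_closed B.scl_0)
  qed
  have "star_subalgebra A ?S"
    unfolding star_subalgebra_def linear_closed_def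
    using hom z[OF hom(1)] z[OF hom(2)]
    by (auto simp: star_hom_def A.zer_closed A.add_closed A.scl_closed A.mul_closed A.star_closed)
  moreover have "norm_closed A ?S"
    unfolding norm_closed_def
  proof (intro allI ballI impI)
    fix \<sigma> x assume x: "x \<in> carrier A" and \<sigma>: "\<forall>n. \<sigma> n \<in> ?S" and lim: "converges A \<sigma> x"
    have conv: "converges B (\<lambda>n. \<theta> (\<sigma> n)) (\<theta> x)" if \<theta>: "star_hom A B \<theta>" for \<theta>
      unfolding converges_def
    proof (rule tendsto_sandwich[OF _ _ tendsto_const lim[unfolded converges_def]])
      show "\<forall>\<^sub>F n in sequentially. 0 \<le> nrm B (dif B (\<theta> (\<sigma> n)) (\<theta> x))"
        using \<theta> \<sigma> x by (auto simp: star_hom_def intro!: always_eventually B.nrm_nonneg B.dif_closed)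
      have "nrm B (dif B (\<theta> (\<sigma> n)) (\<theta> x)) \<le> nrm A (dif A (\<sigma> n) x)" for n
      proof -
        have s: "\<sigma> n \<in> carrier A" using \<sigma> by blast
        then have "dif B (\<theta> (\<sigma> n)) (\<theta> x) = \<theta> (dif A (\<sigma> n) x)"
          using \<theta> x by (simp add: star_hom_def dif_def A.scl_closed)
        then show ?thesis using \<theta> A.dif_closed[OF s x] by (simp add: star_hom_def)
      qed
      then show "\<forall>\<^sub>F n in sequentially. nrm B (dif B (\<theta> (\<sigma> n)) (\<theta> x)) \<le> nrm A (dif A (\<sigma> n) x)" by simp
    qed
    have "\<phi> x = \<psi> x"
    proof (rule B.converges_unique)
      show "converges B (\<lambda>n. \<phi> (\<sigma> n)) (\<phi> x)" by (rule conv[OF hom(1)])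
      show "converges B (\<lambda>n. \<phi> (\<sigma> n)) (\<psi> x)" using conv[OF hom(2)] \<sigma> by simp
    qed (use hom \<sigma> x in \<open>auto simp: star_hom_def\<close>)
    then show "x \<in> ?S" using x by simp
  qed
  moreover have "G \<subseteq> ?S" using gen by blast
  ultimately show ?thesis using x unfolding cstar_generated_def by blast
qed

text \<open>The unimodular scalars cancel in \<open>\<pi>1 \<xi> \<otimes> star A (\<pi>1 \<eta>)\<close>, so the induced homomorphism on the compact
  operators, and with it covariance, does not change.\<close>
lemma covariant_rep_gauge:
  assumes A: "cstar_algebra A" and cov: "covariant_rep E A \<pi>0 \<pi>1" and z: "cmod z = 1"
  shows "covariant_rep E A \<pi>0 (\<lambda>\<xi>. scl A z (\<pi>1 \<xi>))"
proof -
  interpret cstar_algebra A by fact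
  obtain \<phi> where toep: "toeplitz_rep E A \<pi>0 \<pi>1" and \<phi>: "induced_hom E A \<pi>1 \<phi>"
    "\<forall>a\<in>C0 (subtopology (vertices E) (regular_vertices E)). \<phi> (mult_op E (a \<circ> rng E)) = \<pi>0 a"
    using cov unfolding covariant_rep_def by blast
  have zz: "cnj z * z = 1" "z * cnj z = 1" using z by (simp_all add: complex_norm_square[symmetric] mult.commute)
  have p1: "\<pi>1 \<xi> \<in> carrier A" if "\<xi> \<in> H E" for \<xi> using toep that by (auto simp: toeplitz_rep_def)
  have p0: "\<pi>0 a \<in> carrier A" if "a \<in> C0 (vertices E)" for a
    using toep that by (auto simp: toeplitz_rep_def star_hom_def C0_algebra_def)
  have "mul A (star A (scl A z (\<pi>1 \<xi>))) (scl A z (\<pi>1 \<eta>)) = mul A (star A (\<pi>1 \<xi>)) (\<pi>1 \<eta>)"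
    "mul A (scl A z (\<pi>1 \<xi>)) (star A (scl A z (\<pi>1 \<eta>))) = mul A (\<pi>1 \<xi>) (star A (\<pi>1 \<eta>))"
    if "\<xi> \<in> H E" "\<eta> \<in> H E" for \<xi> \<eta>
    using p1 that zz
    by (simp_all add: star_scl scl_mul mul_scl scl_scl star_closed scl_closed mul_closed scl_one)
  moreover have "scl A z (scl A c x) = scl A c (scl A z x)" if "x \<in> carrier A" for c x
    using that by (simp add: scl_scl mult.commute)
  ultimately have "toeplitz_rep E A \<pi>0 (\<lambda>\<xi>. scl A z (\<pi>1 \<xi>))" "induced_hom E A (\<lambda>\<xi>. scl A z (\<pi>1 \<xi>)) \<phi>"
    using toep \<phi>(1) p1 p0 by (auto simp: toeplitz_rep_def induced_hom_def scl_closed scl_add mul_scl)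
  then show ?thesis unfolding covariant_rep_def using \<phi>(2) by blast
qed

text \<open>The definite description in \<open>gauge_action\<close> denotes: existence is the universal property, uniqueness
  holds because the generators determine a homomorphism.\<close>
lemma gauge_action_properties:
  assumes univ: "graph_algebra E A \<pi>0 \<pi>1" and z: "cmod z = 1"
  defines "\<gamma> \<equiv> gauge_action E A \<pi>0 \<pi>1 z"
  shows "star_hom A A \<gamma>" and "a \<in> C0 (vertices E) \<Longrightarrow> \<gamma> (\<pi>0 a) = \<pi>0 a"
    and "\<xi> \<in> H E \<Longrightarrow> \<gamma> (\<pi>1 \<xi>) = scl A z (\<pi>1 \<xi>)"
proof -
  have A: "cstar_algebra A" and cov: "covariant_rep E A \<pi>0 \<pi>1"
    and gen: "cstar_generated A (\<pi>0 ` C0 (vertices E) \<union> \<pi>1 ` H E) = carrier A"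
    using univ by (auto simp: graph_algebra_def)
  interpret cstar_algebra A by fact
  let ?P = "\<lambda>\<gamma>. \<gamma> \<in> extensional (carrier A) \<and> star_hom A A \<gamma> \<and>
     (\<forall>a\<in>C0 (vertices E). \<gamma> (\<pi>0 a) = \<pi>0 a) \<and> (\<forall>\<xi>\<in>H E. \<gamma> (\<pi>1 \<xi>) = scl A z (\<pi>1 \<xi>))"
  have p1: "\<pi>1 \<xi> \<in> carrier A" if "\<xi> \<in> H E" for \<xi>
    using cov that by (auto simp: covariant_rep_def toeplitz_rep_def)
  have p0: "\<pi>0 a \<in> carrier A" if "a \<in> C0 (vertices E)" for a
    using cov that by (auto simp: covariant_rep_def toeplitz_rep_def star_hom_def C0_algebra_def)
  obtain \<psi> where \<psi>: "factors_through E A \<pi>0 \<pi>1 A \<pi>0 (\<lambda>\<xi>. scl A z (\<pi>1 \<xi>)) \<psi>"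
    using graph_algebra_universal[OF univ A covariant_rep_gauge[OF A cov z]] by blast
  define \<gamma>\<^sub>1 where "\<gamma>\<^sub>1 = restrict \<psi> (carrier A)"
  have "star_hom A A \<gamma>\<^sub>1"
    using \<psi> unfolding factors_through_def star_hom_def \<gamma>\<^sub>1_def
    by (auto simp: add_closed scl_closed mul_closed star_closed)
  then have ex: "?P \<gamma>\<^sub>1"
    using \<psi> p0 p1 by (simp add: factors_through_def \<gamma>\<^sub>1_def)
  have uniq: "\<gamma>\<^sub>2 = \<gamma>\<^sub>1" if P: "?P \<gamma>\<^sub>2" for \<gamma>\<^sub>2
  proof (rule extensionalityI[of _ "carrier A"])
    fix x assume x: "x \<in> carrier A"
    have "y \<in> carrier A \<and> \<gamma>\<^sub>2 y = \<gamma>\<^sub>1 y" if "y \<in> \<pi>0 ` C0 (vertices E) \<union> \<pi>1 ` H E" for y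
      using that P ex p0 p1 by auto
    then show "\<gamma>\<^sub>2 x = \<gamma>\<^sub>1 x"
      using star_homs_agree_on_generated[OF A A, of \<gamma>\<^sub>2 \<gamma>\<^sub>1 "\<pi>0 ` C0 (vertices E) \<union> \<pi>1 ` H E" x]
        P ex x gen by blast
  qed (use P ex in auto)
  have "?P \<gamma>"
    unfolding \<gamma>_def gauge_action_def by (rule theI[where P = ?P, OF ex uniq])
  then show "star_hom A A \<gamma>" and "a \<in> C0 (vertices E) \<Longrightarrow> \<gamma> (\<pi>0 a) = \<pi>0 a"
    and "\<xi> \<in> H E \<Longrightarrow> \<gamma> (\<pi>1 \<xi>) = scl A z (\<pi>1 \<xi>)"
    by blast+
qed

lemma state_bound:
  assumes A: "cstar_algebra A" and \<tau>: "state A \<tau>" and x: "x \<in> carrier A"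
  shows "cmod (\<tau> x) \<le> nrm A x"
proof -
  interpret cstar_algebra A by fact
  let ?S = "{cmod (\<tau> x) |x. x \<in> carrier A \<and> nrm A x \<le> 1}"
  have le1: "cmod (\<tau> y) \<le> 1" if "y \<in> carrier A" "nrm A y \<le> 1" for y
    using cSup_upper[of "cmod (\<tau> y)" ?S] \<tau> that unfolding state_def by auto
  have scl: "\<tau> (scl A c y) = c * \<tau> y" if "y \<in> carrier A" for c y using \<tau> that by (simp add: state_def)
  show ?thesis
  proof (cases "x = zer A")
    case True
    then show ?thesis using scl[OF x, of 0] by (simp add: scl_0 zer_closed nrm_zer)
  next
    case False
    then have pos: "nrm A x > 0" using nrm_nonneg[OF x] nrm_eq_0[OF x] by linarith
    let ?c = "complex_of_real (1 / nrm A x)"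
    have "nrm A (scl A ?c x) = 1" using pos x by (simp add: nrm_scl norm_divide)
    then have "cmod (?c * \<tau> x) \<le> 1" using le1[OF scl_closed[OF x], of ?c] scl[OF x, of ?c] by simp
    then show ?thesis using pos by (simp add: norm_mult norm_divide divide_le_eq)
  qed
qed

theorem corollary6p8:
  fixes E :: "('v, 'e) top_graph"
    and A :: "'a cstar"
    and \<pi>0 :: "('v \<Rightarrow> complex) \<Rightarrow> 'a"
    and \<pi>1 :: "('e \<Rightarrow> complex) \<Rightarrow> 'a"
    and \<tau> :: "'a \<Rightarrow> complex"
  assumes "topological_graph E"
    and "graph_algebra E A \<pi>0 \<pi>1"
    and "\<not> (\<exists>\<alpha>. cycle E \<alpha>)"
    and "tracial_state A \<tau>"
  shows "gauge_invariant E A \<pi>0 \<pi>1 \<tau>"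
  unfolding gauge_invariant_def
proof (intro allI impI ballI)
  fix z :: complex and x assume z: "cmod z = 1" and x: "x \<in> carrier A"
  have A: "cstar_algebra A" and toep: "toeplitz_rep E A \<pi>0 \<pi>1"
    and gen: "cstar_generated A (\<pi>0 ` C0 (vertices E) \<union> \<pi>1 ` H E) = carrier A"
    using assms(2) by (auto simp: graph_algebra_def covariant_rep_def)
  interpret toeplitz_representation A E \<pi>0 \<pi>1
    using A toep assms(1) by (simp add: toeplitz_representation_def toeplitz_representation_axioms_def)
  have state: "state A \<tau>" and \<tau>: "tracial_functional A \<tau>"
    using assms(4) by (auto simp: tracial_state_def state_def tracial_functional_def)
  define \<gamma> where "\<gamma> = gauge_action E A \<pi>0 \<pi>1 z"
  note \<gamma> = gauge_action_properties[OF assms(2) z, folded \<gamma>_def]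
  have \<gamma>c: "\<gamma> y \<in> carrier A" "nrm A (\<gamma> y) \<le> nrm A y" if "y \<in> carrier A" for y
    using \<gamma>(1) that by (auto simp: star_hom_def)
  let ?D = "\<lambda>y. \<tau> (\<gamma> y) - \<tau> y"
  obtain \<sigma> where \<sigma>: "\<And>n. \<sigma> n \<in> word_span" "converges A \<sigma> x"
    by (rule word_span_dense[OF gen x]) (rule that)
  have bound: "cmod (?D x) \<le> 2 * nrm A (dif A (\<sigma> n) x)" for n
  proof -
    note s = word_span_closed[OF \<sigma>(1)]
    let ?d = "dif A (\<sigma> n) x"
    have d: "?d \<in> carrier A" by (rule dif_closed[OF s x])
    have "?D ?d = ?D (\<sigma> n) - ?D x"
      using \<gamma>(1) \<tau> s[of n] x \<gamma>c(1) by (simp add: dif_def star_hom_def tracial_functional_def scl_closed)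
    also have "?D (\<sigma> n) = 0"
      using trace_gauge_word_span[OF assms(3) \<tau> \<gamma>(1) z \<gamma>(2,3) \<sigma>(1)] by simp
    finally have "cmod (?D x) = cmod (?D ?d)" by (simp add: norm_minus_commute)
    also have "\<dots> \<le> cmod (\<tau> (\<gamma> ?d)) + cmod (\<tau> ?d)" by (rule norm_triangle_ineq4)
    also have "\<dots> \<le> nrm A (\<gamma> ?d) + nrm A ?d"
      using state_bound[OF A state] d \<gamma>c by (intro add_mono) auto
    finally show ?thesis using \<gamma>c(2)[OF d] by simp
  qed
  have "(\<lambda>n. 2 * nrm A (dif A (\<sigma> n) x)) \<longlonglongrightarrow> 2 * 0"
    using \<sigma>(2) unfolding converges_def by (intro tendsto_intros)
  then have "cmod (?D x) \<le> 2 * 0" by (rule LIMSEQ_le_const) (use bound in blast)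
  then show "\<tau> (gauge_action E A \<pi>0 \<pi>1 z x) = \<tau> x" by (simp add: \<gamma>_def)
qed

end
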